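(* Let $2\le n\le4$ and let $(\Sigma^n,\langle\,,\rangle)$ be a connected stochastically complete Riemannian manifold with $S_*:=\inf_\Sigma\mathrm{Scal}>0$, where $\mathrm{Scal}$ is its scalar curvature. There exists no codimension two weakly trapped immersion $\psi:\Sigma^n\to\Lambda^+\subset\mathbb{L}^{n+2}$ with image in the future component $\Lambda^+$ of the light cone for which $\psi^*(\langle\,,\rangle_{\mathbb{L}^{n+2}})=\lambda^2\langle\,,\rangle$, where the conformal factor $\lambda>0$ is a smooth function bounded from above.
   Context: A (not necessarily complete) Riemannian manifold $\Sigma$ is stochastically complete if for some (equivalently, any) $(x,t)\in\Sigma\times(0,+\infty)$ one has $\int_\Sigma p(x,y,t)\,dy=1$, where $p$ is the heat kernel of the Laplacian. (By Pigola-Rigoli-Setti this is equivalent to the weak Omori-Yau maximum principle: for every $v\in C^2(\Sigma)$ with $v^*=\sup_\Sigma v<+\infty$ there is a sequence $\{p_k\}\subset\Sigma$ with $v(p_k)>v^*-\frac1k$ and $\Delta v(p_k)<\frac1k$ for all $k\ge1$.) $\mathbb{L}^{n+2}$ is $\mathbb{R}^{n+2}$ with metric $-dx_1^2+dx_2^2+\cdots+dx_{n+2}^2$, standard basis $\mathbf{e}_1,\dots,\mathbf{e}_{n+2}$, and time orientation given by $\mathbf{e}_1$; $\Lambda^+=\{x\in\mathbb{L}^{n+2}:\langle x,x\rangle=0,\ x_1>0\}$. For a spacelike immersion $\psi:\Sigma^n\to\Lambda^+\subset\mathbb{L}^{n+2}$ (with $\Sigma$ given the induced metric), put $u=-\langle\psi,\mathbf{e}_1\rangle>0$.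 There is a globally defined future-pointing null normal frame $\xi=\psi$, $\eta=-\frac{1+\|\nabla u\|^2}{2u^2}\xi+\frac1u\mathbf{e}_1^\perp$ with $\langle\xi,\eta\rangle=-1$, where $\nabla u$, $\|\cdot\|$ refer to the induced metric and $\perp$ denotes the component normal to $\Sigma$. For a normal field $\zeta$ set $A_\zeta X=(\overline\nabla_X\zeta)^\top$ ($\overline\nabla$ the Levi-Civita connection of $\mathbb{L}^{n+2}$, $\top$ the tangential component) and $\theta_\zeta=\frac1n\operatorname{tr}A_\zeta$. The immersion is weakly trapped if, on $\Sigma$, either both $\theta_\xi\le0$ and $\theta_\eta\le0$ with $\theta_\xi^2+\theta_\eta^2>0$, or both $\theta_\xi\ge0$ and $\theta_\eta\ge0$ with $\theta_\xi^2+\theta_\eta^2>0$. *)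

theory Defs
  imports "HOL-Analysis.Analysis"
begin

section \<open>Smooth manifolds\<close>

text \<open>A manifold is a Hausdorff, second countable type \<open>'p\<close> with an atlas of charts \<open>(U, \<phi>)\<close> into
  \<open>real ^ 'n\<close>; its dimension is \<open>CARD('n)\<close>. The atlas need not be maximal.\<close>

type_synonym ('p, 'n) chart = "'p set \<times> ('p \<Rightarrow> real ^ 'n)"

primrec Ck_on ::
  "nat \<Rightarrow> 'a::euclidean_space set \<Rightarrow> ('a \<Rightarrow> 'b::real_normed_vector) \<Rightarrow> bool" where
  "Ck_on 0 S f \<longleftrightarrow> continuous_on S f"
| "Ck_on (Suc k) S f \<longleftrightarrow> (\<forall>x\<in>S. f differentiable (at x)) \<and>
     (\<forall>v. Ck_on k S (\<lambda>x. frechet_derivative f (at x) v))"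

text \<open>Only meaningful, and only used, for open \<open>S\<close>.\<close>

definition smooth_on ::
  "'a::euclidean_space set \<Rightarrow> ('a \<Rightarrow> 'b::real_normed_vector) \<Rightarrow> bool" where
  "smooth_on S f \<longleftrightarrow> (\<forall>k. Ck_on k S f)"

definition chart_inv :: "('p, 'n) chart \<Rightarrow> real ^ 'n \<Rightarrow> 'p" where
  "chart_inv c = inv_into (fst c) (snd c)"

definition chart_range :: "('p, 'n) chart \<Rightarrow> (real ^ 'n) set" where
  "chart_range c = snd c ` fst c"

definition smooth_atlas ::
  "('p::{t2_space, second_countable_topology}, 'n::finite) chart set \<Rightarrow> bool" where
  "smooth_atlas A \<longleftrightarrow>
     (\<Union>c\<in>A. fst c) = UNIV \<and>
     (\<forall>c\<in>A. open (fst c) \<and> open (chart_range c) \<and>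
        homeomorphism (fst c) (chart_range c) (snd c) (chart_inv c)) \<and>
     (\<forall>c\<in>A. \<forall>d\<in>A. smooth_on (snd c ` (fst c \<inter> fst d)) (snd d \<circ> chart_inv c))"

definition smooth_map ::
  "('p, 'n::finite) chart set \<Rightarrow> ('p \<Rightarrow> 'b::real_normed_vector) \<Rightarrow> bool" where
  "smooth_map A f \<longleftrightarrow> (\<forall>c\<in>A. smooth_on (chart_range c) (f \<circ> chart_inv c))"

definition pd :: "'n::finite \<Rightarrow> (real ^ 'n \<Rightarrow> 'b::real_normed_vector) \<Rightarrow> real ^ 'n \<Rightarrow> 'b" where
  "pd i F x = frechet_derivative F (at x) (axis i 1)"

text \<open>The coordinate derivative at the point \<open>p\<close> of a function on the manifold.\<close>

definition chart_pd ::
  "('p, 'n::finite) chart \<Rightarrow> 'n \<Rightarrow> ('p \<Rightarrow> 'b::real_normed_vector) \<Rightarrow> 'p \<Rightarrow> 'b" where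
  "chart_pd c i f p = pd i (f \<circ> chart_inv c) (snd c p)"

section \<open>Riemannian metrics\<close>

text \<open>A metric is given by its coordinate matrices: \<open>g c p\<close> is the matrix at \<open>p\<close> with respect to the
  coordinate frame of the chart \<open>c\<close>. Likewise the quantities below that take a chart argument
  are evaluated through that chart, and do not depend on it where they represent scalars
  or \<open>\<real>\<^sup>m\<close>-valued functions.\<close>

type_synonym ('p, 'n) metric_coeffs = "('p, 'n) chart \<Rightarrow> 'p \<Rightarrow> real ^ 'n ^ 'n"

definition transition_jacobian ::
  "('p, 'n::finite) chart \<Rightarrow> ('p, 'n) chart \<Rightarrow> 'p \<Rightarrow> real ^ 'n ^ 'n" where
  "transition_jacobian c d p =
     matrix (frechet_derivative (snd d \<circ> chart_inv c) (at (snd c p)))"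

definition pos_def_matrix :: "real ^ 'n ^ 'n \<Rightarrow> bool" where
  "pos_def_matrix G \<longleftrightarrow> transpose G = G \<and> (\<forall>v. v \<noteq> 0 \<longrightarrow> v \<bullet> (G *v v) > 0)"

definition riemannian_metric ::
  "('p, 'n::finite) chart set \<Rightarrow> ('p, 'n) metric_coeffs \<Rightarrow> bool" where
  "riemannian_metric A g \<longleftrightarrow>
     (\<forall>c\<in>A. smooth_on (chart_range c) (g c \<circ> chart_inv c)) \<and>
     (\<forall>c\<in>A. \<forall>p\<in>fst c. pos_def_matrix (g c p)) \<and>
     (\<forall>c\<in>A. \<forall>d\<in>A. \<forall>p\<in>fst c \<inter> fst d.
        g c p = transpose (transition_jacobian c d p) ** g d p ** transition_jacobian c d p)"

definition christoffel ::
  "(real ^ 'n \<Rightarrow> real ^ 'n ^ 'n) \<Rightarrow> 'n::finite \<Rightarrow> 'n \<Rightarrow> 'n \<Rightarrow> real ^ 'n \<Rightarrow> real" where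
  "christoffel G k i j x = (\<Sum>l\<in>UNIV. matrix_inv (G x) $ k $ l *
     (pd i (\<lambda>y. G y $ j $ l) x + pd j (\<lambda>y. G y $ i $ l) x - pd l (\<lambda>y. G y $ i $ j) x)) / 2"

text \<open>\<open>riemann G l k i j\<close> is the \<open>l\<close>-th component of \<open>R(\<partial>\<^sub>i, \<partial>\<^sub>j)\<partial>\<^sub>k\<close>, where
  \<open>R(X, Y) = [\<nabla>\<^sub>X, \<nabla>\<^sub>Y] - \<nabla>\<^bsub>[X, Y]\<^esub>\<close>; with the contraction below, round spheres have positive
  scalar curvature.\<close>

definition riemann ::
  "(real ^ 'n \<Rightarrow> real ^ 'n ^ 'n) \<Rightarrow> 'n::finite \<Rightarrow> 'n \<Rightarrow> 'n \<Rightarrow> 'n \<Rightarrow> real ^ 'n \<Rightarrow> real" where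
  "riemann G l k i j x =
     pd i (christoffel G l j k) x - pd j (christoffel G l i k) x +
     (\<Sum>m\<in>UNIV. christoffel G l i m x * christoffel G m j k x
               - christoffel G l j m x * christoffel G m i k x)"

definition ricci ::
  "(real ^ 'n \<Rightarrow> real ^ 'n ^ 'n) \<Rightarrow> 'n::finite \<Rightarrow> 'n \<Rightarrow> real ^ 'n \<Rightarrow> real" where
  "ricci G j k x = (\<Sum>i\<in>UNIV. riemann G i k i j x)"

definition scalar_curvature ::
  "('p, 'n::finite) metric_coeffs \<Rightarrow> ('p, 'n) chart \<Rightarrow> 'p \<Rightarrow> real" where
  "scalar_curvature g c p =
     (\<Sum>j\<in>UNIV. \<Sum>k\<in>UNIV. matrix_inv (g c p) $ j $ k * ricci (g c \<circ> chart_inv c) j k (snd c p))"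

definition inf_scalar_curvature ::
  "('p, 'n::finite) chart set \<Rightarrow> ('p, 'n) metric_coeffs \<Rightarrow> ereal" where
  "inf_scalar_curvature A g = (INF c\<in>A. INF p\<in>fst c. ereal (scalar_curvature g c p))"

text \<open>The Laplace-Beltrami operator, as the trace of the Hessian.\<close>

definition laplacian ::
  "('p, 'n::finite) metric_coeffs \<Rightarrow> ('p, 'n) chart \<Rightarrow> ('p \<Rightarrow> real) \<Rightarrow> 'p \<Rightarrow> real" where
  "laplacian g c f p = (\<Sum>i\<in>UNIV. \<Sum>j\<in>UNIV. matrix_inv (g c p) $ i $ j *
     (pd i (pd j (f \<circ> chart_inv c)) (snd c p)
      - (\<Sum>k\<in>UNIV. christoffel (g c \<circ> chart_inv c) k i j (snd c p) * chart_pd c k f p)))"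

definition grad_norm_sq ::
  "('p, 'n::finite) metric_coeffs \<Rightarrow> ('p, 'n) chart \<Rightarrow> ('p \<Rightarrow> real) \<Rightarrow> 'p \<Rightarrow> real" where
  "grad_norm_sq g c f p = (\<Sum>i\<in>UNIV. \<Sum>j\<in>UNIV.
     matrix_inv (g c p) $ i $ j * chart_pd c i f p * chart_pd c j f p)"

text \<open>These conditions determine the Riemannian measure, since countably many charts cover.\<close>

definition riemannian_volume ::
  "('p::{t2_space, second_countable_topology}, 'n::finite) chart set \<Rightarrow>
   ('p, 'n) metric_coeffs \<Rightarrow> 'p measure \<Rightarrow> bool" where
  "riemannian_volume A g \<mu> \<longleftrightarrow> sets \<mu> = sets borel \<and>
     (\<forall>c\<in>A. \<forall>B\<in>sets borel. B \<subseteq> fst c \<longrightarrow>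
        emeasure \<mu> B =
          (\<integral>\<^sup>+x\<in>snd c ` B. ennreal (sqrt (det (g c (chart_inv c x)))) \<partial>lborel))"

section \<open>The heat kernel and stochastic completeness\<close>

text \<open>The Dirichlet heat kernel of a relatively compact open set \<open>\<Omega>\<close>, extended by zero. It is unique
  by the parabolic maximum principle, and it exists if \<open>\<Omega>\<close> has smooth boundary. The Dirichlet condition
  is the continuity of the extension by zero (no condition if \<open>\<Omega>\<close> is a compact manifold).\<close>

definition dirichlet_heat_kernel ::
  "('p::{t2_space, second_countable_topology}, 'n::finite) chart set \<Rightarrow>
   ('p, 'n) metric_coeffs \<Rightarrow> 'p measure \<Rightarrow> 'p set \<Rightarrow> ('p \<Rightarrow> 'p \<Rightarrow> real \<Rightarrow> real) \<Rightarrow> bool" where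
  "dirichlet_heat_kernel A g \<mu> \<Omega> q \<longleftrightarrow>
     (\<forall>x y t. 0 \<le> q x y t) \<and>
     (\<forall>x y t. x \<notin> \<Omega> \<or> y \<notin> \<Omega> \<longrightarrow> q x y t = 0) \<and>
     continuous_on (UNIV \<times> UNIV \<times> {0<..}) (\<lambda>(x, y, t). q x y t) \<and>
     (\<forall>c\<in>A. \<forall>d\<in>A. smooth_on ((snd c ` (fst c \<inter> \<Omega>)) \<times> (snd d ` (fst d \<inter> \<Omega>)) \<times> {0<..})
        (\<lambda>(a, b, t). q (chart_inv c a) (chart_inv d b) t)) \<and>
     (\<forall>c\<in>A. \<forall>x\<in>fst c \<inter> \<Omega>. \<forall>y\<in>\<Omega>. \<forall>t>0.
        ((\<lambda>s. q x y s) has_real_derivative laplacian g c (\<lambda>z. q z y t) x) (at t)) \<and>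
     (\<forall>f. continuous_on UNIV f \<and> compact (closure {y. f y \<noteq> 0}) \<and> closure {y. f y \<noteq> 0} \<subseteq> \<Omega> \<longrightarrow>
        uniform_limit \<Omega> (\<lambda>t x. \<integral>y. q x y t * f y \<partial>\<mu>) f (at_right 0))"

text \<open>The (minimal) heat kernel of the manifold: the limit of the Dirichlet heat kernels along an
  exhaustion by relatively compact open sets. The limit does not depend on the exhaustion. On a
  compact manifold the exhaustion may be constant.\<close>

definition heat_kernel ::
  "('p::{t2_space, second_countable_topology}, 'n::finite) chart set \<Rightarrow>
   ('p, 'n) metric_coeffs \<Rightarrow> 'p measure \<Rightarrow> ('p \<Rightarrow> 'p \<Rightarrow> real \<Rightarrow> real) \<Rightarrow> bool" where
  "heat_kernel A g \<mu> p \<longleftrightarrow>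
     (\<exists>\<Omega> q. (\<forall>k. open (\<Omega> k) \<and> compact (closure (\<Omega> k)) \<and> closure (\<Omega> k) \<subseteq> \<Omega> (Suc k)) \<and>
        (\<Union>k. \<Omega> k) = UNIV \<and>
        (\<forall>k::nat. dirichlet_heat_kernel A g \<mu> (\<Omega> k) (q k)) \<and>
        (\<forall>x y t. t > 0 \<longrightarrow> (\<lambda>k. q k x y t) \<longlonglongrightarrow> p x y t))"

definition stochastically_complete ::
  "('p::{t2_space, second_countable_topology}, 'n::finite) chart set \<Rightarrow>
   ('p, 'n) metric_coeffs \<Rightarrow> bool" where
  "stochastically_complete A g \<longleftrightarrow>
     (\<exists>\<mu> p. riemannian_volume A g \<mu> \<and> heat_kernel A g \<mu> p \<and>
        (\<exists>x t. t > 0 \<and> (\<integral>\<^sup>+y. ennreal (p x y t) \<partial>\<mu>) = 1))"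

section \<open>Immersions into the light cone\<close>

text \<open>Lorentz-Minkowski space is \<open>real \<times> (real ^ 'k)\<close>, of dimension \<open>CARD('k) + 1\<close>; the first
  component is the time coordinate.\<close>

definition lorentz :: "real \<times> (real ^ 'k) \<Rightarrow> real \<times> (real ^ 'k) \<Rightarrow> real" where
  "lorentz v w = - (fst v * fst w) + snd v \<bullet> snd w"

definition e1 :: "real \<times> (real ^ 'k)" where
  "e1 = (1, 0)"

definition future_light_cone :: "(real \<times> (real ^ 'k)) set" where
  "future_light_cone = {x. lorentz x x = 0 \<and> fst x > 0}"

definition induced_metric ::
  "('p \<Rightarrow> real \<times> (real ^ 'k)) \<Rightarrow> ('p, 'n::finite) metric_coeffs" where
  "induced_metric \<psi> c p = (\<chi> i j. lorentz (chart_pd c i \<psi> p) (chart_pd c j \<psi> p))"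

definition spacelike_immersion ::
  "('p, 'n::finite) chart set \<Rightarrow> ('p \<Rightarrow> real \<times> (real ^ 'k)) \<Rightarrow> bool" where
  "spacelike_immersion A \<psi> \<longleftrightarrow> smooth_map A \<psi> \<and>
     (\<forall>c\<in>A. \<forall>p\<in>fst c. inj (frechet_derivative (\<psi> \<circ> chart_inv c) (at (snd c p))) \<and>
        pos_def_matrix (induced_metric \<psi> c p))"

text \<open>Coefficients of the tangential component of \<open>w\<close> in the frame \<open>\<partial>\<^sub>j\<psi>\<close>.\<close>

definition tangent_coeff ::
  "('p \<Rightarrow> real \<times> (real ^ 'k)) \<Rightarrow> ('p, 'n::finite) chart \<Rightarrow> 'p \<Rightarrow> real \<times> (real ^ 'k) \<Rightarrow> 'n \<Rightarrow> real"
  where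
  "tangent_coeff \<psi> c p w j =
     (\<Sum>l\<in>UNIV. matrix_inv (induced_metric \<psi> c p) $ j $ l * lorentz w (chart_pd c l \<psi> p))"

definition tangent_part ::
  "('p \<Rightarrow> real \<times> (real ^ 'k)) \<Rightarrow> ('p, 'n::finite) chart \<Rightarrow> 'p \<Rightarrow> real \<times> (real ^ 'k)
    \<Rightarrow> real \<times> (real ^ 'k)" where
  "tangent_part \<psi> c p w = (\<Sum>j\<in>UNIV. tangent_coeff \<psi> c p w j *\<^sub>R chart_pd c j \<psi> p)"

definition normal_part ::
  "('p \<Rightarrow> real \<times> (real ^ 'k)) \<Rightarrow> ('p, 'n::finite) chart \<Rightarrow> 'p \<Rightarrow> real \<times> (real ^ 'k)
    \<Rightarrow> real \<times> (real ^ 'k)" where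
  "normal_part \<psi> c p w = w - tangent_part \<psi> c p w"

text \<open>The matrix, in the frame \<open>\<partial>\<^sub>i\<psi>\<close>, of \<open>X \<mapsto> (D\<^sub>X \<zeta>)\<^sup>T\<close>, where \<open>D\<close> is the flat connection of
  Lorentz-Minkowski space. There is no minus sign.\<close>

definition shape_operator ::
  "('p \<Rightarrow> real \<times> (real ^ 'k)) \<Rightarrow> ('p \<Rightarrow> real \<times> (real ^ 'k)) \<Rightarrow> ('p, 'n::finite) chart \<Rightarrow> 'p
    \<Rightarrow> real ^ 'n ^ 'n" where
  "shape_operator \<psi> \<zeta> c p = (\<chi> j i. tangent_coeff \<psi> c p (chart_pd c i \<zeta> p) j)"

definition expansion ::
  "('p \<Rightarrow> real \<times> (real ^ 'k)) \<Rightarrow> ('p \<Rightarrow> real \<times> (real ^ 'k)) \<Rightarrow> ('p, 'n::finite) chart \<Rightarrow> 'p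
    \<Rightarrow> real" where
  "expansion \<psi> \<zeta> c p = trace (shape_operator \<psi> \<zeta> c p) / real CARD('n)"

definition height :: "('p \<Rightarrow> real \<times> (real ^ 'k)) \<Rightarrow> 'p \<Rightarrow> real" where
  "height \<psi> p = - lorentz (\<psi> p) e1"

text \<open>The null normal field \<open>\<eta>\<close> on the domain of the chart \<open>c\<close>; the other one is \<open>\<xi> = \<psi>\<close>.\<close>

definition null_eta ::
  "('p \<Rightarrow> real \<times> (real ^ 'k)) \<Rightarrow> ('p, 'n::finite) chart \<Rightarrow> 'p \<Rightarrow> real \<times> (real ^ 'k)" where
  "null_eta \<psi> c p =
     - ((1 + grad_norm_sq (induced_metric \<psi>) c (height \<psi>) p) / (2 * (height \<psi> p)\<^sup>2)) *\<^sub>R \<psi> p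
     + (1 / height \<psi> p) *\<^sub>R normal_part \<psi> c p e1"

definition theta_xi ::
  "('p \<Rightarrow> real \<times> (real ^ 'k)) \<Rightarrow> ('p, 'n::finite) chart \<Rightarrow> 'p \<Rightarrow> real" where
  "theta_xi \<psi> c p = expansion \<psi> \<psi> c p"

definition theta_eta ::
  "('p \<Rightarrow> real \<times> (real ^ 'k)) \<Rightarrow> ('p, 'n::finite) chart \<Rightarrow> 'p \<Rightarrow> real" where
  "theta_eta \<psi> c p = expansion \<psi> (null_eta \<psi> c) c p"

definition weakly_trapped ::
  "('p, 'n::finite) chart set \<Rightarrow> ('p \<Rightarrow> real \<times> (real ^ 'k)) \<Rightarrow> bool" where
  "weakly_trapped A \<psi> \<longleftrightarrow>
     (\<forall>c\<in>A. \<forall>p\<in>fst c. theta_xi \<psi> c p \<le> 0 \<and> theta_eta \<psi> c p \<le> 0 \<and>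
        (theta_xi \<psi> c p)\<^sup>2 + (theta_eta \<psi> c p)\<^sup>2 > 0) \<or>
     (\<forall>c\<in>A. \<forall>p\<in>fst c. theta_xi \<psi> c p \<ge> 0 \<and> theta_eta \<psi> c p \<ge> 0 \<and>
        (theta_xi \<psi> c p)\<^sup>2 + (theta_eta \<psi> c p)\<^sup>2 > 0)"

definition conformal_metrics ::
  "('p, 'n::finite) chart set \<Rightarrow> ('p, 'n) metric_coeffs \<Rightarrow> ('p \<Rightarrow> real) \<Rightarrow> ('p, 'n) metric_coeffs
    \<Rightarrow> bool" where
  "conformal_metrics A h lam g \<longleftrightarrow> (\<forall>c\<in>A. \<forall>p\<in>fst c. h c p = (lam p)\<^sup>2 *\<^sub>R g c p)"

end

theory Submission
  imports Defs
begin

text \<open>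
  Suppose that \<open>\<psi>\<close> is a weakly trapped immersion into the light cone with conformal factor \<open>lam\<close>, and
  let \<open>n\<close> be the dimension. The proof shows that \<open>\<Delta> lam \<ge> \<kappa> lam\<close> for some constant \<open>\<kappa> > 0\<close>, and that this is
  impossible for a bounded positive function on a stochastically complete manifold.

  The first part is geometry. As \<open>\<psi>\<close> is null, \<open>X = \<psi> / lam\<close> is again an immersion into the light cone, and
  its induced metric is \<open>g\<close>. A codimension two submanifold of the light cone is umbilical up to
  multiples of the null normal \<open>X\<close>, so that the Gauss equation reads
  \<open>Scal = (1 - 1 / n) \<langle>\<Delta> X, \<Delta> X\<rangle>\<close>, and \<open>\<langle>\<Delta> X, \<Delta> X\<rangle>\<close> is an expression in the height of \<open>X\<close>
  (\<open>scalar_curvature_mc\<close>, \<open>lorentz_mc_mc\<close>). On the other hand \<open>\<theta>\<^sub>\<xi> = 1\<close>, so weak trapping means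
  \<open>\<theta>\<^sub>\<eta> \<ge> 0\<close>. Writing \<open>\<theta>\<^sub>\<eta>\<close> in terms of \<open>X\<close> and \<open>lam\<close> (\<open>conformal_expansion\<close>) gives
  \<open>\<Delta> lam \<ge> Scal / (2 (n - 1)) lam + (4 - n) / 2 \<bar>d lam\<bar>\<^sup>2 / lam\<close>, and for \<open>n \<le> 4\<close> the last term is nonnegative
  (\<open>laplacian_conformal_factor_ge\<close>).

  The second part is analysis (\<open>no_bounded_subsolution\<close>). Let \<open>f = lam\<close> and \<open>F = sup f\<close>. The function
  \<open>exp (\<kappa> t) f\<close> is a subsolution of the heat equation, and near the supremum of \<open>f\<close> it exceeds \<open>F\<close>. If \<open>P\<close> is
  the Dirichlet heat semigroup of a relatively compact domain applied to a cut-off function,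
  the minimum principle gives \<open>exp (\<kappa> t) f \<le> F + (exp (\<kappa> t) - 1) F (1 - P)\<close> (\<open>deficit_comparison\<close>), hence a lower
  bound for \<open>1 - P\<close> near the supremum of \<open>f\<close> which is independent of the domain. Stochastic completeness is
  known at a single point and time only. So the lower bound has to be carried there, along a
  chain of coordinate balls and by means of an expanding barrier
  (\<open>positivity_spreads_in_chart\<close>, \<open>positivity_propagates\<close>); this is the strong minimum principle in a form which is
  uniform in the domain. Passing to the limit along the exhaustion, the total heat
  at that point and time is less than \<open>1\<close>.
\<close>

section \<open>Calculus of functions of class \<open>C\<^sup>k\<close>\<close>

lemma pd_eqI: "(F has_derivative F') (at x) \<Longrightarrow> pd i F x = F' (axis i 1)"
  unfolding pd_def using frechet_derivative_at by metis

lemma frechet_derivative_eqI: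
  "(F has_derivative F') (at x) \<Longrightarrow> frechet_derivative F (at x) = F'"
  using frechet_derivative_at by metis

lemma frechet_derivative_eq_sum_pd:
  fixes F :: "real ^ 'n::finite \<Rightarrow> 'b::real_normed_vector"
  assumes "F differentiable (at x)"
  shows "frechet_derivative F (at x) v = (\<Sum>i\<in>UNIV. v $ i *\<^sub>R pd i F x)"
proof -
  have lin: "linear (frechet_derivative F (at x))"
    using assms by (rule linear_frechet_derivative)
  have "v = (\<Sum>i\<in>UNIV. v $ i *\<^sub>R axis i 1)"
    by (metis (no_types) basis_expansion scalar_mult_eq_scaleR)
  then have "frechet_derivative F (at x) v
      = frechet_derivative F (at x) (\<Sum>i\<in>UNIV. v $ i *\<^sub>R axis i 1)"
    by simp
  then show ?thesis
    unfolding pd_def by (simp add: linear_sum[OF lin] linear_scale[OF lin])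
qed

lemma has_derivative_iff_cong_open:
  fixes F :: "'a::euclidean_space \<Rightarrow> 'b::real_normed_vector"
  assumes "open S" "x \<in> S" "\<And>y. y \<in> S \<Longrightarrow> F y = G y"
  shows "(F has_derivative D) (at x) \<longleftrightarrow> (G has_derivative D) (at x)"
  using has_derivative_transform_within_open[of F D x UNIV S G]
    has_derivative_transform_within_open[of G D x UNIV S F] assms by auto

lemma pd_cong:
  fixes F :: "real ^ 'n::finite \<Rightarrow> 'b::real_normed_vector"
  assumes "open S" "x \<in> S" "\<And>y. y \<in> S \<Longrightarrow> F y = G y"
  shows "pd i F x = pd i G x"
proof -
  have "(F has_derivative D) (at x) \<longleftrightarrow> (G has_derivative D) (at x)" for D
    by (rule has_derivative_iff_cong_open[OF assms])
  then show ?thesis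
    unfolding pd_def frechet_derivative_def by simp
qed

lemma frechet_derivative_cong_open:
  fixes F :: "'a::euclidean_space \<Rightarrow> 'b::real_normed_vector"
  assumes "open S" "x \<in> S" "\<And>y. y \<in> S \<Longrightarrow> F y = G y"
  shows "frechet_derivative F (at x) = frechet_derivative G (at x)"
proof -
  have "(F has_derivative D) (at x) \<longleftrightarrow> (G has_derivative D) (at x)" for D
    by (rule has_derivative_iff_cong_open[OF assms])
  then show ?thesis
    unfolding frechet_derivative_def by simp
qed

lemma differentiable_cong_open:
  fixes F :: "'a::euclidean_space \<Rightarrow> 'b::real_normed_vector"
  assumes "open S" "x \<in> S" "\<And>y. y \<in> S \<Longrightarrow> F y = G y"
  shows "F differentiable (at x) \<longleftrightarrow> G differentiable (at x)"
  unfolding differentiable_def by (intro ex_cong1 has_derivative_iff_cong_open[OF assms])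

lemma Ck_on_cong:
  assumes "open S" "\<And>x. x \<in> S \<Longrightarrow> f x = g x"
  shows "Ck_on k S f \<longleftrightarrow> Ck_on k S g"
  using assms(2)
proof (induction k arbitrary: f g)
  case 0
  then show ?case by (simp cong: continuous_on_cong)
next
  case (Suc k)
  have "frechet_derivative f (at x) v = frechet_derivative g (at x) v" if "x \<in> S" for x v
    using frechet_derivative_cong_open[OF assms(1) that Suc.prems] by simp
  then have "Ck_on k S (\<lambda>x. frechet_derivative f (at x) v)
      \<longleftrightarrow> Ck_on k S (\<lambda>x. frechet_derivative g (at x) v)" for v
    by (intro Suc.IH)
  moreover have "(\<forall>x\<in>S. f differentiable (at x)) \<longleftrightarrow> (\<forall>x\<in>S. g differentiable (at x))"
    by (intro ball_cong refl differentiable_cong_open[OF assms(1)] Suc.prems)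
  ultimately show ?case by simp
qed

lemma Ck_on_SucD: "Ck_on (Suc k) S f \<Longrightarrow> Ck_on k S f"
proof (induction k arbitrary: f)
  case 0
  then show ?case
    by (auto intro!: continuous_at_imp_continuous_on differentiable_imp_continuous_within)
next
  case (Suc k)
  then show ?case by simp
qed

lemma Ck_on_antimono: "Ck_on m S f \<Longrightarrow> k \<le> m \<Longrightarrow> Ck_on k S f"
proof (induction m)
  case 0
  then show ?case by simp
next
  case (Suc m)
  then show ?case using Ck_on_SucD le_Suc_eq by metis
qed

lemma Ck_on_const [simp]: "Ck_on k S (\<lambda>x. c)"
  by (induction k arbitrary: c) auto

lemma Ck_on_differentiable: "Ck_on k S f \<Longrightarrow> 0 < k \<Longrightarrow> x \<in> S \<Longrightarrow> f differentiable (at x)"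
  by (cases k) auto

lemma Ck_on_linear:
  assumes "open S" "bounded_linear L" "Ck_on k S f"
  shows "Ck_on k S (\<lambda>x. L (f x))"
  using assms(3)
proof (induction k arbitrary: f)
  case 0
  then show ?case using assms(2) by (simp add: bounded_linear.continuous_on)
next
  case (Suc k)
  have D: "((\<lambda>x. L (f x)) has_derivative (\<lambda>v. L (frechet_derivative f (at x) v))) (at x)"
    if "x \<in> S" for x
    using Suc.prems that assms(2)
    by (auto simp: frechet_derivative_works intro: bounded_linear.has_derivative)
  have "Ck_on k S (\<lambda>x. frechet_derivative (\<lambda>x. L (f x)) (at x) v)" for v
    using Suc.IH[of "\<lambda>x. frechet_derivative f (at x) v"] Suc.prems
    by (subst Ck_on_cong[OF assms(1), where g = "\<lambda>x. L (frechet_derivative f (at x) v)"])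
       (auto simp: frechet_derivative_eqI[OF D])
  then show ?case
    using D by (auto simp: differentiable_def)
qed

lemma Ck_on_add:
  assumes "open S" "Ck_on k S f" "Ck_on k S g"
  shows "Ck_on k S (\<lambda>x. f x + g x)"
  using assms(2,3)
proof (induction k arbitrary: f g)
  case 0
  then show ?case by (simp add: continuous_on_add)
next
  case (Suc k)
  have D: "((\<lambda>x. f x + g x) has_derivative
      (\<lambda>v. frechet_derivative f (at x) v + frechet_derivative g (at x) v)) (at x)"
    if "x \<in> S" for x
    using Suc.prems that by (auto simp: frechet_derivative_works intro: has_derivative_add)
  have "Ck_on k S (\<lambda>x. frechet_derivative (\<lambda>x. f x + g x) (at x) v)" for v
    using Suc.IH[of "\<lambda>x. frechet_derivative f (at x) v" "\<lambda>x. frechet_derivative g (at x) v"]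
      Suc.prems
    by (subst Ck_on_cong[OF assms(1), where
          g = "\<lambda>x. frechet_derivative f (at x) v + frechet_derivative g (at x) v"])
       (auto simp: frechet_derivative_eqI[OF D])
  then show ?case
    using D by (auto simp: differentiable_def)
qed

lemma Ck_on_bilinear:
  assumes "open S" "bounded_bilinear B" "Ck_on k S f" "Ck_on k S g"
  shows "Ck_on k S (\<lambda>x. B (f x) (g x))"
  using assms(3,4)
proof (induction k arbitrary: f g)
  case 0
  then show ?case using assms(2) by (simp add: bounded_bilinear.continuous_on)
next
  case (Suc k)
  have D: "((\<lambda>x. B (f x) (g x)) has_derivative
      (\<lambda>v. B (f x) (frechet_derivative g (at x) v) + B (frechet_derivative f (at x) v) (g x))) (at x)"
    if "x \<in> S" for x
    using Suc.prems that assms(2)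
    by (auto simp: frechet_derivative_works intro: bounded_bilinear.FDERIV)
  have "Ck_on k S (\<lambda>x. frechet_derivative (\<lambda>x. B (f x) (g x)) (at x) v)" for v
  proof (subst Ck_on_cong[OF assms(1), where
        g = "\<lambda>x. B (f x) (frechet_derivative g (at x) v) + B (frechet_derivative f (at x) v) (g x)"])
    show "Ck_on k S (\<lambda>x. B (f x) (frechet_derivative g (at x) v)
        + B (frechet_derivative f (at x) v) (g x))"
      using Suc.prems Suc.prems[THEN Ck_on_SucD] by (intro Ck_on_add[OF assms(1)] Suc.IH) auto
  qed (auto simp: frechet_derivative_eqI[OF D])
  then show ?case
    using D by (auto simp: differentiable_def)
qed

lemmas Ck_on_mult = Ck_on_bilinear[OF _ bounded_bilinear_mult]
lemmas Ck_on_scaleR = Ck_on_bilinear[OF _ bounded_bilinear_scaleR]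

lemma Ck_on_minus:
  assumes "open S" "Ck_on k S f"
  shows "Ck_on k S (\<lambda>x. - f x)"
  by (rule Ck_on_linear[OF assms(1) bounded_linear_minus[OF bounded_linear_ident] assms(2)])

lemma Ck_on_diff:
  assumes "open S" "Ck_on k S f" "Ck_on k S g"
  shows "Ck_on k S (\<lambda>x. f x - g x)"
  using Ck_on_add[OF assms(1,2) Ck_on_minus[OF assms(1,3)]] by simp

lemma Ck_on_sum:
  assumes "open S" "\<And>i. i \<in> I \<Longrightarrow> Ck_on k S (f i)"
  shows "Ck_on k S (\<lambda>x. \<Sum>i\<in>I. f i x)"
  using assms(2)
proof (induction I rule: infinite_finite_induct)
  case (insert i I)
  then show ?case by (auto intro!: Ck_on_add[OF assms(1)])
qed auto

lemma Ck_on_prod: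
  fixes f :: "'i \<Rightarrow> 'a::euclidean_space \<Rightarrow> real"
  assumes "open S" "\<And>i. i \<in> I \<Longrightarrow> Ck_on k S (f i)"
  shows "Ck_on k S (\<lambda>x. \<Prod>i\<in>I. f i x)"
  using assms(2)
proof (induction I rule: infinite_finite_induct)
  case (insert i I)
  then show ?case by (auto intro!: Ck_on_mult[OF assms(1)])
qed auto

lemma Ck_on_inverse:
  fixes f :: "'a::euclidean_space \<Rightarrow> real"
  assumes "open S" "Ck_on k S f" "\<And>x. x \<in> S \<Longrightarrow> f x \<noteq> 0"
  shows "Ck_on k S (\<lambda>x. inverse (f x))"
  using assms(2)
proof (induction k)
  case 0
  then show ?case using assms(3) by (simp add: continuous_on_inverse)
next
  case (Suc k)
  have D: "((\<lambda>x. inverse (f x)) has_derivative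
      (\<lambda>v. - (inverse (f x) * frechet_derivative f (at x) v * inverse (f x)))) (at x)"
    if "x \<in> S" for x
    using Suc.prems that assms(3)
    by (intro Deriv.has_derivative_inverse) (auto simp: frechet_derivative_works)
  have I: "Ck_on k S (\<lambda>x. inverse (f x))"
    using Suc Ck_on_SucD by blast
  have "Ck_on k S (\<lambda>x. frechet_derivative (\<lambda>x. inverse (f x)) (at x) v)" for v
  proof (subst Ck_on_cong[OF assms(1), where
        g = "\<lambda>x. - (inverse (f x) * frechet_derivative f (at x) v * inverse (f x))"])
    show "Ck_on k S (\<lambda>x. - (inverse (f x) * frechet_derivative f (at x) v * inverse (f x)))"
      using I Suc.prems by (intro Ck_on_minus Ck_on_mult assms(1)) auto
  qed (auto simp: frechet_derivative_eqI[OF D])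
  then show ?case
    using D by (auto simp: differentiable_def)
qed

lemma Ck_on_pd: "Ck_on (Suc k) S F \<Longrightarrow> Ck_on k S (pd i F)"
  unfolding pd_def by simp

lemma Ck_on_matrix_nth:
  fixes M :: "'a::euclidean_space \<Rightarrow> real ^ 'n::finite ^ 'm::finite"
  assumes "open S" "Ck_on k S M"
  shows "Ck_on k S (\<lambda>x. M x $ i $ j)"
proof -
  have "bounded_linear (\<lambda>M :: real ^ 'n ^ 'm. M $ i $ j)"
    by (rule bounded_linear_compose[OF bounded_linear_vec_nth bounded_linear_vec_nth])
  from Ck_on_linear[OF assms(1) this assms(2)] show ?thesis .
qed

subsection \<open>Rules for partial derivatives\<close>

lemma pd_linear:
  assumes "bounded_linear L" "F differentiable (at x)"
  shows "pd i (\<lambda>y. L (F y)) x = L (pd i F x)"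
proof -
  have "((\<lambda>y. L (F y)) has_derivative (\<lambda>v. L (frechet_derivative F (at x) v))) (at x)"
    using assms by (auto simp: frechet_derivative_works intro: bounded_linear.has_derivative)
  from pd_eqI[OF this] show ?thesis unfolding pd_def .
qed

lemma pd_bilinear:
  assumes "bounded_bilinear B" "F differentiable (at x)" "G differentiable (at x)"
  shows "pd i (\<lambda>y. B (F y) (G y)) x = B (F x) (pd i G x) + B (pd i F x) (G x)"
proof -
  have "((\<lambda>y. B (F y) (G y)) has_derivative
    (\<lambda>v. B (F x) (frechet_derivative G (at x) v) + B (frechet_derivative F (at x) v) (G x))) (at x)"
    using assms by (auto simp: frechet_derivative_works intro: bounded_bilinear.FDERIV)
  from pd_eqI[OF this] show ?thesis unfolding pd_def .
qed

lemma pd_add: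
  assumes "F differentiable (at x)" "G differentiable (at x)"
  shows "pd i (\<lambda>y. F y + G y) x = pd i F x + pd i G x"
  using pd_eqI[OF has_derivative_add[OF assms[unfolded frechet_derivative_works]]]
  unfolding pd_def .

lemma pd_const [simp]: "pd i (\<lambda>y. c) x = 0"
  by (simp add: pd_def)

lemma pd_sum:
  assumes "\<And>j. j \<in> J \<Longrightarrow> F j differentiable (at x)"
  shows "pd i (\<lambda>y. \<Sum>j\<in>J. F j y) x = (\<Sum>j\<in>J. pd i (F j) x)"
proof -
  have "((\<lambda>y. \<Sum>j\<in>J. F j y) has_derivative (\<lambda>v. \<Sum>j\<in>J. frechet_derivative (F j) (at x) v)) (at x)"
    using assms by (intro has_derivative_sum) (simp add: frechet_derivative_works)
  from pd_eqI[OF this] show ?thesis unfolding pd_def .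
qed

lemma has_real_derivative_along_line:
  fixes F :: "'a::euclidean_space \<Rightarrow> real"
  assumes "F differentiable (at (x + s *\<^sub>R v))"
  shows "((\<lambda>s. F (x + s *\<^sub>R v)) has_real_derivative frechet_derivative F (at (x + s *\<^sub>R v)) v) (at s)"
proof -
  have F: "(F has_derivative frechet_derivative F (at (x + s *\<^sub>R v))) (at (x + s *\<^sub>R v))"
    using assms frechet_derivative_works by blast
  have "((\<lambda>s. x + s *\<^sub>R v) has_derivative (\<lambda>h. h *\<^sub>R v)) (at s)"
    by (auto intro!: derivative_eq_intros)
  from has_derivative_compose[OF this F]
  have "((\<lambda>s. F (x + s *\<^sub>R v)) has_derivative
      (\<lambda>h. frechet_derivative F (at (x + s *\<^sub>R v)) (h *\<^sub>R v))) (at s)" .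
  moreover have "(\<lambda>h. frechet_derivative F (at (x + s *\<^sub>R v)) (h *\<^sub>R v))
      = (*) (frechet_derivative F (at (x + s *\<^sub>R v)) v)"
    using linear_scale[OF linear_frechet_derivative[OF assms]] by (simp add: fun_eq_iff)
  ultimately show ?thesis
    unfolding has_field_derivative_def by metis
qed

text \<open>Two applications of the mean value theorem: the second difference quotient is a mixed second
  derivative at a nearby point. Its symmetry in the two directions is what makes mixed partial
  derivatives commute.\<close>

lemma second_difference_eq_mixed_pd:
  fixes F :: "real ^ 'n::finite \<Rightarrow> real"
  assumes "0 < h" "cball x (2 * h) \<subseteq> S"
    and F: "\<And>y. y \<in> S \<Longrightarrow> F differentiable (at y)"
    and Fi: "\<And>y. y \<in> S \<Longrightarrow> pd i F differentiable (at y)"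
  shows "\<exists>z\<in>cball x (2 * h). F (x + h *\<^sub>R axis i 1 + h *\<^sub>R axis j 1) - F (x + h *\<^sub>R axis i 1)
     - F (x + h *\<^sub>R axis j 1) + F x = h\<^sup>2 * pd j (pd i F) z"
proof -
  let ?a = "axis i 1 :: real ^ 'n" and ?b = "axis j 1 :: real ^ 'n"
  have inS: "x + s *\<^sub>R ?a + t *\<^sub>R ?b \<in> cball x (2 * h)" if "0 \<le> s" "s \<le> h" "0 \<le> t" "t \<le> h" for s t
  proof -
    have "norm (s *\<^sub>R ?a + t *\<^sub>R ?b) \<le> norm (s *\<^sub>R ?a) + norm (t *\<^sub>R ?b)"
      by (rule norm_triangle_ineq)
    also have "\<dots> \<le> 2 * h" using that by simp
    finally have "norm (s *\<^sub>R ?a + t *\<^sub>R ?b) \<le> 2 * h" .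
    moreover have "x - (x + s *\<^sub>R ?a + t *\<^sub>R ?b) = - (s *\<^sub>R ?a + t *\<^sub>R ?b)" by simp
    ultimately show ?thesis unfolding mem_cball dist_norm by (metis norm_minus_cancel)
  qed
  define g where "g s = F ((x + h *\<^sub>R ?b) + s *\<^sub>R ?a) - F (x + s *\<^sub>R ?a)" for s
  have g': "(g has_real_derivative (pd i F ((x + h *\<^sub>R ?b) + s *\<^sub>R ?a) - pd i F (x + s *\<^sub>R ?a))) (at s)"
    if "0 \<le> s" "s \<le> h" for s
    unfolding g_def pd_def
  proof (intro DERIV_diff has_real_derivative_along_line F)
    show "x + h *\<^sub>R ?b + s *\<^sub>R ?a \<in> S"
      using inS[OF that, of h] assms by (auto simp: algebra_simps)
    show "x + s *\<^sub>R ?a \<in> S"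
      using inS[OF that, of 0] assms by auto
  qed
  obtain s where s: "0 < s" "s < h" "g h - g 0
      = h * (pd i F ((x + h *\<^sub>R ?b) + s *\<^sub>R ?a) - pd i F (x + s *\<^sub>R ?a))"
    using MVT2[OF assms(1) g'] by auto
  have k': "((\<lambda>t. pd i F ((x + s *\<^sub>R ?a) + t *\<^sub>R ?b)) has_real_derivative
      pd j (pd i F) ((x + s *\<^sub>R ?a) + t *\<^sub>R ?b)) (at t)" if "0 \<le> t" "t \<le> h" for t
    unfolding pd_def[of j]
    using inS[of s t] s that assms by (intro has_real_derivative_along_line Fi) auto
  obtain t where t: "0 < t" "t < h" "pd i F ((x + s *\<^sub>R ?a) + h *\<^sub>R ?b) - pd i F (x + s *\<^sub>R ?a)
      = h * pd j (pd i F) ((x + s *\<^sub>R ?a) + t *\<^sub>R ?b)"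
    using MVT2[OF assms(1) k'] by auto
  show ?thesis
  proof
    show "x + s *\<^sub>R ?a + t *\<^sub>R ?b \<in> cball x (2 * h)" using inS s t by auto
    have "g h - g 0 = h * (h * pd j (pd i F) ((x + s *\<^sub>R ?a) + t *\<^sub>R ?b))"
      using s(3) t(3) by (simp add: add_ac)
    then show "F (x + h *\<^sub>R ?a + h *\<^sub>R ?b) - F (x + h *\<^sub>R ?a)
     - F (x + h *\<^sub>R ?b) + F x = h\<^sup>2 * pd j (pd i F) (x + s *\<^sub>R ?a + t *\<^sub>R ?b)"
      by (simp add: g_def power2_eq_square algebra_simps)
  qed
qed

lemma pd_commute_real:
  fixes F :: "real ^ 'n::finite \<Rightarrow> real"
  assumes "open S" "x \<in> S" "Ck_on 2 S F"
  shows "pd i (pd j F) x = pd j (pd i F) x"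
proof (rule ccontr)
  have C2: "Ck_on (Suc (Suc 0)) S F" using assms(3) by (simp add: numeral_2_eq_2)
  assume ne: "pd i (pd j F) x \<noteq> pd j (pd i F) x"
  define e where "e = dist (pd i (pd j F) x) (pd j (pd i F) x) / 2"
  have "e > 0" using ne by (simp add: e_def)
  have cont: "continuous_on S (pd a (pd b F))" for a b
    using Ck_on_pd[OF Ck_on_pd[OF C2]] by simp
  have nb: "\<exists>d>0. \<forall>y\<in>S. dist y x < d \<longrightarrow> dist (pd a (pd b F) y) (pd a (pd b F) x) < e" for a b
    using cont[of a b] \<open>e > 0\<close> assms(2) unfolding continuous_on_iff by blast
  obtain d1 where d1: "d1 > 0" "\<And>y. y \<in> S \<Longrightarrow> dist y x < d1 \<Longrightarrow>
      dist (pd i (pd j F) y) (pd i (pd j F) x) < e"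
    using nb[of i j] by blast
  obtain d2 where d2: "d2 > 0" "\<And>y. y \<in> S \<Longrightarrow> dist y x < d2 \<Longrightarrow>
      dist (pd j (pd i F) y) (pd j (pd i F) x) < e"
    using nb[of j i] by blast
  obtain d3 where d3: "d3 > 0" "cball x d3 \<subseteq> S"
    using assms open_contains_cball by blast
  define h where "h = min d3 (min d1 d2) / 3"
  have h: "h > 0" "2 * h < d1" "2 * h < d2" "2 * h \<le> d3"
    using d1 d2 d3 by (auto simp: h_def min_def)
  have sub: "cball x (2 * h) \<subseteq> S" using d3 h by auto
  have F: "F differentiable (at y)" "pd a F differentiable (at y)" if "y \<in> S" for y a
    using C2 that Ck_on_pd[OF C2, of a] by auto
  obtain z1 where z1: "z1 \<in> cball x (2 * h)"
      "F (x + h *\<^sub>R axis i 1 + h *\<^sub>R axis j 1) - F (x + h *\<^sub>R axis i 1)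
     - F (x + h *\<^sub>R axis j 1) + F x = h\<^sup>2 * pd j (pd i F) z1"
    using second_difference_eq_mixed_pd[OF h(1) sub F] by blast
  obtain z2 where z2: "z2 \<in> cball x (2 * h)"
      "F (x + h *\<^sub>R axis j 1 + h *\<^sub>R axis i 1) - F (x + h *\<^sub>R axis j 1)
     - F (x + h *\<^sub>R axis i 1) + F x = h\<^sup>2 * pd i (pd j F) z2"
    using second_difference_eq_mixed_pd[OF h(1) sub F] by blast
  have "h\<^sup>2 * pd j (pd i F) z1 = h\<^sup>2 * pd i (pd j F) z2"
    using z1(2) z2(2) by (simp add: algebra_simps)
  then have eq: "pd j (pd i F) z1 = pd i (pd j F) z2" using h by simp
  have "dist (pd j (pd i F) z1) (pd j (pd i F) x) < e"
    using z1(1) sub h by (intro d2) (auto simp: dist_commute)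
  moreover have "dist (pd i (pd j F) z2) (pd i (pd j F) x) < e"
    using z2(1) sub h by (intro d1) (auto simp: dist_commute)
  ultimately show False
    using eq unfolding e_def by (simp add: dist_real_def abs_if split: if_splits)
qed

lemma pd_commute:
  fixes F :: "real ^ 'n::finite \<Rightarrow> 'b::euclidean_space"
  assumes "open S" "x \<in> S" "Ck_on 2 S F"
  shows "pd i (pd j F) x = pd j (pd i F) x"
proof (rule euclidean_eqI)
  fix b :: 'b
  have C2: "Ck_on (Suc (Suc 0)) S F" using assms(3) by (simp add: numeral_2_eq_2)
  have bl: "bounded_linear (\<lambda>y. y \<bullet> b)" by (rule bounded_linear_inner_left)
  have *: "pd a (pd c (\<lambda>y. F y \<bullet> b)) x = pd a (pd c F) x \<bullet> b" for a c
  proof -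
    have "pd a (pd c (\<lambda>y. F y \<bullet> b)) x = pd a (\<lambda>y. pd c F y \<bullet> b) x"
      using C2 by (intro pd_cong[OF assms(1,2)] pd_linear[OF bl]) auto
    also have "\<dots> = pd a (pd c F) x \<bullet> b"
      using Ck_on_pd[OF C2, of c] assms(2) by (intro pd_linear[OF bl]) auto
    finally show ?thesis .
  qed
  have "Ck_on 2 S (\<lambda>y. F y \<bullet> b)" by (rule Ck_on_linear[OF assms(1) bl assms(3)])
  from pd_commute_real[OF assms(1,2) this] * show "pd i (pd j F) x \<bullet> b = pd j (pd i F) x \<bullet> b"
    by metis
qed

section \<open>Positive definite matrices\<close>

lemma quadratic_form_shift:
  fixes a :: "'n::finite \<Rightarrow> 'n \<Rightarrow> real"
  assumes sym: "\<And>i j. a i j = a j i"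
  shows "(\<Sum>i\<in>UNIV. \<Sum>j\<in>UNIV. (v i + (if i = k then t else 0)) * (v j + (if j = k then t else 0)) * a i j)
    = (\<Sum>i\<in>UNIV. \<Sum>j\<in>UNIV. v i * v j * a i j) + 2 * t * (\<Sum>j\<in>UNIV. a k j * v j) + t\<^sup>2 * a k k"
proof -
  define d where "d i = (if i = k then t else 0)" for i
  have d: "(\<Sum>i\<in>UNIV. d i * f i) = t * f k" for f
  proof -
    have "(\<Sum>i\<in>UNIV. d i * f i) = (\<Sum>i\<in>UNIV. if i = k then t * f k else 0)"
      by (intro sum.cong) (auto simp: d_def)
    then show ?thesis by simp
  qed
  have "(\<Sum>i\<in>UNIV. \<Sum>j\<in>UNIV. (v i + d i) * (v j + d j) * a i j)
    = (\<Sum>i\<in>UNIV. \<Sum>j\<in>UNIV. v i * v j * a i j) + (\<Sum>i\<in>UNIV. v i * (\<Sum>j\<in>UNIV. d j * a i j))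
      + (\<Sum>i\<in>UNIV. d i * (\<Sum>j\<in>UNIV. v j * a i j))
      + (\<Sum>i\<in>UNIV. d i * (\<Sum>j\<in>UNIV. d j * a i j))"
    by (simp add: sum_distrib_left sum.distrib algebra_simps)
  also have "\<dots> = (\<Sum>i\<in>UNIV. \<Sum>j\<in>UNIV. v i * v j * a i j)
      + 2 * t * (\<Sum>j\<in>UNIV. a k j * v j) + t\<^sup>2 * a k k"
  proof -
    have "(\<Sum>i\<in>UNIV. v i * (t * a i k)) = t * (\<Sum>j\<in>UNIV. a k j * v j)"
      unfolding sum_distrib_left by (intro sum.cong refl) (metis mult.commute mult.left_commute sym)
    moreover have "(\<Sum>j\<in>UNIV. v j * a k j) = (\<Sum>j\<in>UNIV. a k j * v j)"
      by (simp add: mult.commute)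
    ultimately show ?thesis
      unfolding d by (simp add: power2_eq_square)
  qed
  finally show ?thesis unfolding d_def .
qed

text \<open>Splitting off one square at a time, as in the Cholesky decomposition, writes \<open>a\<close> as a sum of
  matrices \<open>w w\<^sup>T\<close>, and each of these pairs nonnegatively with \<open>b\<close>.\<close>

lemma psd_pairing_nonneg:
  fixes a b :: "'n::finite \<Rightarrow> 'n \<Rightarrow> real"
  assumes sym: "\<And>i j. a i j = a j i"
    and a: "\<And>v. 0 \<le> (\<Sum>i\<in>UNIV. \<Sum>j\<in>UNIV. v i * v j * a i j)"
    and b: "\<And>v. 0 \<le> (\<Sum>i\<in>UNIV. \<Sum>j\<in>UNIV. v i * v j * b i j)"
  shows "0 \<le> (\<Sum>i\<in>UNIV. \<Sum>j\<in>UNIV. a i j * b i j)"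
proof -
  have "finite I \<Longrightarrow> (\<And>i j. a i j = a j i) \<Longrightarrow>
      (\<And>v. 0 \<le> (\<Sum>i\<in>UNIV. \<Sum>j\<in>UNIV. v i * v j * a i j)) \<Longrightarrow>
      (\<And>i j. i \<notin> I \<Longrightarrow> a i j = 0) \<Longrightarrow> 0 \<le> (\<Sum>i\<in>UNIV. \<Sum>j\<in>UNIV. a i j * b i j)"
    for I and a :: "'n \<Rightarrow> 'n \<Rightarrow> real"
  proof (induction I arbitrary: a rule: finite_induct)
    case empty
    then show ?case by simp
  next
    case (insert k I)
    note sym = insert.prems(1) and psd = insert.prems(2) and supp = insert.prems(3)
    note shift = quadratic_form_shift[of a, OF sym]
    have Q0: "(\<Sum>i\<in>UNIV. \<Sum>j\<in>UNIV. (if i = l then 1 else 0) * (if j = l then 1 else 0) * a i j)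
        = a l l" for l
      using shift[of "\<lambda>_. 0" l 1] by simp
    have L0: "(\<Sum>j\<in>UNIV. a k j * (if j = l then 1 else 0)) = a k l" for l
      by (simp add: if_distrib[of "\<lambda>x. a k _ * x"] cong: if_cong)
    have nonneg: "0 \<le> a l l" for l
      using psd[of "\<lambda>i. if i = l then 1 else 0"] Q0[of l] by simp
    show ?case
    proof (cases "a k k = 0")
      case True
      have "a k l = 0" for l
      proof (rule ccontr)
        assume ne: "a k l \<noteq> 0"
        define t where "t = - (a l l + 1) / (2 * a k l)"
        have "0 \<le> a l l + 2 * t * a k l + t\<^sup>2 * a k k"
          using psd[of "\<lambda>i. (if i = l then 1 else 0) + (if i = k then t else 0)"]
          unfolding shift Q0 L0 .
        moreover have "2 * t * a k l = - (a l l + 1)" using ne by (simp add: t_def)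
        ultimately show False using True by simp
      qed
      then have "a i j = 0" if "i \<notin> I" for i j using supp that by (cases "i = k") auto
      then show ?thesis by (rule insert.IH[OF sym psd])
    next
      case False
      then have pos: "0 < a k k" using nonneg[of k] by simp
      define a' where "a' i j = a i j - a k i * a k j / a k k" for i j
      have "0 \<le> (\<Sum>i\<in>UNIV. \<Sum>j\<in>UNIV. a' i j * b i j)"
      proof (rule insert.IH)
        show "a' i j = a' j i" for i j unfolding a'_def using sym by (simp add: mult.commute)
        show "a' i j = 0" if "i \<notin> I" for i j
          using supp that False unfolding a'_def by (cases "i = k") (use sym[of i k] in simp_all)
        fix v :: "'n \<Rightarrow> real"
        define L where "L = (\<Sum>j\<in>UNIV. a k j * v j)"
        define t where "t = - L / a k k"
        have "0 \<le> (\<Sum>i\<in>UNIV. \<Sum>j\<in>UNIV. v i * v j * a i j) + 2 * t * L + t\<^sup>2 * a k k"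
          using psd[of "\<lambda>i. v i + (if i = k then t else 0)"] unfolding shift L_def .
        also have "2 * t * L + t\<^sup>2 * a k k = - (L * L / a k k)"
          using False by (simp add: t_def field_simps power2_eq_square)
        then have "(\<Sum>i\<in>UNIV. \<Sum>j\<in>UNIV. v i * v j * a i j) + 2 * t * L + t\<^sup>2 * a k k
          = (\<Sum>i\<in>UNIV. \<Sum>j\<in>UNIV. v i * v j * a i j) - L * L / a k k" by linarith
        also have "L * L / a k k = (\<Sum>i\<in>UNIV. \<Sum>j\<in>UNIV. v i * v j * (a k i * a k j / a k k))"
          unfolding L_def sum_product sum_divide_distrib by (simp add: algebra_simps)
        also have "(\<Sum>i\<in>UNIV. \<Sum>j\<in>UNIV. v i * v j * a i j) - \<dots>
            = (\<Sum>i\<in>UNIV. \<Sum>j\<in>UNIV. v i * v j * a' i j)"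
          by (simp add: a'_def sum_subtractf right_diff_distrib)
        finally show "0 \<le> (\<Sum>i\<in>UNIV. \<Sum>j\<in>UNIV. v i * v j * a' i j)" .
      qed
      moreover have "0 \<le> (\<Sum>i\<in>UNIV. \<Sum>j\<in>UNIV. a k i * a k j * b i j) / a k k"
        using b[of "a k"] pos by simp
      moreover have "(\<Sum>i\<in>UNIV. \<Sum>j\<in>UNIV. a i j * b i j)
        = (\<Sum>i\<in>UNIV. \<Sum>j\<in>UNIV. a' i j * b i j) + (\<Sum>i\<in>UNIV. \<Sum>j\<in>UNIV. a k i * a k j * b i j) / a k k"
        by (simp add: a'_def sum_divide_distrib sum.distrib[symmetric] algebra_simps)
      ultimately show ?thesis by linarith
    qed
  qed
  from this[of UNIV a] show ?thesis using sym a by simp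
qed

lemma inner_matrix_eq_sum:
  fixes M :: "real ^ 'n::finite ^ 'n"
  shows "v \<bullet> (M *v v) = (\<Sum>i\<in>UNIV. \<Sum>j\<in>UNIV. v $ i * v $ j * M $ i $ j)"
  by (simp add: inner_vec_def matrix_vector_mult_def sum_distrib_left algebra_simps)

lemma pos_def_matrix_sym: "pos_def_matrix G \<Longrightarrow> G $ i $ j = G $ j $ i"
  unfolding pos_def_matrix_def by (metis transpose_def vec_lambda_beta)

lemma pos_def_matrix_inverse:
  assumes "pos_def_matrix G"
  shows "G ** matrix_inv G = mat 1" "matrix_inv G ** G = mat 1"
proof -
  have "\<forall>v. G *v v = 0 \<longrightarrow> v = 0"
    using assms unfolding pos_def_matrix_def by (metis inner_zero_right less_irrefl)
  then obtain B where "B ** G = mat 1"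
    using matrix_left_invertible_ker by blast
  then have "\<exists>A'. G ** A' = mat 1 \<and> A' ** G = mat 1"
    using matrix_left_right_inverse by blast
  then show "G ** matrix_inv G = mat 1" "matrix_inv G ** G = mat 1"
    unfolding matrix_inv_def by (metis (mono_tags, lifting) someI_ex)+
qed

lemma pos_def_matrix_inv:
  assumes "pos_def_matrix G"
  shows "pos_def_matrix (matrix_inv G)"
proof -
  note inv = pos_def_matrix_inverse[OF assms]
  have "transpose (matrix_inv G) ** G = mat 1"
    using inv(1) assms unfolding pos_def_matrix_def by (metis matrix_transpose_mul transpose_mat)
  then have "transpose (matrix_inv G) = matrix_inv G"
    by (metis inv(1) matrix_mul_assoc matrix_mul_lid matrix_mul_rid)
  moreover have "v \<bullet> (matrix_inv G *v v) > 0" if "v \<noteq> 0" for v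
  proof -
    let ?w = "matrix_inv G *v v"
    have "G *v ?w = v" by (simp add: matrix_vector_mul_assoc inv)
    moreover from this have "?w \<noteq> 0" using that by auto
    ultimately show ?thesis
      using assms unfolding pos_def_matrix_def by (metis inner_commute)
  qed
  ultimately show ?thesis unfolding pos_def_matrix_def by blast
qed

lemma pos_def_matrix_inverse_sum:
  assumes "pos_def_matrix G"
  shows "(\<Sum>k\<in>UNIV. matrix_inv G $ i $ k * G $ k $ j) = (if i = j then 1 else 0)"
    and "(\<Sum>k\<in>UNIV. G $ i $ k * matrix_inv G $ k $ j) = (if i = j then 1 else 0)"
  using pos_def_matrix_inverse[OF assms]
  by (simp_all add: matrix_matrix_mult_def mat_def vec_eq_iff)

lemma pos_def_matrix_nonneg:
  assumes "pos_def_matrix G"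
  shows "0 \<le> (\<Sum>i\<in>UNIV. \<Sum>j\<in>UNIV. v i * v j * G $ i $ j)"
proof -
  have "0 \<le> (\<chi> i. v i) \<bullet> (G *v (\<chi> i. v i))"
    using assms unfolding pos_def_matrix_def by (cases "(\<chi> i. v i) = 0") (auto intro: less_imp_le)
  then show ?thesis unfolding inner_matrix_eq_sum by simp
qed

lemma pos_def_matrix_det_nonzero: "pos_def_matrix G \<Longrightarrow> det G \<noteq> 0"
  by (metis det_I det_mul mult_zero_left pos_def_matrix_inverse(1) zero_neq_one)

lemma matrix_inv_cramer:
  fixes G :: "real ^ 'n::finite ^ 'n"
  assumes "pos_def_matrix G"
  shows "matrix_inv G $ k $ l
    = det (\<chi> i j. if j = k then (if i = l then 1 else 0) else G $ i $ j) / det G"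
proof -
  have "G *v (matrix_inv G *v axis l 1) = axis l 1"
    by (simp add: matrix_vector_mul_assoc pos_def_matrix_inverse[OF assms])
  then have "matrix_inv G *v axis l 1
      = (\<chi> k. det (\<chi> i j. if j = k then axis l 1 $ i else G $ i $ j) / det G)"
    using cramer[OF pos_def_matrix_det_nonzero[OF assms]] by blast
  then have "(matrix_inv G *v axis l 1) $ k
      = det (\<chi> i j. if j = k then axis l 1 $ i else G $ i $ j) / det G"
    by (simp only: vec_lambda_beta)
  moreover have "(matrix_inv G *v axis l 1) $ k = matrix_inv G $ k $ l"
    by (simp add: matrix_vector_mult_basis column_def)
  ultimately show ?thesis unfolding axis_def vec_lambda_beta by simp
qed

lemma Ck_on_det:
  fixes M :: "'a::euclidean_space \<Rightarrow> real ^ 'n::finite ^ 'n"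
  assumes "open S" "\<And>i j. Ck_on k S (\<lambda>x. M x $ i $ j)"
  shows "Ck_on k S (\<lambda>x. det (M x))"
  unfolding det_def by (intro Ck_on_sum Ck_on_mult Ck_on_prod Ck_on_const assms)

lemma Ck_on_matrix_inv:
  fixes G :: "'a::euclidean_space \<Rightarrow> real ^ 'n::finite ^ 'n"
  assumes S: "open S" and G: "\<And>i j. Ck_on k S (\<lambda>x. G x $ i $ j)"
    and pd: "\<And>x. x \<in> S \<Longrightarrow> pos_def_matrix (G x)"
  shows "Ck_on k S (\<lambda>x. matrix_inv (G x) $ i $ j)"
proof -
  have entry: "Ck_on k S (\<lambda>x. (\<chi> p q. if q = i then (if p = j then 1 else 0) else G x $ p $ q) $ a $ b)"
    for a b using G[of a b] by (cases "b = i"; cases "a = j") simp_all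
  have "Ck_on k S (\<lambda>x. det (\<chi> p q. if q = i then (if p = j then 1 else 0) else G x $ p $ q)
      * inverse (det (G x)))"
    by (intro Ck_on_mult Ck_on_inverse Ck_on_det S G entry pos_def_matrix_det_nonzero pd)
  then show ?thesis
    by (subst Ck_on_cong[OF S]) (auto simp: matrix_inv_cramer pd divide_inverse)
qed

section \<open>Immersions into the light cone in local coordinates\<close>

lemma bounded_bilinear_lorentz: "bounded_bilinear (lorentz :: real \<times> (real ^ 'k::finite) \<Rightarrow> _)"
proof -
  have "bounded_bilinear (\<lambda>(v :: real \<times> (real ^ 'k)) w. (- fst v, snd v) \<bullet> w)"
    by (intro bounded_bilinear.comp1[OF bounded_bilinear_inner] bounded_linear_Pair
        bounded_linear_minus bounded_linear_fst bounded_linear_snd)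
  moreover have "(\<lambda>(v :: real \<times> (real ^ 'k)) w. (- fst v, snd v) \<bullet> w) = lorentz"
    by (simp add: fun_eq_iff lorentz_def inner_prod_def)
  ultimately show ?thesis by simp
qed

lemma lorentz_commute: "lorentz v w = lorentz w v"
  by (simp add: lorentz_def inner_commute mult.commute)

lemmas lorentz_linear =
  bounded_bilinear.add_left[OF bounded_bilinear_lorentz]
  bounded_bilinear.add_right[OF bounded_bilinear_lorentz]
  bounded_bilinear.diff_left[OF bounded_bilinear_lorentz]
  bounded_bilinear.diff_right[OF bounded_bilinear_lorentz]
  bounded_bilinear.scaleR_left[OF bounded_bilinear_lorentz]
  bounded_bilinear.scaleR_right[OF bounded_bilinear_lorentz]
  bounded_bilinear.minus_left[OF bounded_bilinear_lorentz]
  bounded_bilinear.minus_right[OF bounded_bilinear_lorentz]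
  bounded_bilinear.sum_left[OF bounded_bilinear_lorentz]
  bounded_bilinear.sum_right[OF bounded_bilinear_lorentz]
  bounded_bilinear.zero_left[OF bounded_bilinear_lorentz]
  bounded_bilinear.zero_right[OF bounded_bilinear_lorentz]

lemma lorentz_e1: "lorentz v e1 = - fst v"
  by (simp add: lorentz_def e1_def)

text \<open>The Laplacian and the dual metric for coefficients \<open>G\<close> given on a coordinate domain.\<close>

definition laplace_coord ::
  "(real ^ 'n \<Rightarrow> real ^ 'n ^ 'n) \<Rightarrow> (real ^ 'n::finite \<Rightarrow> real) \<Rightarrow> real ^ 'n \<Rightarrow> real" where
  "laplace_coord G f x = (\<Sum>i\<in>UNIV. \<Sum>j\<in>UNIV. matrix_inv (G x) $ i $ j *
     (pd i (pd j f) x - (\<Sum>k\<in>UNIV. christoffel G k i j x * pd k f x)))"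

definition cometric ::
  "(real ^ 'n \<Rightarrow> real ^ 'n ^ 'n) \<Rightarrow> real ^ 'n \<Rightarrow> ('n::finite \<Rightarrow> real) \<Rightarrow> ('n \<Rightarrow> real) \<Rightarrow> real" where
  "cometric G x a b = (\<Sum>i\<in>UNIV. \<Sum>j\<in>UNIV. matrix_inv (G x) $ i $ j * a i * b j)"

text \<open>An isometric immersion into the light cone, read in a chart: \<open>X\<close> is the immersion and \<open>G\<close> the
  metric. It will be applied to \<open>\<psi> / lam\<close>, which induces the original metric \<open>g\<close>: multiplying a
  null vector field by a function multiplies the induced metric by the square of that function.\<close>

locale cone_chart =
  fixes V :: "(real ^ 'n::finite) set"
    and X :: "real ^ 'n \<Rightarrow> real \<times> (real ^ 'k::finite)"
    and G :: "real ^ 'n \<Rightarrow> real ^ 'n ^ 'n"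
  assumes open_V: "open V"
    and X_C3: "Ck_on 3 V X"
    and X_null: "x \<in> V \<Longrightarrow> lorentz (X x) (X x) = 0"
    and X_future: "x \<in> V \<Longrightarrow> 0 < fst (X x)"
    and G_eq: "x \<in> V \<Longrightarrow> G x $ i $ j = lorentz (pd i X x) (pd j X x)"
    and G_pos: "x \<in> V \<Longrightarrow> pos_def_matrix (G x)"
    and codim: "CARD('k) = CARD('n) + 1"
begin

abbreviation Ginv where "Ginv x i j \<equiv> matrix_inv (G x) $ i $ j"
abbreviation gam where "gam \<equiv> christoffel G"

lemma Ck_pd_X: "Ck_on 2 V (pd i X)" and Ck_pd2_X: "Ck_on 1 V (pd i (pd j X))"
  and Ck_X: "Ck_on 2 V X"
proof -
  have *: "Ck_on (Suc 2) V X" using X_C3 by (simp add: numeral_3_eq_3 numeral_2_eq_2)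
  show "Ck_on 2 V X" using Ck_on_SucD[OF *] .
  have "Ck_on 2 V (pd j X)" for j using Ck_on_pd[OF *] .
  then show "Ck_on 2 V (pd i X)" "Ck_on 1 V (pd i (pd j X))"
    using Ck_on_pd[of 1 V "pd j X" i] by (simp_all add: numeral_2_eq_2)
qed

lemma diff_X:
  assumes "x \<in> V"
  shows "X differentiable (at x)" "pd i X differentiable (at x)"
    "pd i (pd j X) differentiable (at x)"
  using Ck_X Ck_pd_X Ck_pd2_X assms Ck_on_differentiable by (metis zero_less_numeral zero_less_one)+

lemma pd_X_commute: "x \<in> V \<Longrightarrow> pd i (pd j X) x = pd j (pd i X) x"
  by (rule pd_commute[OF open_V _ Ck_X])

lemma pd2_X_commute: "x \<in> V \<Longrightarrow> pd i (pd j (pd k X)) x = pd j (pd i (pd k X)) x"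
  by (rule pd_commute[OF open_V _ Ck_pd_X])

lemma pd_lorentz:
  assumes "F differentiable (at x)" "H differentiable (at x)"
  shows "pd i (\<lambda>y. lorentz (F y) (H y)) x = lorentz (F x) (pd i H x) + lorentz (pd i F x) (H x)"
  by (rule pd_bilinear[OF bounded_bilinear_lorentz assms])

lemma X_perp_tangent:
  assumes "x \<in> V"
  shows "lorentz (X x) (pd j X x) = 0"
proof -
  have "pd j (\<lambda>y. lorentz (X y) (X y)) x = pd j (\<lambda>y. 0) x"
    by (rule pd_cong[OF open_V assms X_null])
  then show ?thesis
    using pd_lorentz[OF diff_X(1)[OF assms] diff_X(1)[OF assms], of j]
      lorentz_commute[of "X x" "pd j X x"] by simp
qed

lemma X_second:
  assumes "x \<in> V"
  shows "lorentz (X x) (pd i (pd j X) x) = - G x $ i $ j"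
proof -
  have "pd i (\<lambda>y. lorentz (X y) (pd j X y)) x = pd i (\<lambda>y. 0) x"
    by (rule pd_cong[OF open_V assms X_perp_tangent])
  then show ?thesis
    using pd_lorentz[OF diff_X(1,2)[OF assms], of i j] G_eq[OF assms, of i j] by simp
qed

lemma pd_G:
  assumes "x \<in> V"
  shows "pd i (\<lambda>y. G y $ j $ l) x
    = lorentz (pd j X x) (pd i (pd l X) x) + lorentz (pd i (pd j X) x) (pd l X x)"
proof -
  have "pd i (\<lambda>y. G y $ j $ l) x = pd i (\<lambda>y. lorentz (pd j X y) (pd l X y)) x"
    by (rule pd_cong[OF open_V assms G_eq])
  then show ?thesis
    using pd_lorentz[OF diff_X(2)[OF assms] diff_X(2)[OF assms], of i j l] by simp
qed

text \<open>The Levi-Civita connection is the tangential part of the flat connection.\<close>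

lemma christoffel_eq:
  assumes "x \<in> V"
  shows "gam k i j x = (\<Sum>l\<in>UNIV. Ginv x k l * lorentz (pd i (pd j X) x) (pd l X x))"
proof -
  have "pd i (\<lambda>y. G y $ j $ l) x + pd j (\<lambda>y. G y $ i $ l) x - pd l (\<lambda>y. G y $ i $ j) x
      = 2 * lorentz (pd i (pd j X) x) (pd l X x)" for l
    unfolding pd_G[OF assms]
    using pd_X_commute[OF assms, of i l] pd_X_commute[OF assms, of j l] pd_X_commute[OF assms, of j i]
      lorentz_commute[of "pd j X x" "pd l (pd i X) x"] by simp
  then show ?thesis
    unfolding christoffel_def by (simp add: sum_divide_distrib)
qed

lemma christoffel_lower:
  assumes "x \<in> V"
  shows "(\<Sum>k\<in>UNIV. gam k i j x * G x $ k $ l) = lorentz (pd i (pd j X) x) (pd l X x)"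
proof -
  have "(\<Sum>k\<in>UNIV. gam k i j x * G x $ k $ l)
      = (\<Sum>m\<in>UNIV. lorentz (pd i (pd j X) x) (pd m X x) * (\<Sum>k\<in>UNIV. G x $ l $ k * Ginv x k m))"
    unfolding christoffel_eq[OF assms] sum_distrib_left sum_distrib_right
    using pos_def_matrix_sym[OF G_pos[OF assms]]
    by (subst sum.swap) (intro sum.cong refl, simp add: mult_ac)
  also have "\<dots> = lorentz (pd i (pd j X) x) (pd l X x)"
    unfolding pos_def_matrix_inverse_sum[OF G_pos[OF assms]] by (simp add: if_distrib cong: if_cong)
  finally show ?thesis .
qed

lemma Ck_christoffel: "Ck_on 1 V (gam k i j)"
proof -
  have G2: "Ck_on 2 V (\<lambda>y. G y $ p $ q)" for p q
    using Ck_on_bilinear[OF open_V bounded_bilinear_lorentz Ck_pd_X[of p] Ck_pd_X[of q]]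
    by (subst Ck_on_cong[OF open_V G_eq]) auto
  have "Ck_on 1 V (\<lambda>y. \<Sum>l\<in>UNIV. Ginv y k l * lorentz (pd i (pd j X) y) (pd l X y))" (is "Ck_on 1 V ?F")
    by (intro Ck_on_sum Ck_on_mult Ck_on_matrix_inv Ck_on_bilinear[OF _ bounded_bilinear_lorentz]
        open_V Ck_pd2_X G_pos Ck_on_antimono[OF G2] Ck_on_antimono[OF Ck_pd_X]) auto
  then show ?thesis
    using Ck_on_cong[OF open_V, of "gam k i j" ?F 1] christoffel_eq by blast
qed

text \<open>The second fundamental form, by the Gauss formula. Its trace \<open>mc\<close> is \<open>CARD('n)\<close> times the mean
  curvature vector.\<close>

definition II where
  "II i j x = pd i (pd j X) x - (\<Sum>m\<in>UNIV. gam m i j x *\<^sub>R pd m X x)"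

definition mc where
  "mc x = (\<Sum>i\<in>UNIV. \<Sum>j\<in>UNIV. Ginv x i j *\<^sub>R II i j x)"

lemma II_tangent: "x \<in> V \<Longrightarrow> lorentz (II i j x) (pd l X x) = 0"
  unfolding II_def lorentz_linear by (simp add: G_eq[symmetric] christoffel_lower)

lemma II_X: "x \<in> V \<Longrightarrow> lorentz (II i j x) (X x) = - G x $ i $ j"
  unfolding II_def lorentz_linear
  by (simp add: lorentz_commute[of _ "X x"] X_perp_tangent X_second)

lemma diff_II:
  assumes "x \<in> V"
  shows "II i j differentiable (at x)"
proof -
  have "Ck_on 1 V (\<lambda>x. pd i (pd j X) x - (\<Sum>m\<in>UNIV. gam m i j x *\<^sub>R pd m X x))"
    by (intro Ck_on_diff Ck_on_sum Ck_on_scaleR open_V Ck_pd2_X Ck_christoffel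
        Ck_on_antimono[OF Ck_pd_X]) auto
  then show ?thesis
    using Ck_on_differentiable assms unfolding II_def[abs_def] by force
qed

lemma pd_II_tangent:
  assumes "x \<in> V"
  shows "lorentz (pd i (II j k) x) (pd l X x) = - lorentz (II j k x) (II i l x)"
proof -
  have "pd i (\<lambda>y. lorentz (II j k y) (pd l X y)) x = pd i (\<lambda>y. 0) x"
    by (rule pd_cong[OF open_V assms II_tangent])
  then have "lorentz (pd i (II j k) x) (pd l X x) = - lorentz (II j k x) (pd i (pd l X) x)"
    using pd_lorentz[OF diff_II[OF assms] diff_X(2)[OF assms], of i j k l] by simp
  also have "pd i (pd l X) x = II i l x + (\<Sum>m\<in>UNIV. gam m i l x *\<^sub>R pd m X x)"
    by (simp add: II_def)
  finally show ?thesis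
    unfolding lorentz_linear by (simp add: II_tangent[OF assms])
qed

lemma third_derivative_tangent:
  assumes "x \<in> V"
  shows "lorentz (pd i (pd j (pd k X)) x) (pd l X x)
    = (\<Sum>m\<in>UNIV. G x $ l $ m * (pd i (gam m j k) x + (\<Sum>p\<in>UNIV. gam m i p x * gam p j k x)))
      - lorentz (II j k x) (II i l x)"
proof -
  have dgam: "gam m j k differentiable (at x)" for m
    using Ck_on_differentiable[OF Ck_christoffel] assms by simp
  have dterm: "(\<lambda>y. gam m j k y *\<^sub>R pd m X y) differentiable (at x)" for m
    using dgam diff_X(2)[OF assms] by (rule differentiable_scaleR)
  have "pd i (pd j (pd k X)) x
      = pd i (\<lambda>y. II j k y + (\<Sum>m\<in>UNIV. gam m j k y *\<^sub>R pd m X y)) x"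
    by (intro arg_cong[of _ _ "\<lambda>F. pd i F x"]) (simp add: II_def fun_eq_iff)
  also have "\<dots> = pd i (II j k) x + pd i (\<lambda>y. \<Sum>m\<in>UNIV. gam m j k y *\<^sub>R pd m X y) x"
    using dterm by (intro pd_add diff_II assms differentiable_sum) auto
  also have "pd i (\<lambda>y. \<Sum>m\<in>UNIV. gam m j k y *\<^sub>R pd m X y) x
      = (\<Sum>m\<in>UNIV. gam m j k x *\<^sub>R pd i (pd m X) x + pd i (gam m j k) x *\<^sub>R pd m X x)"
    by (simp add: pd_sum[OF dterm]
        pd_bilinear[OF bounded_bilinear_scaleR dgam diff_X(2)[OF assms]])
  finally have "lorentz (pd i (pd j (pd k X)) x) (pd l X x)
      = (\<Sum>m\<in>UNIV. gam m j k x * lorentz (pd i (pd m X) x) (pd l X x)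
          + pd i (gam m j k) x * G x $ m $ l) - lorentz (II j k x) (II i l x)"
    by (simp add: lorentz_linear pd_II_tangent[OF assms] G_eq[OF assms])
  also have "(\<Sum>m\<in>UNIV. gam m j k x * lorentz (pd i (pd m X) x) (pd l X x)
          + pd i (gam m j k) x * G x $ m $ l)
      = (\<Sum>p\<in>UNIV. \<Sum>m\<in>UNIV. gam p j k x * (gam m i p x * G x $ m $ l))
          + (\<Sum>m\<in>UNIV. pd i (gam m j k) x * G x $ m $ l)"
    unfolding christoffel_lower[OF assms, symmetric] by (simp add: sum.distrib sum_distrib_left)
  also have "\<dots> = (\<Sum>m\<in>UNIV. G x $ l $ m * (pd i (gam m j k) x
      + (\<Sum>p\<in>UNIV. gam m i p x * gam p j k x)))"
    by (subst sum.swap) (simp add: sum_distrib_left sum.distrib algebra_simps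
        pos_def_matrix_sym[OF G_pos[OF assms], of l])
  finally show ?thesis .
qed

text \<open>The Gauss equation. It is the tangential part of the identity which says that the third
  derivatives of \<open>X\<close> commute.\<close>

lemma gauss_equation:
  assumes "x \<in> V"
  shows "(\<Sum>m\<in>UNIV. G x $ l $ m * riemann G m k i j x)
    = lorentz (II j k x) (II i l x) - lorentz (II i k x) (II j l x)"
proof -
  have "(\<Sum>m\<in>UNIV. G x $ l $ m * riemann G m k i j x)
    = (\<Sum>m\<in>UNIV. G x $ l $ m * (pd i (gam m j k) x + (\<Sum>p\<in>UNIV. gam m i p x * gam p j k x)))
    - (\<Sum>m\<in>UNIV. G x $ l $ m * (pd j (gam m i k) x + (\<Sum>p\<in>UNIV. gam m j p x * gam p i k x)))"
    unfolding riemann_def by (simp add: sum_subtractf algebra_simps sum.distrib)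
  then show ?thesis
    using third_derivative_tangent[OF assms, of i j k l]
      third_derivative_tangent[OF assms, of j i k l] pd2_X_commute[OF assms, of i j k] by simp
qed

lemma riemann_trace:
  assumes "x \<in> V"
  shows "riemann G i k i j x = (\<Sum>l\<in>UNIV. Ginv x i l *
    (lorentz (II j k x) (II i l x) - lorentz (II i k x) (II j l x)))"
proof -
  have "(\<Sum>l\<in>UNIV. Ginv x i l * (\<Sum>m\<in>UNIV. G x $ l $ m * riemann G m k i j x))
      = (\<Sum>m\<in>UNIV. (\<Sum>l\<in>UNIV. Ginv x i l * G x $ l $ m) * riemann G m k i j x)"
    unfolding sum_distrib_left sum_distrib_right by (subst sum.swap) (simp add: mult.assoc)
  also have "\<dots> = riemann G i k i j x"
    unfolding pos_def_matrix_inverse_sum[OF G_pos[OF assms]]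
    by (simp add: if_distrib[of "\<lambda>c. c * _"] cong: if_cong)
  finally show ?thesis unfolding gauss_equation[OF assms] by simp
qed

text \<open>The normal space at a point is a Lorentzian plane containing the null vector \<open>X\<close>, so that the
  normal vectors orthogonal to \<open>X\<close> are its multiples. In terms of dimensions: \<open>X\<close>, the \<open>pd j X\<close> and
  \<open>e1\<close> are linearly independent, hence form a basis.\<close>

lemma normal_perp_X:
  assumes x: "x \<in> V" and vX: "lorentz v (X x) = 0" and vT: "\<And>j. lorentz v (pd j X x) = 0"
  shows "\<exists>s. v = s *\<^sub>R X x"
proof -
  define f :: "(real \<times> real) \<times> (real ^ 'n) \<Rightarrow> real \<times> (real ^ 'k)" where
    "f w = fst (fst w) *\<^sub>R X x + snd (fst w) *\<^sub>R e1 + (\<Sum>j\<in>UNIV. snd w $ j *\<^sub>R pd j X x)" for w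
  have lin: "linear f"
    by (rule linearI) (simp_all add: f_def algebra_simps sum.distrib scaleR_sum_right)
  have fX: "lorentz (f w) (X x) = - snd (fst w) * fst (X x)" for w
    unfolding f_def lorentz_linear
    by (simp add: X_null[OF x] lorentz_commute[of e1] lorentz_commute[of "pd _ X x" "X x"]
        X_perp_tangent[OF x] lorentz_e1)
  have fT: "lorentz (f w) (pd i X x) = (G x *v snd w) $ i" if "snd (fst w) = 0" for w i
    using that unfolding f_def lorentz_linear
    by (simp add: X_perp_tangent[OF x] matrix_vector_mult_def G_eq[OF x, symmetric]
        pos_def_matrix_sym[OF G_pos[OF x], of i] mult.commute)
  have ker: "snd (fst w) = 0 \<and> snd w = 0"
    if "lorentz (f w) (X x) = 0" "\<And>j. lorentz (f w) (pd j X x) = 0" for w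
  proof -
    have r: "snd (fst w) = 0" using that(1) X_future[OF x] fX[of w] by auto
    then have "G x *v snd w = 0" using fT that(2) by (simp add: vec_eq_iff)
    then show ?thesis
      using r G_pos[OF x] unfolding pos_def_matrix_def by (metis inner_zero_right less_irrefl)
  qed
  have "inj f"
  proof (subst linear_injective_0[OF lin], intro allI impI)
    fix w assume w: "f w = 0"
    then have k: "snd (fst w) = 0 \<and> snd w = 0" by (intro ker) (simp_all add: lorentz_linear)
    then have "fst (fst w) *\<^sub>R X x = 0" using w by (simp add: f_def)
    then have "fst (fst w) = 0" using X_future[OF x] by auto
    then show "w = 0" using k by (simp add: prod_eq_iff)
  qed
  then have "dim (range f) = DIM((real \<times> real) \<times> (real ^ 'n))"
    using dim_image_eq[OF lin, of UNIV] by (simp add: inj_on_subset)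
  then have "dim (range f) = DIM(real \<times> (real ^ 'k))"
    using codim by simp
  then have "span (range f) = UNIV"
    unfolding dim_eq_full .
  then have "surj f"
    using linear_subspace_image[OF lin subspace_UNIV] by (metis span_eq_iff)
  then obtain w where w: "v = f w" by (rule surjE)
  then have "snd (fst w) = 0 \<and> snd w = 0" using ker vX vT by blast
  then show ?thesis using w by (auto simp: f_def)
qed

lemma Ginv_sym: "x \<in> V \<Longrightarrow> Ginv x i j = Ginv x j i"
  by (rule pos_def_matrix_sym[OF pos_def_matrix_inv[OF G_pos]])

lemma Ginv_trace:
  assumes "x \<in> V"
  shows "(\<Sum>i\<in>UNIV. \<Sum>j\<in>UNIV. Ginv x i j * G x $ i $ j) = real CARD('n)"
proof -
  have "(\<Sum>j\<in>UNIV. Ginv x i j * G x $ i $ j) = 1" for i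
    using pos_def_matrix_inverse_sum(1)[OF G_pos[OF assms], of i i]
    by (simp add: pos_def_matrix_sym[OF G_pos[OF assms], of i])
  then show ?thesis by simp
qed

lemma mc_X:
  assumes "x \<in> V"
  shows "lorentz (mc x) (X x) = - real CARD('n)"
  using Ginv_trace[OF assms] unfolding mc_def lorentz_linear
  by (simp add: II_X[OF assms] sum_negf)

lemma mc_tangent: "x \<in> V \<Longrightarrow> lorentz (mc x) (pd l X x) = 0"
  unfolding mc_def lorentz_linear by (simp add: II_tangent)

text \<open>Up to multiples of \<open>X\<close> the second fundamental form is umbilical. Since \<open>X\<close> is null, these
  multiples do not contribute to its norm, and the Gauss equation expresses the scalar curvature
  through the mean curvature vector alone.\<close>

lemma II_umbilical_mod_X:
  assumes "x \<in> V"
  shows "\<exists>z. II i j x = z *\<^sub>R X x + (G x $ i $ j / real CARD('n)) *\<^sub>R mc x"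
proof -
  have "\<exists>z. II i j x - (G x $ i $ j / real CARD('n)) *\<^sub>R mc x = z *\<^sub>R X x"
    by (rule normal_perp_X[OF assms])
       (simp_all add: lorentz_linear II_X[OF assms] mc_X[OF assms] II_tangent[OF assms]
         mc_tangent[OF assms])
  then show ?thesis by (metis add.commute diff_add_cancel)
qed

lemma scalar_curvature_mc:
  assumes "x \<in> V"
  shows "(\<Sum>j\<in>UNIV. \<Sum>k\<in>UNIV. Ginv x j k * ricci G j k x)
    = (1 - 1 / real CARD('n)) * lorentz (mc x) (mc x)"
proof -
  let ?n = "real CARD('n)" and ?M = "lorentz (mc x) (mc x)"
  let ?C = "\<lambda>T. \<Sum>j\<in>UNIV. \<Sum>k\<in>UNIV. \<Sum>i\<in>UNIV. \<Sum>l\<in>UNIV. Ginv x j k * (Ginv x i l * T i j k l)"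
  obtain z where z: "II i j x = z i j *\<^sub>R X x + (G x $ i $ j / ?n) *\<^sub>R mc x" for i j
    using II_umbilical_mod_X[OF assms] by metis
  have "mc x = (\<Sum>i\<in>UNIV. \<Sum>j\<in>UNIV. Ginv x i j * z i j) *\<^sub>R X x
      + ((\<Sum>i\<in>UNIV. \<Sum>j\<in>UNIV. Ginv x i j * G x $ i $ j) / ?n) *\<^sub>R mc x"
    by (subst mc_def)
       (simp add: z scaleR_sum_left sum_divide_distrib sum.distrib scaleR_add_right)
  then have "(\<Sum>i\<in>UNIV. \<Sum>j\<in>UNIV. Ginv x i j * z i j) *\<^sub>R X x = 0"
    unfolding Ginv_trace[OF assms] by simp
  then have z0: "(\<Sum>i\<in>UNIV. \<Sum>j\<in>UNIV. Ginv x i j * z i j) = 0"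
    using X_future[OF assms] by auto
  have prod: "lorentz (II i k x) (II j l x)
      = - (z i k * G x $ j $ l) - z j l * G x $ i $ k + G x $ i $ k * G x $ j $ l * ?M / ?n\<^sup>2"
    for i j k l
    unfolding z lorentz_linear
    by (simp add: X_null[OF assms] mc_X[OF assms] lorentz_commute[of "X x" "mc x"] power2_eq_square
        field_simps)
  have raise: "(\<Sum>j\<in>UNIV. Ginv x j k * (\<Sum>l\<in>UNIV. Ginv x i l * G x $ j $ l)) = Ginv x i k" for i k
  proof -
    have "(\<Sum>j\<in>UNIV. Ginv x j k * (\<Sum>l\<in>UNIV. Ginv x i l * G x $ j $ l))
        = (\<Sum>j\<in>UNIV. Ginv x j k * (\<Sum>l\<in>UNIV. Ginv x i l * G x $ l $ j))"
      by (intro sum.cong refl arg_cong2[of _ _ _ _ "(*)"]) (simp add: pos_def_matrix_sym[OF G_pos[OF assms]])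
    also have "\<dots> = Ginv x i k"
      unfolding pos_def_matrix_inverse_sum[OF G_pos[OF assms]] by (simp add: if_distrib cong: if_cong)
    finally show ?thesis .
  qed
  have contract: "?C (\<lambda>i j k l. (w i k * G x $ j $ l))
      = (\<Sum>i\<in>UNIV. \<Sum>k\<in>UNIV. Ginv x i k * w i k)" for w :: "'n \<Rightarrow> 'n \<Rightarrow> real"
  proof -
    have "?C (\<lambda>i j k l. (w i k * G x $ j $ l))
       = (\<Sum>k\<in>UNIV. \<Sum>i\<in>UNIV. \<Sum>j\<in>UNIV. \<Sum>l\<in>UNIV. w i k * (Ginv x j k * (Ginv x i l * G x $ j $ l)))"
      by (rule trans[OF sum.swap], rule sum.cong[OF refl], rule trans[OF sum.swap],
          rule sum.cong[OF refl]) (simp add: mult_ac)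
    also have "\<dots> = (\<Sum>k\<in>UNIV. \<Sum>i\<in>UNIV. w i k * Ginv x i k)"
      unfolding sum_distrib_left[symmetric] raise ..
    also have "\<dots> = (\<Sum>i\<in>UNIV. \<Sum>k\<in>UNIV. Ginv x i k * w i k)"
      by (subst sum.swap) (simp add: mult.commute)
    finally show ?thesis .
  qed
  have contract': "?C (\<lambda>i j k l. (w j l * G x $ i $ k))
      = (\<Sum>i\<in>UNIV. \<Sum>k\<in>UNIV. Ginv x i k * w i k)" for w :: "'n \<Rightarrow> 'n \<Rightarrow> real"
  proof -
    have "?C (\<lambda>i j k l. (w j l * G x $ i $ k))
        = (\<Sum>j\<in>UNIV. \<Sum>i\<in>UNIV. \<Sum>l\<in>UNIV. \<Sum>k\<in>UNIV. Ginv x j k * (Ginv x i l * (w j l * G x $ i $ k)))"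
      by (rule sum.cong[OF refl], rule trans[OF sum.swap], rule sum.cong[OF refl], rule sum.swap)
    also have "\<dots> = (\<Sum>i\<in>UNIV. \<Sum>l\<in>UNIV. \<Sum>j\<in>UNIV. \<Sum>k\<in>UNIV. Ginv x j k * (Ginv x i l * (w j l * G x $ i $ k)))"
      by (rule trans[OF sum.swap], rule sum.cong[OF refl], rule sum.swap)
    also have "\<dots> = (\<Sum>i\<in>UNIV. \<Sum>l\<in>UNIV. \<Sum>j\<in>UNIV. \<Sum>k\<in>UNIV. Ginv x i l * (Ginv x j k * (w j l * G x $ i $ k)))"
      by (simp add: mult.left_commute)
    finally show ?thesis unfolding contract .
  qed
  have "(\<Sum>j\<in>UNIV. \<Sum>k\<in>UNIV. Ginv x j k * ricci G j k x)
    = ?C (\<lambda>i j k l. lorentz (II j k x) (II i l x))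
     - ?C (\<lambda>i j k l. lorentz (II i k x) (II j l x))"
    unfolding ricci_def riemann_trace[OF assms]
    by (simp add: sum_distrib_left right_diff_distrib sum_subtractf)
  also have "?C (\<lambda>i j k l. lorentz (II j k x) (II i l x))
      = ?M"
    unfolding mc_def lorentz_linear real_scaleR_def
    by (simp add: sum_distrib_left)
       (intro sum.cong refl arg_cong2[of _ _ _ _ "(*)"] lorentz_commute)
  also have "?C (\<lambda>i j k l. lorentz (II i k x) (II j l x))
      = - ?C (\<lambda>i j k l. (z i k * G x $ j $ l))
        - ?C (\<lambda>i j k l. (z j l * G x $ i $ k))
        + ?C (\<lambda>i j k l. (G x $ i $ k * G x $ j $ l)) * (?M / ?n\<^sup>2)"
    unfolding prod
    by (simp add: sum_distrib_right sum_distrib_left sum_negf sum_subtractf sum.distrib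
        sum_divide_distrib algebra_simps)
  also have "\<dots> = ?M / ?n"
    unfolding contract contract' z0 Ginv_trace[OF assms] by (simp add: power2_eq_square)
  finally show ?thesis by (simp add: algebra_simps)
qed

text \<open>\<open>mc\<close> is the Laplacian of the vector-valued function \<open>X\<close> (Beltrami).\<close>

lemma laplace_height:
  assumes "x \<in> V"
  shows "fst (mc x) = laplace_coord G (\<lambda>y. fst (X y)) x"
proof -
  have p1: "pd i (\<lambda>y. fst (X y)) y = fst (pd i X y)" if "y \<in> V" for i y
    by (rule pd_linear[OF bounded_linear_fst diff_X(1)[OF that]])
  have p2: "pd i (pd j (\<lambda>y. fst (X y))) x = fst (pd i (pd j X) x)" for i j
  proof -
    have "pd i (pd j (\<lambda>y. fst (X y))) x = pd i (\<lambda>y. fst (pd j X y)) x"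
      by (rule pd_cong[OF open_V assms p1])
    then show ?thesis using pd_linear[OF bounded_linear_fst diff_X(2)[OF assms]] by simp
  qed
  show ?thesis
    unfolding laplace_coord_def mc_def II_def
    by (simp add: p1[OF assms] p2 fst_sum)
qed

text \<open>The normal part \<open>N = e1 + grad v\<close> of \<open>e1\<close> and the vector \<open>X\<close> span the normal plane, so that \<open>mc\<close> is
  determined by its products with \<open>X\<close>, which is \<open>- CARD('n)\<close>, and with \<open>e1\<close>, which is the Laplacian
  of the height up to sign.\<close>

lemma lorentz_mc_mc:
  assumes "x \<in> V"
  defines "v \<equiv> \<lambda>y. fst (X y)"
  shows "lorentz (mc x) (mc x) = (real CARD('n))\<^sup>2 * (1 + cometric G x (\<lambda>i. pd i v x) (\<lambda>i. pd i v x)) / (v x)\<^sup>2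
     - 2 * real CARD('n) * laplace_coord G v x / v x"
proof -
  let ?n = "real CARD('n)"
  have v: "0 < v x" using X_future assms by simp
  have dv: "pd i v x = fst (pd i X x)" for i
    unfolding v_def by (rule pd_linear[OF bounded_linear_fst diff_X(1)[OF assms(1)]])
  define gr where "gr = (\<Sum>i\<in>UNIV. \<Sum>j\<in>UNIV. (Ginv x i j * pd j v x) *\<^sub>R pd i X x)"
  define N where "N = e1 + gr"
  have grX: "lorentz gr (X x) = 0"
    unfolding gr_def lorentz_linear
    by (simp add: lorentz_commute[of "pd _ X x" "X x"] X_perp_tangent[OF assms(1)])
  have grT: "lorentz gr (pd l X x) = pd l v x" for l
  proof -
    have "lorentz gr (pd l X x) = (\<Sum>j\<in>UNIV. pd j v x * (\<Sum>i\<in>UNIV. G x $ l $ i * Ginv x i j))"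
      unfolding gr_def lorentz_linear sum_distrib_left
      by (subst sum.swap) (simp add: G_eq[OF assms(1), symmetric]
          pos_def_matrix_sym[OF G_pos[OF assms(1)], of l] mult_ac)
    then show ?thesis
      unfolding pos_def_matrix_inverse_sum[OF G_pos[OF assms(1)]] by (simp add: if_distrib cong: if_cong)
  qed
  have NT: "lorentz N (pd l X x) = 0" for l
    unfolding N_def lorentz_linear grT by (simp add: lorentz_commute[of e1] lorentz_e1 dv)
  have NX: "lorentz N (X x) = - v x"
    unfolding N_def lorentz_linear grX by (simp add: lorentz_commute[of e1] lorentz_e1 v_def)
  have NN: "lorentz N N = - 1 - cometric G x (\<lambda>i. pd i v x) (\<lambda>i. pd i v x)"
  proof -
    have "lorentz N gr = 0" unfolding gr_def lorentz_linear by (simp add: NT)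
    then have "lorentz N N = lorentz e1 N" unfolding N_def by (simp add: lorentz_linear lorentz_commute)
    also have "\<dots> = - fst N" by (simp add: lorentz_commute[of e1] lorentz_e1)
    also have "fst N = 1 + cometric G x (\<lambda>i. pd i v x) (\<lambda>i. pd i v x)"
      by (simp add: N_def gr_def cometric_def e1_def fst_sum dv mult_ac)
    finally show ?thesis by simp
  qed
  have Nmc: "lorentz N (mc x) = - laplace_coord G v x"
  proof -
    have "lorentz gr (mc x) = 0"
      unfolding gr_def lorentz_linear by (simp add: lorentz_commute[of _ "mc x"] mc_tangent[OF assms(1)])
    then show ?thesis
      using laplace_height[OF assms(1)] unfolding N_def lorentz_linear v_def
      by (simp add: lorentz_commute[of e1] lorentz_e1)
  qed
  have "\<exists>s. mc x - (?n / v x) *\<^sub>R N = s *\<^sub>R X x"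
    using v by (intro normal_perp_X[OF assms(1)])
      (simp_all add: lorentz_linear mc_X[OF assms(1)] mc_tangent[OF assms(1)] NX NT)
  then obtain s where "mc x - (?n / v x) *\<^sub>R N = s *\<^sub>R X x" by blast
  then have mc: "mc x = s *\<^sub>R X x + (?n / v x) *\<^sub>R N" by (simp add: algebra_simps)
  have "lorentz N (mc x) = - s * v x + (?n / v x) * lorentz N N"
    unfolding mc lorentz_linear NX by simp
  then have s: "s = (laplace_coord G v x + (?n / v x) * lorentz N N) / v x"
    using Nmc v by (simp add: field_simps)
  have "lorentz (mc x) (mc x) = - 2 * s * ?n + (?n / v x)\<^sup>2 * lorentz N N"
    using v unfolding mc lorentz_linear
    by (simp add: X_null[OF assms(1)] NX lorentz_commute[of "X x" N] power2_eq_square field_simps)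
  also have "\<dots> = ?n\<^sup>2 * (1 + cometric G x (\<lambda>i. pd i v x) (\<lambda>i. pd i v x)) / (v x)\<^sup>2
      - 2 * ?n * laplace_coord G v x / v x"
    unfolding s NN using v by (simp add: field_simps power2_eq_square)
  finally show ?thesis .
qed

lemma cometric_sym:
  assumes "x \<in> V"
  shows "cometric G x a b = cometric G x b a"
  unfolding cometric_def
  by (subst sum.swap) (intro sum.cong refl, simp add: Ginv_sym[OF assms] mult_ac)

lemma cometric_nonneg:
  assumes "x \<in> V"
  shows "0 \<le> cometric G x a a"
  using pos_def_matrix_nonneg[OF pos_def_matrix_inv[OF G_pos[OF assms]], of a]
  by (simp add: cometric_def mult_ac)

lemma cometric_add_left: "cometric G x (\<lambda>i. a i + b i) c = cometric G x a c + cometric G x b c"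
  and cometric_add_right: "cometric G x a (\<lambda>i. b i + c i) = cometric G x a b + cometric G x a c"
  and cometric_mult_left: "cometric G x (\<lambda>i. r * a i) b = r * cometric G x a b"
  and cometric_mult_right: "cometric G x a (\<lambda>i. r * b i) = r * cometric G x a b"
  by (simp_all add: cometric_def sum.distrib sum_distrib_left algebra_simps)

text \<open>The vector \<open>Ny\<close> is the normal part of \<open>e1\<close> for the conformal immersion \<open>Y = l X\<close>. The sum is, up to
  sign and a power of \<open>l\<close>, the Laplacian of the height of \<open>Y\<close> for the metric induced by \<open>Y\<close>. Expanding
  the derivatives of \<open>l X\<close> expresses it through the Christoffel symbols of \<open>G\<close> alone.\<close>

lemma conformal_expansion:
  assumes x: "x \<in> V"
    and l: "Ck_on 2 V l" "0 < l x"
    and Y: "\<And>y. y \<in> V \<Longrightarrow> Y y = l y *\<^sub>R X y"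
    and Ny: "Ny = e1 - (\<Sum>j\<in>UNIV. (\<Sum>k\<in>UNIV. Ginv x j k / (l x)\<^sup>2 * lorentz e1 (pd k Y x)) *\<^sub>R pd j Y x)"
  defines "v \<equiv> \<lambda>y. fst (X y)" and "n \<equiv> real CARD('n)"
  shows "(\<Sum>i\<in>UNIV. \<Sum>j\<in>UNIV. Ginv x i j * lorentz Ny (pd i (pd j Y) x))
    = - (l x * laplace_coord G v x + n * cometric G x (\<lambda>i. pd i v x) (\<lambda>i. pd i l x)
         + (n - 2) * v x / l x * cometric G x (\<lambda>i. pd i l x) (\<lambda>i. pd i l x)
         + v x * laplace_coord G l x)" (is "?sum = ?rhs")
    and "pd i (\<lambda>y. fst (Y y)) x = l x * pd i v x + v x * pd i l x"
    and "lorentz (Y x) (pd i (pd j Y) x) = - (l x)\<^sup>2 * G x $ i $ j"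
proof -
  have l2: "Ck_on (Suc (Suc 0)) V l" using l(1) by (simp add: numeral_2_eq_2)
  have dl: "l differentiable (at y)" "pd i l differentiable (at y)" if "y \<in> V" for y i
    using l2 Ck_on_pd[OF l2, of i] that by auto
  have Y1: "pd i Y y = l y *\<^sub>R pd i X y + pd i l y *\<^sub>R X y" if "y \<in> V" for i y
    by (rule trans[OF _ pd_bilinear[OF bounded_bilinear_scaleR dl(1)[OF that] diff_X(1)[OF that]]],
        rule pd_cong[OF open_V that], rule Y)
  have dX: "l differentiable (at x)" "pd i l differentiable (at x)" "X differentiable (at x)"
    "pd i X differentiable (at x)" for i
    using dl diff_X x by auto
  have Y2: "pd i (pd j Y) x = l x *\<^sub>R pd i (pd j X) x + pd i l x *\<^sub>R pd j X x
      + (pd j l x *\<^sub>R pd i X x + pd i (pd j l) x *\<^sub>R X x)" for i j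
  proof -
    have "pd i (pd j Y) x = pd i (\<lambda>y. l y *\<^sub>R pd j X y + pd j l y *\<^sub>R X y) x"
      by (rule pd_cong[OF open_V x Y1])
    also have "\<dots> = pd i (\<lambda>y. l y *\<^sub>R pd j X y) x + pd i (\<lambda>y. pd j l y *\<^sub>R X y) x"
      by (intro pd_add differentiable_scaleR dX)
    finally show ?thesis
      by (simp add: pd_bilinear[OF bounded_bilinear_scaleR dX(1,4)]
          pd_bilinear[OF bounded_bilinear_scaleR dX(2,3)])
  qed
  have v1: "pd i v x = fst (pd i X x)" for i
    unfolding v_def by (rule pd_linear[OF bounded_linear_fst diff_X(1)[OF x]])
  have U0: "pd i (\<lambda>y. fst (Y y)) x = fst (pd i Y x)" for i
  proof -
    have "pd i (\<lambda>y. fst (Y y)) x = pd i (\<lambda>y. fst (l y *\<^sub>R X y)) x"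
      by (rule pd_cong[OF open_V x]) (simp add: Y)
    also have "\<dots> = fst (pd i (\<lambda>y. l y *\<^sub>R X y) x)"
      by (intro pd_linear bounded_linear_fst differentiable_scaleR dX)
    also have "pd i (\<lambda>y. l y *\<^sub>R X y) x = pd i Y x"
      by (rule pd_cong[OF open_V x]) (simp add: Y)
    finally show ?thesis .
  qed
  show "pd i (\<lambda>y. fst (Y y)) x = l x * pd i v x + v x * pd i l x"
    unfolding U0 v1 Y1[OF x] by (simp add: v_def)
  show "lorentz (Y x) (pd i (pd j Y) x) = - (l x)\<^sup>2 * G x $ i $ j"
    unfolding Y2 Y[OF x] lorentz_linear
    by (simp add: X_second[OF x] X_perp_tangent[OF x] X_null[OF x] power2_eq_square)
  define U where "U i = l x * pd i v x + v x * pd i l x" for i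
  have e1Y: "lorentz e1 (pd k Y x) = - U k" for k
    unfolding Y1[OF x] U_def v1 lorentz_linear by (simp add: lorentz_commute[of e1] lorentz_e1 v_def mult.commute)
  define c where "c j = (\<Sum>k\<in>UNIV. Ginv x j k * U k) / l x" for j
  define s where "s = cometric G x (\<lambda>i. pd i l x) U / (l x)\<^sup>2"
  have Ny': "Ny = e1 + (\<Sum>j\<in>UNIV. c j *\<^sub>R pd j X x) + s *\<^sub>R X x"
  proof -
    have coeff: "(\<Sum>k\<in>UNIV. Ginv x j k / (l x)\<^sup>2 * lorentz e1 (pd k Y x)) = - (c j / l x)" for j
      using l(2) unfolding e1Y c_def
      by (simp add: sum_divide_distrib sum_negf power2_eq_square)
    have "(\<Sum>j\<in>UNIV. (c j / l x) * pd j l x) = s"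
      unfolding c_def s_def cometric_def sum_divide_distrib sum_distrib_right
      by (intro sum.cong refl) (simp add: power2_eq_square field_simps)
    moreover have "Ny = e1 + (\<Sum>j\<in>UNIV. (c j / l x) *\<^sub>R (l x *\<^sub>R pd j X x + pd j l x *\<^sub>R X x))"
      unfolding Ny coeff by (simp add: Y1[OF x] sum_negf)
    ultimately show ?thesis
      using l(2) by (simp add: scaleR_add_right sum.distrib scaleR_sum_left[symmetric])
  qed
  have NX: "lorentz Ny (X x) = - v x"
    unfolding Ny' lorentz_linear
    by (simp add: lorentz_commute[of e1] lorentz_e1 v_def X_null[OF x]
        lorentz_commute[of "pd _ X x" "X x"] X_perp_tangent[OF x])
  have NT: "lorentz Ny (pd m X x) = v x * pd m l x / l x" for m
  proof -
    have "(\<Sum>j\<in>UNIV. c j * G x $ j $ m) = U m / l x"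
    proof -
      have "(\<Sum>j\<in>UNIV. c j * G x $ j $ m)
          = (\<Sum>k\<in>UNIV. U k * (\<Sum>j\<in>UNIV. G x $ m $ j * Ginv x j k)) / l x"
        unfolding c_def sum_divide_distrib sum_distrib_left sum_distrib_right
        by (subst sum.swap) (simp add: pos_def_matrix_sym[OF G_pos[OF x], of m] mult_ac)
      then show ?thesis
        unfolding pos_def_matrix_inverse_sum[OF G_pos[OF x]] by (simp add: if_distrib cong: if_cong)
    qed
    then have "lorentz Ny (pd m X x) = - pd m v x + U m / l x"
      unfolding Ny' lorentz_linear
      by (simp add: lorentz_commute[of e1] lorentz_e1 v1 G_eq[OF x, symmetric] X_perp_tangent[OF x])
    then show ?thesis using l(2) by (simp add: U_def field_simps)
  qed
  have Nmc: "lorentz Ny (mc x) = - laplace_coord G v x - n * s"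
    unfolding Ny' lorentz_linear
    by (simp add: lorentz_commute[of _ "mc x"] lorentz_e1 laplace_height[OF x] v_def mc_X[OF x]
        mc_tangent[OF x] n_def)
  \<comment> \<open>The tangential parts of the second derivatives of \<open>X\<close> contribute because \<open>Ny\<close> is normal
    to \<open>Y\<close> and not to \<open>X\<close>; with the second derivatives of \<open>l\<close> they make up the Laplacian of \<open>l\<close>.\<close>
  have NII: "(\<Sum>i\<in>UNIV. \<Sum>j\<in>UNIV. Ginv x i j * lorentz Ny (II i j x)) = lorentz Ny (mc x)"
    unfolding mc_def lorentz_linear by simp
  have "lorentz Ny (pd i (pd j Y) x) = l x * lorentz Ny (II i j x)
      - v x * (pd i (pd j l) x - (\<Sum>m\<in>UNIV. gam m i j x * pd m l x))
      + 2 * v x / l x * (pd i l x * pd j l x)" for i j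
  proof -
    have "pd i (pd j X) x = II i j x + (\<Sum>m\<in>UNIV. gam m i j x *\<^sub>R pd m X x)"
      by (simp add: II_def)
    then have "lorentz Ny (pd i (pd j X) x)
        = lorentz Ny (II i j x) + (\<Sum>m\<in>UNIV. gam m i j x * (v x * pd m l x / l x))"
      by (simp add: lorentz_linear NT)
    also have "(\<Sum>m\<in>UNIV. gam m i j x * (v x * pd m l x / l x))
        = v x / l x * (\<Sum>m\<in>UNIV. gam m i j x * pd m l x)"
      by (simp add: sum_distrib_left mult_ac)
    finally show ?thesis
      unfolding Y2 lorentz_linear NX NT using l(2) by (simp add: field_simps)
  qed
  then have "?sum
    = l x * (\<Sum>i\<in>UNIV. \<Sum>j\<in>UNIV. Ginv x i j * lorentz Ny (II i j x)) - v x * laplace_coord G l x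
      + 2 * v x / l x * cometric G x (\<lambda>i. pd i l x) (\<lambda>i. pd i l x)"
    unfolding laplace_coord_def cometric_def sum_distrib_left
    by (simp add: sum.distrib[symmetric] sum_subtractf[symmetric])
       (intro sum.cong refl, simp add: algebra_simps)
  also have "\<dots> = - (l x * laplace_coord G v x + n * l x * s - 2 * v x / l x * cometric G x (\<lambda>i. pd i l x) (\<lambda>i. pd i l x)
         + v x * laplace_coord G l x)"
    unfolding NII Nmc by (simp add: algebra_simps)
  also have "n * l x * s = n * cometric G x (\<lambda>i. pd i v x) (\<lambda>i. pd i l x)
      + n * v x / l x * cometric G x (\<lambda>i. pd i l x) (\<lambda>i. pd i l x)"
    using l(2) cometric_sym[OF x, of "\<lambda>i. pd i l x" "\<lambda>i. pd i v x"]
    unfolding s_def U_def[abs_def] cometric_add_right cometric_mult_right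
    by (simp add: field_simps power2_eq_square)
  finally show "?sum = ?rhs"
    by (simp add: algebra_simps diff_divide_distrib)
qed

end

section \<open>The conformal factor of a weakly trapped immersion\<close>

lemma smooth_atlas_chart:
  assumes "smooth_atlas A" "c \<in> A"
  shows "open (fst c)" "open (chart_range c)" "continuous_on (fst c) (snd c)"
    "continuous_on (chart_range c) (chart_inv c)"
    "\<And>p. p \<in> fst c \<Longrightarrow> snd c p \<in> chart_range c" "\<And>p. p \<in> fst c \<Longrightarrow> chart_inv c (snd c p) = p"
    "\<And>a. a \<in> chart_range c \<Longrightarrow> chart_inv c a \<in> fst c"
    "\<And>a. a \<in> chart_range c \<Longrightarrow> snd c (chart_inv c a) = a"
proof -
  have h: "homeomorphism (fst c) (chart_range c) (snd c) (chart_inv c)"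
    and "open (fst c)" "open (chart_range c)"
    using assms unfolding smooth_atlas_def by blast+
  then show "open (fst c)" "open (chart_range c)" by auto
  show "continuous_on (fst c) (snd c)" "continuous_on (chart_range c) (chart_inv c)"
    using h unfolding homeomorphism_def by auto
  show "\<And>p. p \<in> fst c \<Longrightarrow> snd c p \<in> chart_range c" "\<And>p. p \<in> fst c \<Longrightarrow> chart_inv c (snd c p) = p"
    "\<And>a. a \<in> chart_range c \<Longrightarrow> chart_inv c a \<in> fst c"
    "\<And>a. a \<in> chart_range c \<Longrightarrow> snd c (chart_inv c a) = a"
    using h unfolding homeomorphism_def by auto
qed

lemma laplacian_eq_laplace_coord:
  assumes "chart_inv c (snd c p) = p"
  shows "laplacian g c f p = laplace_coord (g c \<circ> chart_inv c) (f \<circ> chart_inv c) (snd c p)"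
  unfolding laplacian_def laplace_coord_def chart_pd_def using assms by simp

lemma pos_def_matrix_inv_scaleR:
  assumes "pos_def_matrix G" "r \<noteq> 0"
  shows "matrix_inv (r *\<^sub>R G) = (1 / r) *\<^sub>R matrix_inv G"
proof -
  have 1: "(r *\<^sub>R G) ** ((1 / r) *\<^sub>R matrix_inv G) = mat 1"
    "((1 / r) *\<^sub>R matrix_inv G) ** (r *\<^sub>R G) = mat 1"
    using pos_def_matrix_inverse_sum[OF assms(1)] assms(2)
    by (simp_all add: matrix_matrix_mult_def mat_def vec_eq_iff)
  then have "\<exists>A'. (r *\<^sub>R G) ** A' = mat 1 \<and> A' ** (r *\<^sub>R G) = mat 1" by blast
  then have "(r *\<^sub>R G) ** matrix_inv (r *\<^sub>R G) = mat 1"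
    unfolding matrix_inv_def by (metis (mono_tags, lifting) someI_ex)
  then show ?thesis
    using 1(2) by (metis matrix_mul_assoc matrix_mul_lid matrix_mul_rid)
qed

text \<open>The conformal change of the scalar curvature, in the form in which it arises here. The numbers
  stand for values at a point: \<open>v\<close> is the height of \<open>X\<close>; \<open>Lv\<close> and \<open>Ll\<close> are the Laplacians of \<open>v\<close> and \<open>l\<close>;
  \<open>a\<close>, \<open>b\<close>, \<open>d\<close> are the products \<open>\<langle>dv, dv\<rangle>\<close>, \<open>\<langle>dv, dl\<rangle>\<close>, \<open>\<langle>dl, dl\<rangle>\<close>; \<open>M\<close> is the square of the trace of the
  second fundamental form of \<open>X\<close>, and \<open>S\<close> the scalar curvature. The last hypothesis is \<open>\<theta>\<^sub>\<eta> \<ge> 0\<close>. The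
  terms in \<open>b\<close> cancel, and the term in \<open>d\<close> has the factor \<open>n - 4\<close>, whence the bound on the dimension.\<close>

lemma expansion_comparison:
  fixes n l v Lv Ll a b d M S :: real
  assumes "2 \<le> n" "n \<le> 4" "0 < l" "0 < v" "0 \<le> d"
    and M: "M = n\<^sup>2 * (1 + a) / v\<^sup>2 - 2 * n * Lv / v"
    and S: "S = (1 - 1 / n) * M"
    and theta: "0 \<le> - n * ((1 + (l\<^sup>2 * a + 2 * l * v * b + v\<^sup>2 * d) / l\<^sup>2) / (2 * (l * v)\<^sup>2))
        + (l * Lv + n * b + (n - 2) * v / l * d + v * Ll) / (l * v * l\<^sup>2)"
  shows "S / (2 * (n - 1)) * l \<le> Ll"
proof -
  have "- n * ((1 + (l\<^sup>2 * a + 2 * l * v * b + v\<^sup>2 * d) / l\<^sup>2) / (2 * (l * v)\<^sup>2))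
        + (l * Lv + n * b + (n - 2) * v / l * d + v * Ll) / (l * v * l\<^sup>2)
      = (1 / l\<^sup>2) * (- M / (2 * n) + Ll / l + (n - 4) / 2 * (d / l\<^sup>2))"
    using assms(1,3,4) unfolding M by (simp add: divide_simps power2_eq_square) (simp add: algebra_simps)
  with theta have "0 \<le> (1 / l\<^sup>2) * (- M / (2 * n) + Ll / l + (n - 4) / 2 * (d / l\<^sup>2))" by simp
  then have "0 \<le> - M / (2 * n) + Ll / l + (n - 4) / 2 * (d / l\<^sup>2)"
    using assms(3) by (metis mult_le_cancel_left_pos mult_zero_right zero_less_divide_1_iff zero_less_power)
  moreover have "(n - 4) / 2 * (d / l\<^sup>2) \<le> 0"
    using assms by (intro mult_nonpos_nonneg) auto
  moreover have "S / (2 * (n - 1)) = M / (2 * n)"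
    using assms(1) unfolding S by (simp add: field_simps)
  moreover have "- M / (2 * n) = - (M / (2 * n))" by simp
  ultimately have "S / (2 * (n - 1)) \<le> Ll / l" by linarith
  then show ?thesis using assms(3) by (simp add: field_simps)
qed

text \<open>Since \<open>\<theta>\<^sub>\<xi> = 1\<close>, the immersion can only be trapped with \<open>\<theta>\<^sub>\<eta> \<ge> 0\<close>. As the field \<open>\<eta>\<close> is normal, the trace
  of its shape operator is obtained by differentiating \<open>\<langle>\<eta>, \<partial>\<^sub>j \<psi>\<rangle> = 0\<close>: what enters is the value of \<open>\<eta>\<close>,
  and of its derivatives only that they exist.\<close>

lemma laplacian_conformal_factor_ge:
  fixes A :: "('p::{t2_space, second_countable_topology}, 'n::finite) chart set"
    and \<psi> :: "'p \<Rightarrow> real \<times> (real ^ 'k::finite)"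
  assumes dim: "2 \<le> CARD('n)" "CARD('n) \<le> 4" "CARD('k) + 1 = CARD('n) + 2"
    and atlas: "smooth_atlas A" and metric: "riemannian_metric A g"
    and immersion: "spacelike_immersion A \<psi>" and cone: "range \<psi> \<subseteq> future_light_cone"
    and trapped: "weakly_trapped A \<psi>"
    and lam: "smooth_map A lam" "\<And>p. 0 < lam p"
    and conf: "conformal_metrics A (induced_metric \<psi>) lam g"
    and c: "c \<in> A" and p: "p \<in> fst c"
  shows "scalar_curvature g c p / (2 * (real CARD('n) - 1)) * lam p \<le> laplacian g c lam p"
proof -
  note chart = smooth_atlas_chart[OF atlas c]
  define V where "V = chart_range c"
  define x where "x = snd c p"
  define Y where "Y = \<psi> \<circ> chart_inv c"
  define l where "l = lam \<circ> chart_inv c"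
  define G where "G = g c \<circ> chart_inv c"
  define X where "X y = inverse (l y) *\<^sub>R Y y" for y
  define v where "v y = fst (X y)" for y
  let ?n = "real CARD('n)"
  have V: "open V" and x: "x \<in> V"
    using chart p by (auto simp: V_def x_def)
  have Y3: "Ck_on 3 V Y" and l3: "Ck_on 3 V l"
    using immersion lam(1) c
    unfolding spacelike_immersion_def smooth_map_def smooth_on_def V_def Y_def l_def by blast+
  have lpos: "0 < l y" for y using lam(2) by (simp add: l_def)
  have X3: "Ck_on 3 V X"
    unfolding X_def by (intro Ck_on_scaleR Ck_on_inverse V Y3 l3) (use lpos in \<open>auto simp: less_le\<close>)
  have YlX: "Y y = l y *\<^sub>R X y" for y
    using lpos[of y] by (simp add: X_def)
  have Gpos: "pos_def_matrix (G y)" if "y \<in> V" for y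
  proof -
    have "pos_def_matrix (g c p)" if "p \<in> fst c" for p
      using metric c that unfolding riemannian_metric_def by blast
    from this[OF chart(7)] show ?thesis using that by (simp add: G_def V_def)
  qed
  have Ynull: "lorentz (Y y) (Y y) = 0" and Yfut: "0 < fst (Y y)" for y
    using cone unfolding future_light_cone_def Y_def by auto
  have dY: "Y differentiable (at y)" "pd i Y differentiable (at y)" if "y \<in> V" for y i
    using Ck_on_differentiable[OF Y3] Ck_on_differentiable[OF Ck_on_pd, of 1 V Y]
      Ck_on_antimono[OF Y3, of "Suc 1"] that by auto
  have Yperp: "lorentz (Y y) (pd j Y y) = 0" if "y \<in> V" for y j
  proof -
    have "pd j (\<lambda>y. lorentz (Y y) (Y y)) y = 0" unfolding Ynull by simp
    then show ?thesis
      using pd_bilinear[OF bounded_bilinear_lorentz dY(1)[OF that] dY(1)[OF that], of j]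
        lorentz_commute[of "Y y" "pd j Y y"] by simp
  qed
  have chart_pd: "chart_pd c i f (chart_inv c y) = pd i (f \<circ> chart_inv c) y" if "y \<in> V"
    for y i and f :: "'p \<Rightarrow> 'b::real_normed_vector"
    using chart(8) that by (simp add: chart_pd_def V_def)
  have h: "induced_metric \<psi> c (chart_inv c y) = (l y)\<^sup>2 *\<^sub>R G y" if "y \<in> V" for y
    using conf c chart(7) that unfolding conformal_metrics_def l_def G_def V_def by simp
  have h': "lorentz (pd i Y y) (pd j Y y) = (l y)\<^sup>2 * G y $ i $ j" if "y \<in> V" for y i j
    using arg_cong[OF h[OF that], of "\<lambda>M. M $ i $ j"] chart_pd[OF that, of _ \<psi>]
    by (simp add: induced_metric_def Y_def)
  have hinv: "matrix_inv (induced_metric \<psi> c (chart_inv c y)) $ i $ j = matrix_inv (G y) $ i $ j / (l y)\<^sup>2"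
    if "y \<in> V" for y i j
    unfolding h[OF that] using pos_def_matrix_inv_scaleR[OF Gpos[OF that], of "(l y)\<^sup>2"] lpos[of y]
    by simp
  have "cone_chart V X G"
  proof
    show "open V" by fact
    show "Ck_on 3 V X" by fact
    show "lorentz (X y) (X y) = 0" for y
      unfolding X_def lorentz_linear Ynull by simp
    show "0 < fst (X y)" for y using Yfut[of y] lpos[of y] by (simp add: X_def)
    show "pos_def_matrix (G y)" if "y \<in> V" for y by (rule Gpos[OF that])
    show "CARD('k) = CARD('n) + 1" using dim by simp
    show "G y $ i $ j = lorentz (pd i X y) (pd j X y)" if "y \<in> V" for y i j
    proof -
      have "Ck_on 3 V (\<lambda>y. inverse (l y))"
        by (intro Ck_on_inverse V l3) (use lpos in \<open>auto simp: less_le\<close>)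
      then have di: "(\<lambda>y. inverse (l y)) differentiable (at y)"
        using Ck_on_differentiable that by fastforce
      have "pd i X y = inverse (l y) *\<^sub>R pd i Y y + pd i (\<lambda>y. inverse (l y)) y *\<^sub>R Y y" for i
        unfolding X_def by (rule pd_bilinear[OF bounded_bilinear_scaleR di dY(1)[OF that]])
      then have "lorentz (pd i X y) (pd j X y) = inverse (l y) * inverse (l y) * lorentz (pd i Y y) (pd j Y y)"
        by (simp add: lorentz_linear Ynull Yperp[OF that] lorentz_commute[of "pd _ Y y" "Y y"])
      then show ?thesis
        unfolding h'[OF that] using lpos[of y] by (simp add: field_simps power2_eq_square)
    qed
  qed
  then interpret cone_chart V X G .

  \<comment> \<open>\<open>E\<close> is the field \<open>\<eta>\<close> in coordinates, with the induced metric replaced by \<open>l\<^sup>2 G\<close>.\<close>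
  define U where "U y = fst (Y y)" for y
  define \<beta> where "\<beta> y = (1 + (\<Sum>i\<in>UNIV. \<Sum>j\<in>UNIV. Ginv y i j / (l y)\<^sup>2 * pd i U y * pd j U y)) / (2 * (U y)\<^sup>2)" for y
  define N where "N y = e1 - (\<Sum>j\<in>UNIV. (\<Sum>k\<in>UNIV. Ginv y j k / (l y)\<^sup>2 * lorentz e1 (pd k Y y)) *\<^sub>R pd j Y y)" for y
  define E where "E y = - \<beta> y *\<^sub>R Y y + (1 / U y) *\<^sub>R N y" for y
  have hU: "height \<psi> \<circ> chart_inv c = U"
    by (simp add: fun_eq_iff height_def lorentz_e1 U_def Y_def)
  have eta: "(null_eta \<psi> c \<circ> chart_inv c) y = E y" if "y \<in> V" for y
  proof -
    have hy: "height \<psi> (chart_inv c y) = U y" using hU by (metis comp_apply)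
    have yy: "\<psi> (chart_inv c y) = Y y" by (simp add: Y_def)
    have "grad_norm_sq (induced_metric \<psi>) c (height \<psi>) (chart_inv c y)
        = (\<Sum>i\<in>UNIV. \<Sum>j\<in>UNIV. Ginv y i j / (l y)\<^sup>2 * pd i U y * pd j U y)"
      unfolding grad_norm_sq_def hinv[OF that] chart_pd[OF that] hU ..
    moreover have "normal_part \<psi> c (chart_inv c y) e1 = N y"
      unfolding normal_part_def tangent_part_def tangent_coeff_def hinv[OF that] chart_pd[OF that]
        Y_def[symmetric] N_def ..
    ultimately show ?thesis
      by (simp add: null_eta_def hy yy E_def \<beta>_def)
  qed
  have Upos: "0 < U y" for y using Yfut by (simp add: U_def)
  have E1: "Ck_on 1 V E"
  proof -
    have U2: "Ck_on (Suc 1) V U" and lC: "Ck_on 1 V l" and YC: "Ck_on 1 V Y"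
      using Ck_on_linear[OF V bounded_linear_fst Y3] Ck_on_antimono[of 3 V _ 2]
        Ck_on_antimono[OF l3, of 1] Ck_on_antimono[OF Y3, of 1]
      unfolding U_def[abs_def] by (auto simp: numeral_2_eq_2)
    have G1: "Ck_on 1 V (\<lambda>y. G y $ i $ j)" for i j
      using metric c Ck_on_matrix_nth[OF V] 
      unfolding riemannian_metric_def smooth_on_def G_def V_def by blast
    have pY: "Ck_on 1 V (pd i Y)" for i
      by (rule Ck_on_pd, rule Ck_on_antimono[OF Y3]) simp
    have inv: "Ck_on 1 V (\<lambda>y. Ginv y i j * inverse (l y * l y))" for i j
      using lpos by (intro Ck_on_mult Ck_on_inverse Ck_on_matrix_inv V G1 Gpos lC) (auto simp: less_le)
    have b: "Ck_on 1 V (\<lambda>y. (1 + (\<Sum>i\<in>UNIV. \<Sum>j\<in>UNIV. Ginv y i j * inverse (l y * l y) * pd i U y * pd j U y))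
        * inverse (2 * (U y * U y)))"
      using Upos by (intro Ck_on_mult Ck_on_inverse Ck_on_add Ck_on_sum inv V Ck_on_pd[OF U2]
          Ck_on_SucD[OF U2] Ck_on_const) (auto simp: less_le)
    have n: "Ck_on 1 V (\<lambda>y. e1 - (\<Sum>j\<in>UNIV. (\<Sum>k\<in>UNIV. Ginv y j k * inverse (l y * l y) * lorentz e1 (pd k Y y)) *\<^sub>R pd j Y y))"
      by (intro Ck_on_diff Ck_on_scaleR Ck_on_mult Ck_on_sum inv pY V Ck_on_const
          Ck_on_bilinear[OF _ bounded_bilinear_lorentz])
    have "E = (\<lambda>y. - ((1 + (\<Sum>i\<in>UNIV. \<Sum>j\<in>UNIV. Ginv y i j * inverse (l y * l y) * pd i U y * pd j U y))
        * inverse (2 * (U y * U y))) *\<^sub>R Y y + inverse (U y) *\<^sub>R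
        (e1 - (\<Sum>j\<in>UNIV. (\<Sum>k\<in>UNIV. Ginv y j k * inverse (l y * l y) * lorentz e1 (pd k Y y)) *\<^sub>R pd j Y y)))"
      unfolding E_def[abs_def] \<beta>_def N_def divide_inverse power2_eq_square mult_1_left ..
    then show ?thesis
      using Upos by (simp only:) (intro Ck_on_add Ck_on_scaleR Ck_on_minus b n V YC Ck_on_inverse
        Ck_on_SucD[OF U2], auto simp: less_le)
  qed
  have dE: "E differentiable (at x)"
    using Ck_on_differentiable[OF E1] x by simp
  have NT: "lorentz (N y) (pd j Y y) = 0" if "y \<in> V" for y j
  proof -
    have "(\<Sum>m\<in>UNIV. (\<Sum>k\<in>UNIV. Ginv y m k / (l y)\<^sup>2 * lorentz e1 (pd k Y y)) * ((l y)\<^sup>2 * G y $ m $ j))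
        = (\<Sum>k\<in>UNIV. lorentz e1 (pd k Y y) * (\<Sum>m\<in>UNIV. G y $ j $ m * Ginv y m k))"
      unfolding sum_distrib_left sum_distrib_right using lpos[of y]
      by (subst sum.swap) (simp add: pos_def_matrix_sym[OF Gpos[OF that], of j] field_simps)
    also have "\<dots> = lorentz e1 (pd j Y y)"
      unfolding pos_def_matrix_inverse_sum[OF Gpos[OF that]] by (simp add: if_distrib cong: if_cong)
    finally show ?thesis
      unfolding N_def lorentz_linear by (simp add: h'[OF that])
  qed
  have ET: "lorentz (E y) (pd j Y y) = 0" if "y \<in> V" for y j
    unfolding E_def lorentz_linear by (simp add: NT[OF that] Yperp[OF that])
  have shape: "lorentz (pd i E x) (pd j Y x) = - lorentz (E x) (pd i (pd j Y) x)" for i j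
  proof -
    have "pd i (\<lambda>y. lorentz (E y) (pd j Y y)) x = pd i (\<lambda>y. 0) x"
      by (rule pd_cong[OF V x ET])
    then show ?thesis
      using pd_bilinear[OF bounded_bilinear_lorentz dE dY(2)[OF x], of i j] by simp
  qed
  have l2: "Ck_on 2 V l" using Ck_on_antimono[OF l3] by simp
  note ce = conformal_expansion[OF x l2 lpos[of x] YlX N_def[of x]]
  have pinv: "chart_inv c x = p" using chart(6)[OF p] by (simp add: x_def)
  have theta: "?n * theta_eta \<psi> c p = (\<Sum>i\<in>UNIV. \<Sum>j\<in>UNIV. Ginv x i j / (l x)\<^sup>2 * lorentz (pd i E x) (pd j Y x))"
  proof -
    have "chart_pd c i (null_eta \<psi> c) p = pd i E x" for i
      using chart_pd[OF x, of i "null_eta \<psi> c"] pd_cong[OF V x, of "null_eta \<psi> c \<circ> chart_inv c" E i] eta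
      by (simp add: pinv)
    moreover have "chart_pd c i \<psi> p = pd i Y x" for i
      using chart_pd[OF x, of i \<psi>] by (simp add: pinv Y_def)
    ultimately show ?thesis
      using hinv[OF x] by (simp add: theta_eta_def expansion_def trace_def shape_operator_def
          tangent_coeff_def pinv)
  qed
  have theta_xi: "theta_xi \<psi> c p = 1"
  proof -
    have "chart_pd c i \<psi> p = pd i Y x" for i
      using chart_pd[OF x, of i \<psi>] by (simp add: pinv Y_def)
    then have "?n * theta_xi \<psi> c p = (\<Sum>i\<in>UNIV. \<Sum>j\<in>UNIV. Ginv x i j / (l x)\<^sup>2 * lorentz (pd i Y x) (pd j Y x))"
      using hinv[OF x] by (simp add: theta_xi_def expansion_def trace_def shape_operator_def
          tangent_coeff_def pinv)
    also have "\<dots> = ?n"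
      using Ginv_trace[OF x] lpos[of x] by (simp add: h'[OF x])
    finally show ?thesis by simp
  qed
  have "0 \<le> theta_eta \<psi> c p"
    using trapped c p theta_xi unfolding weakly_trapped_def by force
  then have nonneg: "0 \<le> (\<Sum>i\<in>UNIV. \<Sum>j\<in>UNIV. Ginv x i j / (l x)\<^sup>2 * lorentz (pd i E x) (pd j Y x))"
    unfolding theta[symmetric] by simp
  define gvv where "gvv = cometric G x (\<lambda>i. pd i v x) (\<lambda>i. pd i v x)"
  define gvl where "gvl = cometric G x (\<lambda>i. pd i v x) (\<lambda>i. pd i l x)"
  define gll where "gll = cometric G x (\<lambda>i. pd i l x) (\<lambda>i. pd i l x)"
  have vpos: "0 < v x" using X_future[OF x] by (simp add: v_def)
  have Ux: "U x = l x * v x" using lpos[of x] by (simp add: U_def v_def YlX)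
  have \<beta>x: "\<beta> x = (1 + ((l x)\<^sup>2 * gvv + 2 * l x * v x * gvl + (v x)\<^sup>2 * gll) / (l x)\<^sup>2) / (2 * (l x * v x)\<^sup>2)"
  proof -
    have dU: "pd i U x = l x * pd i v x + v x * pd i l x" for i
      using ce(2)[of i] unfolding U_def[abs_def] v_def[abs_def] .
    have "(\<Sum>i\<in>UNIV. \<Sum>j\<in>UNIV. Ginv x i j / (l x)\<^sup>2 * pd i U x * pd j U x)
        = cometric G x (\<lambda>i. pd i U x) (\<lambda>i. pd i U x) / (l x)\<^sup>2"
      unfolding cometric_def sum_divide_distrib by simp
    also have "cometric G x (\<lambda>i. pd i U x) (\<lambda>i. pd i U x)
        = (l x)\<^sup>2 * gvv + 2 * l x * v x * gvl + (v x)\<^sup>2 * gll"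
      unfolding dU cometric_add_left cometric_add_right cometric_mult_left cometric_mult_right
        gvv_def gvl_def gll_def
      using cometric_sym[OF x, of "\<lambda>i. pd i l x" "\<lambda>i. pd i v x"]
      by (simp add: power2_eq_square algebra_simps)
    finally show ?thesis unfolding \<beta>_def Ux by simp
  qed
  have vfun: "(\<lambda>y. fst (X y)) = v" by (simp add: fun_eq_iff v_def)
  define Z where "Z = l x * laplace_coord G v x + ?n * gvl + (?n - 2) * v x / l x * gll
      + v x * laplace_coord G l x"
  have Z: "(\<Sum>i\<in>UNIV. \<Sum>j\<in>UNIV. Ginv x i j * lorentz (N x) (pd i (pd j Y) x)) = - Z"
    using ce(1) unfolding vfun v_def[symmetric] Z_def gvl_def gll_def .
  have "(\<Sum>i\<in>UNIV. \<Sum>j\<in>UNIV. Ginv x i j / (l x)\<^sup>2 * lorentz (pd i E x) (pd j Y x))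
      = - \<beta> x * (\<Sum>i\<in>UNIV. \<Sum>j\<in>UNIV. Ginv x i j * G x $ i $ j)
        - 1 / (U x * (l x)\<^sup>2) * (\<Sum>i\<in>UNIV. \<Sum>j\<in>UNIV. Ginv x i j * lorentz (N x) (pd i (pd j Y) x))"
    unfolding shape E_def lorentz_linear real_scaleR_def ce(3) sum_distrib_left sum_subtractf[symmetric]
    using lpos[of x] Upos[of x] by (intro sum.cong refl) (simp add: field_simps)
  then have "0 \<le> - ?n * \<beta> x + Z / (U x * (l x)\<^sup>2)"
    using nonneg unfolding Z Ginv_trace[OF x] by (simp add: mult.commute)
  then have nonneg': "0 \<le> - ?n * ((1 + ((l x)\<^sup>2 * gvv + 2 * l x * v x * gvl + (v x)\<^sup>2 * gll) / (l x)\<^sup>2) / (2 * (l x * v x)\<^sup>2))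
        + (l x * laplace_coord G v x + ?n * gvl + (?n - 2) * v x / l x * gll + v x * laplace_coord G l x) / (l x * v x * (l x)\<^sup>2)"
    unfolding \<beta>x Ux Z_def .
  have S: "scalar_curvature g c p = (1 - 1 / ?n) * lorentz (mc x) (mc x)"
    using scalar_curvature_mc[OF x] unfolding scalar_curvature_def G_def
    by (simp add: x_def[symmetric] pinv)
  have M: "lorentz (mc x) (mc x) = ?n\<^sup>2 * (1 + gvv) / (v x)\<^sup>2 - 2 * ?n * laplace_coord G v x / v x"
    using lorentz_mc_mc[OF x] unfolding vfun v_def[symmetric] gvv_def .
  have "scalar_curvature g c p / (2 * (?n - 1)) * l x \<le> laplace_coord G l x"
    by (rule expansion_comparison[OF _ _ lpos vpos _ M S nonneg'])
       (use dim cometric_nonneg[OF x] in \<open>simp_all add: gll_def\<close>)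
  moreover have "laplacian g c lam p = laplace_coord G l x"
    unfolding G_def l_def x_def by (rule laplacian_eq_laplace_coord[OF chart(6)[OF p]])
  moreover have "l x = lam p" by (simp add: l_def pinv)
  ultimately show ?thesis by simp
qed

section \<open>The parabolic minimum principle\<close>

text \<open>The regularity that the second derivative test at a minimum requires.\<close>

definition twice_differentiable :: "(real ^ 'n::finite \<Rightarrow> real) \<Rightarrow> real ^ 'n \<Rightarrow> bool" where
  "twice_differentiable F x \<longleftrightarrow> (\<exists>U. open U \<and> x \<in> U \<and> (\<forall>a\<in>U. F differentiable (at a))) \<and>
     (\<forall>j. pd j F differentiable (at x))"

lemma twice_differentiableI_Ck:
  assumes "open S" "x \<in> S" "Ck_on 2 S F"
  shows "twice_differentiable F x"
proof -
  have "Ck_on (Suc (Suc 0)) S F" using assms(3) by (simp add: numeral_2_eq_2)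
  then show ?thesis
    using assms(1,2) Ck_on_pd[of "Suc 0" S F] Ck_on_differentiable[of "Suc 0" S "pd _ F" x]
    unfolding twice_differentiable_def by auto
qed

lemma pd_pd_cong:
  assumes "open S" "x \<in> S" "\<And>y. y \<in> S \<Longrightarrow> F y = H y"
  shows "pd i (pd j F) x = pd i (pd j H) x"
  by (rule pd_cong[OF assms(1,2)], rule pd_cong[OF assms(1)], assumption, rule assms(3))

lemma twice_differentiable_cong:
  assumes "open S" "x \<in> S" "\<And>y. y \<in> S \<Longrightarrow> F y = H y" "twice_differentiable F x"
  shows "twice_differentiable H x"
proof -
  obtain U where U: "open U" "x \<in> U" "\<And>a. a \<in> U \<Longrightarrow> F differentiable (at a)"
    using assms(4) unfolding twice_differentiable_def by blast
  have "H differentiable (at a)" if "a \<in> U \<inter> S" for a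
    using differentiable_cong_open[OF assms(1) _ assms(3), of a "\<lambda>y. y"] U(3)[of a] that by simp
  moreover have "pd j H differentiable (at x)" for j
  proof -
    have "pd j F y = pd j H y" if "y \<in> S" for y
      by (rule pd_cong[OF assms(1) that assms(3)])
    then show ?thesis
      using differentiable_cong_open[OF assms(1,2), of "pd j F" "pd j H"] assms(4)
      unfolding twice_differentiable_def by blast
  qed
  ultimately show ?thesis
    unfolding twice_differentiable_def
    using U(1,2) assms(1,2) by (intro conjI allI exI[of _ "U \<inter> S"]) auto
qed

lemma laplace_coord_cong:
  assumes "open S" "x \<in> S" "\<And>y. y \<in> S \<Longrightarrow> F y = H y"
  shows "laplace_coord G F x = laplace_coord G H x"
proof -
  have "pd i (pd j F) x = pd i (pd j H) x" and "pd k F x = pd k H x" for i j k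
    by (rule pd_pd_cong[OF assms], assumption) (rule pd_cong[OF assms])
  then show ?thesis unfolding laplace_coord_def by simp
qed

lemma twice_differentiable_affine:
  assumes F: "twice_differentiable F x" and H: "twice_differentiable H x"
  shows "twice_differentiable (\<lambda>a. k + r * F a + s * H a) x" (is ?A)
    and "laplace_coord G (\<lambda>a. k + r * F a + s * H a) x
      = r * laplace_coord G F x + s * laplace_coord G H x" (is ?B)
proof -
  obtain U where U: "open U" "x \<in> U" "\<And>a. a \<in> U \<Longrightarrow> F differentiable (at a)"
    using F unfolding twice_differentiable_def by blast
  obtain W where W: "open W" "x \<in> W" "\<And>a. a \<in> W \<Longrightarrow> H differentiable (at a)"
    using H unfolding twice_differentiable_def by blast
  have p1: "((\<lambda>a. k + r * F a + s * H a) has_derivative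
      (\<lambda>h. 0 + r * frechet_derivative F (at a) h + s * frechet_derivative H (at a) h)) (at a)"
    if "a \<in> U \<inter> W" for a
    using U(3) W(3) that
    by (intro has_derivative_add has_derivative_const has_derivative_mult_right)
       (auto simp: frechet_derivative_works)
  have pd1: "pd j (\<lambda>a. k + r * F a + s * H a) a = r * pd j F a + s * pd j H a"
    if "a \<in> U \<inter> W" for a j
    using pd_eqI[OF p1[OF that], of j] by (simp add: pd_def)
  have S: "open (U \<inter> W)" "x \<in> U \<inter> W" using U W by auto
  have p2: "((\<lambda>a. r * pd j F a + s * pd j H a) has_derivative
      (\<lambda>h. r * frechet_derivative (pd j F) (at x) h + s * frechet_derivative (pd j H) (at x) h)) (at x)" for j
    using F H unfolding twice_differentiable_def
    by (intro has_derivative_add has_derivative_mult_right) (auto simp: frechet_derivative_works)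
  have pd2: "pd i (pd j (\<lambda>a. k + r * F a + s * H a)) x = r * pd i (pd j F) x + s * pd i (pd j H) x" for i j
  proof -
    have "pd i (pd j (\<lambda>a. k + r * F a + s * H a)) x = pd i (\<lambda>a. r * pd j F a + s * pd j H a) x"
      by (rule pd_cong[OF S], rule pd1)
    then show ?thesis using pd_eqI[OF p2, of i j] by (simp add: pd_def[of i])
  qed
  have "pd j (\<lambda>a. k + r * F a + s * H a) differentiable (at x)" for j
  proof -
    have "pd j (\<lambda>a. k + r * F a + s * H a) differentiable (at x)
        \<longleftrightarrow> (\<lambda>a. r * pd j F a + s * pd j H a) differentiable (at x)"
      by (rule differentiable_cong_open[OF S], rule pd1)
    then show ?thesis using p2[of j] by (auto simp: differentiable_def)
  qed
  then show ?A
    unfolding twice_differentiable_def using S p1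
    by (intro conjI allI exI[of _ "U \<inter> W"]) (auto simp: differentiable_def)
  show ?B
    unfolding laplace_coord_def pd2 pd1[OF S(2)] sum_distrib_left sum.distrib[symmetric]
    by (intro sum.cong refl)
       (simp add: sum.distrib sum_distrib_left[symmetric] algebra_simps)
qed

lemma second_derivative_nonneg_at_min:
  fixes f f' :: "real \<Rightarrow> real"
  assumes "0 < d" and f: "\<And>s. \<bar>s\<bar> < d \<Longrightarrow> (f has_real_derivative f' s) (at s)"
    and f': "(f' has_real_derivative b) (at 0)"
    and min: "\<And>s. \<bar>s\<bar> < d \<Longrightarrow> f 0 \<le> f s"
  shows "f' 0 = 0" "0 \<le> b"
proof -
  show 0: "f' 0 = 0"
    using DERIV_local_min[OF f[of 0] assms(1)] assms(1) min by simp
  show "0 \<le> b"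
  proof (rule ccontr)
    assume "\<not> 0 \<le> b"
    then obtain e where e: "0 < e" "\<And>h. 0 < h \<Longrightarrow> h < e \<Longrightarrow> f' h < 0"
      using DERIV_neg_dec_right[OF f'] 0 by auto
    define h where "h = min e d / 2"
    have h: "0 < h" "h < e" "h < d" using e(1) assms(1) by (auto simp: h_def min_def)
    obtain z where z: "0 < z" "z < h" "f h - f 0 = (h - 0) * f' z"
      using MVT2[of 0 h f f'] f h by force
    have "h * f' z < 0" using e(2)[of z] z h by (intro mult_pos_neg) auto
    then show False using z min[of h] h by simp
  qed
qed

text \<open>At a minimum the first order terms vanish and the Hessian is positive semidefinite; the Laplacian
  is its pairing with the inverse metric.\<close>

lemma laplace_coord_nonneg_at_min:
  fixes F :: "real ^ 'n::finite \<Rightarrow> real"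
  assumes F: "twice_differentiable F x" and G: "pos_def_matrix (G x)"
    and min: "open W" "x \<in> W" "\<And>y. y \<in> W \<Longrightarrow> F x \<le> F y"
  shows "0 \<le> laplace_coord G F x"
proof -
  obtain U where U: "open U" "x \<in> U" "\<And>a. a \<in> U \<Longrightarrow> F differentiable (at a)"
    using F unfolding twice_differentiable_def by blast
  have F2: "pd j F differentiable (at x)" for j
    using F unfolding twice_differentiable_def by blast
  have along: "(\<Sum>j\<in>UNIV. v $ j * pd j F x) = 0 \<and> 0 \<le> (\<Sum>i\<in>UNIV. \<Sum>j\<in>UNIV. v $ i * v $ j * pd i (pd j F) x)"
    for v :: "real ^ 'n"
  proof -
    obtain e where e: "0 < e" "ball x e \<subseteq> U \<inter> W"
      using U min(1,2) by (metis IntI open_Int openE)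
    define d where "d = e / (norm v + 1)"
    have d: "0 < d" using e(1) by (simp add: d_def add_nonneg_pos)
    have line: "x + s *\<^sub>R v \<in> U \<inter> W" if "\<bar>s\<bar> < d" for s
    proof -
      have "\<bar>s\<bar> * norm v \<le> \<bar>s\<bar> * (norm v + 1)" by (simp add: mult_left_mono)
      also have "\<dots> < e" using that by (simp add: d_def pos_less_divide_eq add_nonneg_pos)
      finally have "x + s *\<^sub>R v \<in> ball x e" by (simp add: dist_norm)
      then show ?thesis using e(2) by blast
    qed
    have D1: "((\<lambda>s. F (x + s *\<^sub>R v)) has_real_derivative (\<Sum>j\<in>UNIV. v $ j * pd j F (x + s *\<^sub>R v))) (at s)"
      if "\<bar>s\<bar> < d" for s
      using has_real_derivative_along_line[of F x s v] U(3) line[OF that]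
      by (simp add: frechet_derivative_eq_sum_pd)
    have D2: "((\<lambda>s. \<Sum>j\<in>UNIV. v $ j * pd j F (x + s *\<^sub>R v)) has_real_derivative
        (\<Sum>j\<in>UNIV. v $ j * (\<Sum>i\<in>UNIV. v $ i * pd i (pd j F) x))) (at 0)"
    proof (intro DERIV_sum DERIV_cmult)
      fix j
      show "((\<lambda>s. pd j F (x + s *\<^sub>R v)) has_real_derivative (\<Sum>i\<in>UNIV. v $ i * pd i (pd j F) x)) (at 0)"
        using has_real_derivative_along_line[of "pd j F" x 0 v] F2[of j]
        by (simp add: frechet_derivative_eq_sum_pd)
    qed
    have "(\<Sum>j\<in>UNIV. v $ j * (\<Sum>i\<in>UNIV. v $ i * pd i (pd j F) x))
        = (\<Sum>i\<in>UNIV. \<Sum>j\<in>UNIV. v $ i * v $ j * pd i (pd j F) x)"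
      unfolding sum_distrib_left by (subst sum.swap) (simp add: mult_ac)
    then show ?thesis
      using second_derivative_nonneg_at_min[OF d D1 D2] line min(3) by simp
  qed
  have grad: "pd k F x = 0" for k
    using along[of "axis k 1"] by (simp add: axis_def if_distrib[of "\<lambda>c. c * _"] cong: if_cong)
  have "0 \<le> (\<Sum>i\<in>UNIV. \<Sum>j\<in>UNIV. matrix_inv (G x) $ i $ j * pd i (pd j F) x)"
  proof (rule psd_pairing_nonneg)
    show "matrix_inv (G x) $ i $ j = matrix_inv (G x) $ j $ i" for i j
      by (rule pos_def_matrix_sym[OF pos_def_matrix_inv[OF G]])
    show "0 \<le> (\<Sum>i\<in>UNIV. \<Sum>j\<in>UNIV. v i * v j * matrix_inv (G x) $ i $ j)" for v
      by (rule pos_def_matrix_nonneg[OF pos_def_matrix_inv[OF G]])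
    show "0 \<le> (\<Sum>i\<in>UNIV. \<Sum>j\<in>UNIV. v i * v j * pd i (pd j F) x)" for v
      using along[of "\<chi> i. v i"] by simp
  qed
  then show ?thesis unfolding laplace_coord_def grad by simp
qed

text \<open>At a negative minimum over \<open>K\<close> the time derivative, taken from the left, would be at most zero and the
  Laplacian at least zero. The set \<open>K\<close> only has to contain the recent past and a
  spatial neighbourhood of the points where the function is negative, so that the principle also
  applies to barriers whose support grows with time.\<close>

lemma parabolic_minimum_principle:
  fixes A :: "('p::{t2_space, second_countable_topology}, 'n::finite) chart set"
    and u :: "'p \<Rightarrow> real \<Rightarrow> real"
  assumes atlas: "smooth_atlas A" and metric: "riemannian_metric A g"
    and K: "compact K" and cont: "continuous_on K (\<lambda>(x, t). u x t)"
    and step: "\<And>x t. (x, t) \<in> K \<Longrightarrow> u x t < 0 \<Longrightarrow>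
      \<exists>c\<in>A. x \<in> fst c \<and> (\<exists>r>0. \<forall>s\<in>{t - r<..t}. (x, s) \<in> K) \<and>
        (\<exists>W. open W \<and> x \<in> W \<and> (\<forall>y\<in>W. (y, t) \<in> K)) \<and>
        twice_differentiable ((\<lambda>y. u y t) \<circ> chart_inv c) (snd c x) \<and>
        (\<exists>D>laplacian g c (\<lambda>y. u y t) x. ((\<lambda>s. u x s) has_real_derivative D) (at t))"
    and xt: "(x, t) \<in> K"
  shows "0 \<le> u x t"
proof (rule ccontr)
  assume neg: "\<not> 0 \<le> u x t"
  obtain z where z: "z \<in> K" "\<And>w. w \<in> K \<Longrightarrow> (\<lambda>(x, t). u x t) z \<le> (\<lambda>(x, t). u x t) w"
    using continuous_attains_inf[OF K _ cont] xt by blast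
  obtain y s where ys: "z = (y, s)" by (cases z)
  have min: "u y s \<le> u y' s'" if "(y', s') \<in> K" for y' s'
    using z(2)[OF that] ys by simp
  have "u y s < 0" using min[OF xt] neg by simp
  then obtain c r W D where c: "c \<in> A" "y \<in> fst c"
    and r: "0 < r" "\<And>s'. s' \<in> {s - r<..s} \<Longrightarrow> (y, s') \<in> K"
    and W: "open W" "y \<in> W" "\<And>y'. y' \<in> W \<Longrightarrow> (y', s) \<in> K"
    and tw: "twice_differentiable ((\<lambda>y. u y s) \<circ> chart_inv c) (snd c y)"
    and D: "laplacian g c (\<lambda>y. u y s) y < D" "((\<lambda>s. u y s) has_real_derivative D) (at s)"
    using step[of y s] z(1) ys by blast
  note chart = smooth_atlas_chart[OF atlas c(1)]
  have "D \<le> 0"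
  proof (rule ccontr)
    assume "\<not> D \<le> 0"
    then obtain d where d: "0 < d" "\<And>h. 0 < h \<Longrightarrow> h < d \<Longrightarrow> u y (s - h) < u y s"
      using DERIV_pos_inc_left[OF D(2)] by auto
    define h where "h = min d r / 2"
    have h: "0 < h" "h < d" "h < r" using d(1) r(1) by (auto simp: h_def min_def)
    have "(y, s - h) \<in> K" using h by (intro r(2)) auto
    then show False using min[of y "s - h"] d(2)[OF h(1,2)] by simp
  qed
  moreover have "0 \<le> laplacian g c (\<lambda>y. u y s) y"
    unfolding laplacian_eq_laplace_coord[where g = g, OF chart(6)[OF c(2)]]
  proof (rule laplace_coord_nonneg_at_min[OF tw])
    have "pos_def_matrix (g c y)"
      using metric c unfolding riemannian_metric_def by blast
    then show "pos_def_matrix ((g c \<circ> chart_inv c) (snd c y))"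
      using chart(6)[OF c(2)] by simp
    show "open (chart_range c \<inter> chart_inv c -` W)"
      using continuous_open_preimage[OF chart(4,2) W(1)] .
    show "snd c y \<in> chart_range c \<inter> chart_inv c -` W"
      using chart(5,6)[OF c(2)] W(2) by simp
    show "((\<lambda>y. u y s) \<circ> chart_inv c) (snd c y) \<le> ((\<lambda>y. u y s) \<circ> chart_inv c) a"
      if "a \<in> chart_range c \<inter> chart_inv c -` W" for a
      using that min[OF W(3)] chart(6)[OF c(2)] by simp
  qed
  ultimately show False using D(1) by simp
qed

lemma laplacian_affine:
  assumes "chart_inv c (snd c p) = p"
    and "twice_differentiable (f \<circ> chart_inv c) (snd c p)"
    and "twice_differentiable (h \<circ> chart_inv c) (snd c p)"
  shows "twice_differentiable ((\<lambda>y. k + r * f y + s * h y) \<circ> chart_inv c) (snd c p)"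
    and "laplacian g c (\<lambda>y. k + r * f y + s * h y) p = r * laplacian g c f p + s * laplacian g c h p"
proof -
  have *: "(\<lambda>y. k + r * f y + s * h y) \<circ> chart_inv c
      = (\<lambda>a. k + r * (f \<circ> chart_inv c) a + s * (h \<circ> chart_inv c) a)"
    by (simp add: fun_eq_iff)
  show "twice_differentiable ((\<lambda>y. k + r * f y + s * h y) \<circ> chart_inv c) (snd c p)"
    unfolding * by (rule twice_differentiable_affine(1)[OF assms(2,3)])
  show "laplacian g c (\<lambda>y. k + r * f y + s * h y) p = r * laplacian g c f p + s * laplacian g c h p"
    unfolding laplacian_eq_laplace_coord[where g = g, OF assms(1)] *
    by (rule twice_differentiable_affine(2)[OF assms(2,3)])
qed

definition heat_at ::
  "('p, 'n::finite) chart set \<Rightarrow> ('p, 'n) metric_coeffs \<Rightarrow> ('p \<Rightarrow> real \<Rightarrow> real) \<Rightarrow> 'p \<Rightarrow> real \<Rightarrow> bool"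
  where
  "heat_at A g u x t \<longleftrightarrow> (\<forall>c\<in>A. x \<in> fst c \<longrightarrow>
     twice_differentiable ((\<lambda>y. u y t) \<circ> chart_inv c) (snd c x) \<and>
     ((\<lambda>s. u x s) has_real_derivative laplacian g c (\<lambda>y. u y t) x) (at t))"

lemma smooth_map_continuous:
  assumes "smooth_atlas A" "smooth_map A f"
  shows "continuous_on UNIV f"
proof -
  have "\<exists>N. open N \<and> y \<in> N \<and> continuous_on N f" for y
  proof -
    obtain c where c: "c \<in> A" "y \<in> fst c" using assms(1) unfolding smooth_atlas_def by blast
    note chart = smooth_atlas_chart[OF assms(1) c(1)]
    have "Ck_on 0 (chart_range c) (f \<circ> chart_inv c)"
      using assms(2) c unfolding smooth_map_def smooth_on_def by blast
    then have "continuous_on (chart_range c) (f \<circ> chart_inv c)" by simp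
    then have "continuous_on (fst c) (\<lambda>p. (f \<circ> chart_inv c) (snd c p))"
      by (rule continuous_on_compose2[OF _ chart(3)]) (use chart(5) in auto)
    then have "continuous_on (fst c) f"
      using chart(6) by (simp cong: continuous_on_cong)
    then show ?thesis using chart(1) c(2) by blast
  qed
  then show ?thesis
    by (metis UNIV_I continuous_at_imp_continuous_on continuous_on_eq_continuous_at)
qed

text \<open>If \<open>\<Delta> f \<ge> \<kappa> f\<close>, then \<open>exp (\<kappa> t) f\<close> is a subsolution of the heat equation. It is compared
  with an affine function of a solution \<open>D\<close> which equals \<open>1\<close> on the boundary of \<open>\<Omega>\<close> and is
  asymptotically nonnegative at time \<open>0\<close>.\<close>

lemma subsolution_comparison:
  fixes A :: "('p::{t2_space, second_countable_topology}, 'n::finite) chart set"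
    and D :: "'p \<Rightarrow> real \<Rightarrow> real"
  assumes atlas: "smooth_atlas A" and metric: "riemannian_metric A g"
    and \<Omega>: "open \<Omega>" "compact (closure \<Omega>)"
    and D_cont: "continuous_on (UNIV \<times> {0<..}) (\<lambda>(x, t). D x t)"
    and D_out: "\<And>x t. x \<notin> \<Omega> \<Longrightarrow> 0 < t \<Longrightarrow> D x t = 1"
    and D_heat: "\<And>x t. x \<in> \<Omega> \<Longrightarrow> 0 < t \<Longrightarrow> heat_at A g D x t"
    and D_init: "\<And>e. 0 < e \<Longrightarrow> \<exists>\<tau>>0. \<forall>t. 0 < t \<and> t < \<tau> \<longrightarrow> (\<forall>x\<in>\<Omega>. - e \<le> D x t)"
    and f: "smooth_map A f" "\<And>x. 0 \<le> f x" "\<And>x. f x \<le> F"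
    and f_sub: "\<And>c x. c \<in> A \<Longrightarrow> x \<in> fst c \<Longrightarrow> \<kappa> * f x \<le> laplacian g c f x"
    and coeffs: "0 \<le> \<alpha>" "0 \<le> \<beta>" "0 \<le> \<gamma>" "0 < \<kappa>" "\<gamma> * F \<le> \<alpha>" "\<gamma> * exp (\<kappa> * T) * F \<le> \<alpha> + \<beta>"
    and t: "0 < t" "t \<le> T"
  shows "\<gamma> * exp (\<kappa> * t) * f x \<le> \<alpha> + \<beta> * D x t"
proof (rule ccontr)
  define P where "P x t = \<alpha> + \<beta> * D x t - \<gamma> * exp (\<kappa> * t) * f x" for x t
  have F0: "0 \<le> F" using f(2)[of x] f(3)[of x] by linarith
  assume "\<not> \<gamma> * exp (\<kappa> * t) * f x \<le> \<alpha> + \<beta> * D x t"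
  then have neg: "P x t < 0" by (simp add: P_def)
  have P_out: "0 \<le> P y s" if "y \<notin> \<Omega>" "0 < s" "s \<le> T" for y s
  proof -
    have "\<gamma> * exp (\<kappa> * s) * f y \<le> \<gamma> * exp (\<kappa> * T) * F"
      using coeffs that f by (intro mult_mono) auto
    then show ?thesis using coeffs(6) D_out[OF that(1,2)] by (simp add: P_def)
  qed
  \<comment> \<open>Adding \<open>e s\<close> makes the differential inequality strict and leaves the value at \<open>(x, t)\<close>
    negative. Adding \<open>d / 2\<close> pays for the initial values, which are only nonnegative in the limit.\<close>
  define e where "e = - P x t / (2 * t)"
  define d where "d = - (P x t + e * t)"
  have e: "0 < e" and d: "0 < d"
    using neg t by (auto simp: e_def d_def field_simps)
  obtain \<tau> where \<tau>: "0 < \<tau>" "\<And>y s. y \<in> \<Omega> \<Longrightarrow> 0 < s \<Longrightarrow> s < \<tau> \<Longrightarrow> - (d / 2) \<le> P y s"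
  proof -
    have "((\<lambda>s. \<gamma> * exp (\<kappa> * s) * F) \<longlongrightarrow> \<gamma> * exp (\<kappa> * 0) * F) (at_right 0)"
      by (intro tendsto_intros)
    then have "\<forall>\<^sub>F s in at_right 0. \<gamma> * exp (\<kappa> * s) * F < \<gamma> * F + d / 4"
      using d by (intro order_tendstoD) auto
    then obtain b where b: "0 < b" "\<And>s. 0 < s \<Longrightarrow> s < b \<Longrightarrow> \<gamma> * exp (\<kappa> * s) * F < \<gamma> * F + d / 4"
      unfolding eventually_at_right_field by auto
    obtain \<tau>1 where \<tau>1: "0 < \<tau>1" "\<And>y s. 0 < s \<Longrightarrow> s < \<tau>1 \<Longrightarrow> y \<in> \<Omega> \<Longrightarrow> - (d / (4 * (\<beta> + 1))) \<le> D y s"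
      using D_init[of "d / (4 * (\<beta> + 1))"] d coeffs(2) by auto
    have "- (d / 2) \<le> P y s" if "y \<in> \<Omega>" "0 < s" "s < min b \<tau>1" for y s
    proof -
      have "\<beta> * - (d / (4 * (\<beta> + 1))) \<le> \<beta> * D y s"
        using \<tau>1(2)[of s y] that coeffs(2) by (intro mult_left_mono) auto
      moreover have "\<beta> * (d / (4 * (\<beta> + 1))) \<le> d / 4"
        using coeffs(2) d by (simp add: field_simps)
      moreover have "\<gamma> * exp (\<kappa> * s) * f y \<le> \<gamma> * exp (\<kappa> * s) * F"
        using coeffs f by (intro mult_left_mono) auto
      ultimately show ?thesis
        using b(2)[of s] that coeffs(5) unfolding P_def by simp
    qed
    then show ?thesis using that[of "min b \<tau>1"] b(1) \<tau>1(1) by auto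
  qed
  define u where "u y s = (\<alpha> + d / 2 + e * s) + \<beta> * D y s + (- \<gamma> * exp (\<kappa> * s)) * f y" for y s
  have uP: "u y s = P y s + e * s + d / 2" for y s by (simp add: u_def P_def)
  define K where "K = closure \<Omega> \<times> {min \<tau> t / 2..t}"
  have "0 \<le> u x t"
  proof (rule parabolic_minimum_principle[OF atlas metric, where u = u and K = K])
    show "compact K" unfolding K_def by (intro compact_Times \<Omega> compact_Icc)
    have sub: "K \<subseteq> UNIV \<times> {0<..}" using \<tau>(1) t by (auto simp: K_def)
    from smooth_map_continuous[OF atlas f(1)]
    have cf: "continuous_on K (\<lambda>z. f (fst z))"
      by (rule continuous_on_compose2[OF _ continuous_on_fst[OF continuous_on_id]]) auto
    have cD: "continuous_on K (\<lambda>z. D (fst z) (snd z))"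
      using continuous_on_subset[OF D_cont sub] by (simp add: case_prod_unfold)
    have "continuous_on K (\<lambda>z. u (fst z) (snd z))"
      unfolding u_def by (intro continuous_intros cf cD)
    then show "continuous_on K (\<lambda>(x, t). u x t)"
      by (simp add: case_prod_unfold)
    show "(x, t) \<in> K"
    proof -
      have "x \<in> \<Omega>" using P_out[of x t] neg t by force
      then show ?thesis using closure_subset t by (auto simp: K_def)
    qed
    fix y s
    assume ys: "(y, s) \<in> K" and us: "u y s < 0"
    have s: "0 < s" "s \<le> T" using subsetD[OF sub ys] ys t by (auto simp: K_def)
    have P: "P y s < - (d / 2)" using us e s d unfolding uP by (smt (verit) mult_pos_pos)
    have y: "y \<in> \<Omega>" using P_out[of y s] P d s by force
    have st: "\<tau> \<le> s" using \<tau>(2)[OF y s(1)] P by force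
    obtain c where c: "c \<in> A" "y \<in> fst c" using atlas unfolding smooth_atlas_def by blast
    note chart = smooth_atlas_chart[OF atlas c(1)]
    have h: "twice_differentiable ((\<lambda>y. D y s) \<circ> chart_inv c) (snd c y)"
      "((\<lambda>s. D y s) has_real_derivative laplacian g c (\<lambda>y. D y s) y) (at s)"
      using D_heat[OF y s(1)] c unfolding heat_at_def by blast+
    have "Ck_on 2 (chart_range c) (f \<circ> chart_inv c)"
      using f(1) c unfolding smooth_map_def smooth_on_def by blast
    then have ftw: "twice_differentiable (f \<circ> chart_inv c) (snd c y)"
      by (rule twice_differentiableI_Ck[OF chart(2) chart(5)[OF c(2)]])
    show "\<exists>c\<in>A. y \<in> fst c \<and> (\<exists>r>0. \<forall>s'\<in>{s - r<..s}. (y, s') \<in> K) \<and>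
        (\<exists>W. open W \<and> y \<in> W \<and> (\<forall>y\<in>W. (y, s) \<in> K)) \<and>
        twice_differentiable ((\<lambda>y. u y s) \<circ> chart_inv c) (snd c y) \<and>
        (\<exists>D>laplacian g c (\<lambda>y. u y s) y. ((\<lambda>s. u y s) has_real_derivative D) (at s))"
    proof (intro bexI[of _ c] conjI)
      show "\<exists>r>0. \<forall>s'\<in>{s - r<..s}. (y, s') \<in> K"
        using ys st \<tau>(1) by (intro exI[of _ "\<tau> / 2"]) (auto simp: K_def min_def)
      show "\<exists>W. open W \<and> y \<in> W \<and> (\<forall>y\<in>W. (y, s) \<in> K)"
        using \<Omega>(1) y ys closure_subset by (intro exI[of _ \<Omega>]) (auto simp: K_def)
      show "twice_differentiable ((\<lambda>y. u y s) \<circ> chart_inv c) (snd c y)"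
        unfolding u_def by (rule laplacian_affine(1)[OF chart(6)[OF c(2)] h(1) ftw])
      show "\<exists>D>laplacian g c (\<lambda>y. u y s) y. ((\<lambda>s. u y s) has_real_derivative D) (at s)"
      proof (intro exI conjI)
        show "((\<lambda>s. u y s) has_real_derivative
          (e + \<beta> * laplacian g c (\<lambda>y. D y s) y + (- \<gamma> * (exp (\<kappa> * s) * \<kappa>)) * f y)) (at s)"
          unfolding u_def by (auto intro!: derivative_eq_intros h(2))
        have "\<gamma> * exp (\<kappa> * s) * (\<kappa> * f y) \<le> \<gamma> * exp (\<kappa> * s) * laplacian g c f y"
          using f_sub[OF c] coeffs by (intro mult_left_mono) auto
        then show "laplacian g c (\<lambda>y. u y s) y
            < e + \<beta> * laplacian g c (\<lambda>y. D y s) y + (- \<gamma> * (exp (\<kappa> * s) * \<kappa>)) * f y"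
          unfolding u_def laplacian_affine(2)[OF chart(6)[OF c(2)] h(1) ftw]
          using e by (simp add: mult_ac)
      qed
    qed (use c in auto)
  qed
  moreover have "u x t = - d / 2" unfolding uP by (simp add: d_def field_simps)
  ultimately show False using d by simp
qed

section \<open>Propagation of positivity\<close>

lemma squared_distance_barrier:
  fixes y0 :: "real ^ 'n::finite" and S :: real
  defines "B \<equiv> \<lambda>a. (S - (a - y0) \<bullet> (a - y0))\<^sup>2"
  shows "twice_differentiable B x"
    and "laplace_coord G B x = 8 * (\<Sum>i\<in>UNIV. \<Sum>j\<in>UNIV. matrix_inv (G x) $ i $ j * ((x - y0) $ i * (x - y0) $ j))
      + (S - (x - y0) \<bullet> (x - y0)) * (\<Sum>i\<in>UNIV. \<Sum>j\<in>UNIV. matrix_inv (G x) $ i $ j *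
          ((\<Sum>k\<in>UNIV. 4 * christoffel G k i j x * (x - y0) $ k) - (if i = j then 4 else 0)))" (is ?lap)
proof -
  have B1: "(B has_derivative (\<lambda>h. - 4 * (S - (a - y0) \<bullet> (a - y0)) * ((a - y0) \<bullet> h))) (at a)" for a
    unfolding B_def
    by (auto intro!: derivative_eq_intros simp: inner_commute algebra_simps power2_eq_square)
  have pB: "pd j B = (\<lambda>a. - 4 * (S - (a - y0) \<bullet> (a - y0)) * (a - y0) $ j)" for j
    by (rule ext) (simp add: pd_eqI[OF B1] inner_axis)
  have B2: "((\<lambda>a. - 4 * (S - (a - y0) \<bullet> (a - y0)) * (a - y0) $ j) has_derivative
      (\<lambda>h. 8 * ((a - y0) \<bullet> h) * (a - y0) $ j - 4 * (S - (a - y0) \<bullet> (a - y0)) * h $ j)) (at a)" for a j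
    by (auto intro!: derivative_eq_intros bounded_linear.has_derivative[OF bounded_linear_vec_nth]
        simp: inner_commute algebra_simps)
  have ppB: "pd i (pd j B) x = 8 * (x - y0) $ i * (x - y0) $ j
      - 4 * (S - (x - y0) \<bullet> (x - y0)) * (if i = j then 1 else 0)" for i j
    unfolding pB pd_eqI[OF B2] inner_axis by (simp add: axis_def)
  show "twice_differentiable B x"
    unfolding twice_differentiable_def pB using B1 B2
    by (auto simp: differentiable_def intro!: exI[of _ UNIV])
  define z where "z = x - y0"
  define \<rho> where "\<rho> = S - z \<bullet> z"
  have drift: "(\<Sum>k\<in>UNIV. christoffel G k i j x * (- 4 * \<rho> * z $ k))
      = - \<rho> * (\<Sum>k\<in>UNIV. 4 * christoffel G k i j x * z $ k)" for i j
    by (simp add: sum_distrib_left sum_negf mult_ac)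
  show ?lap
    unfolding laplace_coord_def ppB
    unfolding pB z_def[symmetric] \<rho>_def[symmetric] drift
    unfolding sum_distrib_left[of 8] sum_distrib_left[of \<rho>] sum.distrib[symmetric]
    by (intro sum.cong refl) (simp add: algebra_simps)
qed

lemma uniform_ellipticity:
  fixes G :: "real ^ 'n::finite \<Rightarrow> real ^ 'n ^ 'n"
  assumes C: "compact C" and pos: "\<And>a. a \<in> C \<Longrightarrow> pos_def_matrix (G a)"
    and cont: "\<And>i j. continuous_on C (\<lambda>a. matrix_inv (G a) $ i $ j)"
  obtains m where "0 < m" "\<And>a z. a \<in> C \<Longrightarrow>
    m * (z \<bullet> z) \<le> (\<Sum>i\<in>UNIV. \<Sum>j\<in>UNIV. matrix_inv (G a) $ i $ j * (z $ i * z $ j))"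
proof (cases "C = {}")
  case True
  then show ?thesis using that[of 1] by simp
next
  case False
  define Q where "Q a z = (\<Sum>i\<in>UNIV. \<Sum>j\<in>UNIV. matrix_inv (G a) $ i $ j * (z $ i * z $ j))"
    for a and z :: "real ^ 'n"
  have "axis undefined 1 \<in> sphere (0 :: real ^ 'n) 1" by simp
  then have ne: "C \<times> sphere (0 :: real ^ 'n) 1 \<noteq> {}" using False by blast
  have cG: "continuous_on (C \<times> sphere 0 1) (\<lambda>w. matrix_inv (G (fst w)) $ i $ j)" for i j
    by (rule continuous_on_compose2[OF cont continuous_on_fst[OF continuous_on_id]]) auto
  have "continuous_on (C \<times> sphere 0 1) (\<lambda>w. Q (fst w) (snd w))"
    unfolding Q_def
    by (intro continuous_on_sum continuous_on_mult cG) (auto intro!: continuous_intros)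
  from continuous_attains_inf[OF compact_Times[OF C compact_sphere] ne this]
  obtain w where w: "w \<in> C \<times> sphere 0 1"
    "\<And>a z. a \<in> C \<Longrightarrow> z \<in> sphere 0 1 \<Longrightarrow> Q (fst w) (snd w) \<le> Q a z" by fastforce
  have Q: "Q a z = z \<bullet> (matrix_inv (G a) *v z)" for a z
    unfolding inner_matrix_eq_sum Q_def by (simp add: mult_ac)
  have "0 < Q (fst w) (snd w)"
  proof -
    have "snd w \<noteq> 0" using w(1) by auto
    then show ?thesis
      using pos_def_matrix_inv[OF pos, of "fst w"] w(1)
      unfolding Q pos_def_matrix_def by (cases w) auto
  qed
  moreover have "Q (fst w) (snd w) * (z \<bullet> z) \<le> Q a z" if "a \<in> C" for a z
  proof (cases "z = 0")
    case True
    then show ?thesis by (simp add: Q)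
  next
    case False
    define r where "r = norm z"
    have r: "r > 0" using False by (simp add: r_def)
    have "Q (fst w) (snd w) \<le> Q a ((1 / r) *\<^sub>R z)"
      using r by (intro w(2) that) (simp add: r_def)
    also have "\<dots> = Q a z / r\<^sup>2"
      unfolding Q_def sum_divide_distrib by (simp add: power2_eq_square)
    finally have "Q (fst w) (snd w) * r\<^sup>2 \<le> Q a z" using r by (simp add: field_simps)
    then show ?thesis by (simp add: r_def dot_square_norm)
  qed
  ultimately show ?thesis using that unfolding Q_def by blast
qed

lemma continuous_on_christoffel:
  assumes "open V" "smooth_on V G" "\<And>a. a \<in> V \<Longrightarrow> pos_def_matrix (G a)"
  shows "continuous_on V (\<lambda>a. matrix_inv (G a) $ i $ j)" "continuous_on V (christoffel G k i j)"
proof -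
  have G1: "Ck_on (Suc 0) V (\<lambda>a. G a $ p $ q)" for p q
    using Ck_on_matrix_nth[OF assms(1)] assms(2) unfolding smooth_on_def by blast
  have inv: "Ck_on 0 V (\<lambda>a. matrix_inv (G a) $ p $ q)" for p q
    by (rule Ck_on_matrix_inv[OF assms(1) Ck_on_SucD[OF G1] assms(3)])
  then show "continuous_on V (\<lambda>a. matrix_inv (G a) $ i $ j)" by simp
  have pG: "continuous_on V (pd r (\<lambda>a. G a $ p $ q))" for p q r
    using Ck_on_pd[OF G1] by simp
  show "continuous_on V (christoffel G k i j)"
    unfolding christoffel_def[abs_def] using inv pG
    by (intro continuous_on_divide continuous_on_sum continuous_on_mult continuous_on_add
        continuous_on_diff continuous_on_const) simp_all
qed

lemma mem_cball_iff_inner: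
  "0 \<le> R \<Longrightarrow> a \<in> cball y R \<longleftrightarrow> (a - y) \<bullet> (a - y) \<le> R\<^sup>2"
  using abs_le_square_iff[of "norm (a - y)" R]
  by (simp add: dot_square_norm dist_norm norm_minus_commute)

lemma mem_ball_iff_inner:
  "0 \<le> R \<Longrightarrow> a \<in> ball y R \<longleftrightarrow> (a - y) \<bullet> (a - y) < R\<^sup>2"
  using abs_le_square_iff[of R "norm (a - y)"]
  by (auto simp: dot_square_norm dist_norm norm_minus_commute not_le[symmetric])

text \<open>The functions \<open>1 - \<integral> q \<phi>\<close> for Dirichlet heat kernels \<open>q\<close> are of this kind: they solve the heat
  equation where it matters, and take the value \<open>1\<close> elsewhere.\<close>

definition capped_heat_function ::
  "('p::topological_space, 'n::finite) chart set \<Rightarrow> ('p, 'n) metric_coeffs \<Rightarrow> ('p \<Rightarrow> real \<Rightarrow> real) \<Rightarrow> bool"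
  where
  "capped_heat_function A g D \<longleftrightarrow> continuous_on (UNIV \<times> {0<..}) (\<lambda>(x, t). D x t) \<and>
     (\<forall>x t. 0 < t \<longrightarrow> 0 \<le> D x t) \<and> (\<forall>x t. 0 < t \<longrightarrow> D x t < 1 \<longrightarrow> heat_at A g D x t)"

text \<open>The barrier \<open>exp (- \<alpha> s) (r\<^sup>2 + \<beta> s - \<bar>x - y0\<bar>\<^sup>2)\<^sup>2\<close> is a subsolution if \<open>\<alpha>\<close> is large: where the
  second factor is small its gradient is bounded away from zero, elsewhere the decay in time wins.\<close>

lemma positivity_spreads_in_chart:
  fixes A :: "('p::{t2_space, second_countable_topology}, 'n::finite) chart set"
  assumes atlas: "smooth_atlas A" and metric: "riemannian_metric A g"
    and c: "c \<in> A" and ball: "cball y0 R \<subseteq> chart_range c"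
    and r: "0 < r" "r < R" and \<tau>: "0 < \<tau>" and \<delta>: "0 < \<delta>" and R': "R' < R"
  obtains \<eta> where "0 < \<eta>"
    "\<And>D t x. capped_heat_function A g D \<Longrightarrow> 0 < t \<Longrightarrow>
      (\<And>a. a \<in> ball y0 r \<Longrightarrow> \<delta> \<le> D (chart_inv c a) t) \<Longrightarrow>
      x \<in> cball y0 R' \<Longrightarrow> \<eta> \<le> D (chart_inv c x) (t + \<tau>)"
proof -
  note chart = smooth_atlas_chart[OF atlas c]
  define G where "G = g c \<circ> chart_inv c"
  have Gpos: "pos_def_matrix (G a)" if "a \<in> chart_range c" for a
  proof -
    have "pos_def_matrix (g c p)" if "p \<in> fst c" for p
      using metric c that unfolding riemannian_metric_def by blast
    from this[OF chart(7)[OF that]] show ?thesis by (simp add: G_def)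
  qed
  have Gs: "smooth_on (chart_range c) G"
    using metric c unfolding riemannian_metric_def G_def by blast
  note cont = continuous_on_christoffel[OF chart(2) Gs Gpos]
  obtain m where m: "0 < m" "\<And>a z. a \<in> cball y0 R \<Longrightarrow>
      m * (z \<bullet> z) \<le> (\<Sum>i\<in>UNIV. \<Sum>j\<in>UNIV. matrix_inv (G a) $ i $ j * (z $ i * z $ j))"
  proof (rule uniform_ellipticity[of "cball y0 R" G])
    show "pos_def_matrix (G a)" if "a \<in> cball y0 R" for a using Gpos ball that by blast
    show "continuous_on (cball y0 R) (\<lambda>a. matrix_inv (G a) $ i $ j)" for i j
      by (rule continuous_on_subset[OF cont(1) ball])
  qed (auto intro: that)
  define q where "q a = (\<Sum>i\<in>UNIV. \<Sum>j\<in>UNIV. matrix_inv (G a) $ i $ j *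
          ((\<Sum>k\<in>UNIV. 4 * christoffel G k i j a * (a - y0) $ k) - (if i = j then 4 else 0)))" for a
  have "continuous_on (cball y0 R) q"
    unfolding q_def
    by (intro continuous_on_sum continuous_on_mult continuous_on_diff continuous_on_const
        continuous_on_subset[OF cont(1) ball] continuous_on_subset[OF cont(2) ball])
       (auto intro!: continuous_intros)
  then have "bounded (q ` cball y0 R)"
    by (intro compact_imp_bounded compact_continuous_image compact_cball)
  then obtain C where C0: "\<forall>x\<in>q ` cball y0 R. norm x \<le> C"
    unfolding bounded_iff by blast
  have C: "- C \<le> q a" if "a \<in> cball y0 R" for a
    using bspec[OF C0 imageI[OF that]] by (simp add: abs_le_iff)

  define \<beta> where "\<beta> = (R\<^sup>2 - r\<^sup>2) / \<tau>"
  define E where "E = 2 * \<beta> + C + 8 * m"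
  define \<alpha> where "\<alpha> = E\<^sup>2 / (32 * m * r\<^sup>2) + 1"
  define \<epsilon> where "\<epsilon> = min \<delta> 1 / (R\<^sup>2)\<^sup>2"
  have \<beta>: "0 < \<beta>" "r\<^sup>2 + \<beta> * \<tau> = R\<^sup>2"
    using r \<tau> by (auto simp: \<beta>_def intro!: divide_pos_pos power_strict_mono)
  have \<epsilon>: "0 < \<epsilon>" "\<epsilon> * (R\<^sup>2)\<^sup>2 \<le> \<delta>" "\<epsilon> * (R\<^sup>2)\<^sup>2 \<le> 1"
    using \<delta> r by (auto simp: \<epsilon>_def)
  have \<alpha>: "0 < \<alpha>" using m(1) by (simp add: \<alpha>_def add_nonneg_pos)
  \<comment> \<open>The discriminant of this quadratic polynomial in \<open>\<rho>\<close> is negative by the choice of \<open>\<alpha>\<close>.\<close>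
  have quadratic: "0 < \<alpha> * \<rho>\<^sup>2 - E * \<rho> + 8 * m * r\<^sup>2" if "0 < \<rho>" for \<rho>
  proof -
    define k where "k = 8 * m * r\<^sup>2"
    have k: "0 < k" using m r by (simp add: k_def)
    have k\<alpha>: "4 * k * \<alpha> = E\<^sup>2 + 4 * k" using m(1) r(1) by (simp add: \<alpha>_def k_def field_simps)
    have "4 * k * (\<alpha> * \<rho>\<^sup>2 - E * \<rho> + k) = (4 * k * \<alpha>) * \<rho>\<^sup>2 - 4 * k * E * \<rho> + 4 * k\<^sup>2"
      by (simp add: power2_eq_square algebra_simps)
    also have "\<dots> = (2 * k - E * \<rho>)\<^sup>2 + 4 * k * \<rho>\<^sup>2"
      unfolding k\<alpha> by (simp add: power2_eq_square algebra_simps)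
    also have "\<dots> > 0" using k that by (simp add: add_nonneg_pos)
    finally have "0 < \<alpha> * \<rho>\<^sup>2 - E * \<rho> + k"
      using k by (simp add: zero_less_mult_iff)
    then show ?thesis by (simp add: k_def)
  qed
  define \<rho> where "\<rho> a s = r\<^sup>2 + \<beta> * s - (a - y0) \<bullet> (a - y0)" for a s
  define \<eta> where "\<eta> = \<epsilon> * exp (- \<alpha> * \<tau>) * (R\<^sup>2 - (max R' 0)\<^sup>2)\<^sup>2"
  show ?thesis
  proof (rule that[of \<eta>])
    have "(max R' 0)\<^sup>2 < R\<^sup>2" using R' r by (intro power_strict_mono) auto
    then show "0 < \<eta>" using \<epsilon> by (simp add: \<eta>_def)
    fix D t x
    assume D: "capped_heat_function A g D" and t: "0 < t"
      and init: "\<And>a. a \<in> ball y0 r \<Longrightarrow> \<delta> \<le> D (chart_inv c a) t"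
      and x: "x \<in> cball y0 R'"
    define b where "b p s = \<epsilon> * exp (- \<alpha> * (s - t)) * (\<rho> (snd c p) (s - t))\<^sup>2" for p s
    define u where "u p s = 0 + 1 * D p s + (- \<epsilon> * exp (- \<alpha> * (s - t))) * (\<rho> (snd c p) (s - t))\<^sup>2" for p s
    have u: "u p s = D p s - b p s" for p s by (simp add: u_def b_def)
    define K0 where "K0 = (cball y0 R \<times> {t..t + \<tau>}) \<inter> {w. 0 \<le> \<rho> (fst w) (snd w - t)}"
    define K where "K = (\<lambda>w. (chart_inv c (fst w), snd w)) ` K0"
    have K0: "compact K0"
      unfolding K0_def \<rho>_def
      by (intro compact_Int_closed compact_Times compact_cball compact_Icc closed_Collect_le
          continuous_intros)
    have inK: "(p, s) \<in> K \<longleftrightarrow> p \<in> fst c \<and> snd c p \<in> cball y0 R \<and> s \<in> {t..t + \<tau>} \<and> 0 \<le> \<rho> (snd c p) (s - t)"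
      for p s
    proof
      assume "(p, s) \<in> K"
      then obtain a where "a \<in> cball y0 R" "p = chart_inv c a" "s \<in> {t..t + \<tau>}" "0 \<le> \<rho> a (s - t)"
        by (auto simp: K_def K0_def)
      moreover from this have "a \<in> chart_range c" using ball by auto
      ultimately show "p \<in> fst c \<and> snd c p \<in> cball y0 R \<and> s \<in> {t..t + \<tau>} \<and> 0 \<le> \<rho> (snd c p) (s - t)"
        using chart(7,8) by simp
    next
      assume h: "p \<in> fst c \<and> snd c p \<in> cball y0 R \<and> s \<in> {t..t + \<tau>} \<and> 0 \<le> \<rho> (snd c p) (s - t)"
      then have "(snd c p, s) \<in> K0" by (auto simp: K0_def)
      moreover have "(p, s) = (\<lambda>w. (chart_inv c (fst w), snd w)) (snd c p, s)"
        using chart(6) h by simp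
      ultimately show "(p, s) \<in> K" unfolding K_def by (rule rev_image_eqI)
    qed
    have "0 \<le> u (chart_inv c x) (t + \<tau>)"
    proof (rule parabolic_minimum_principle[OF atlas metric, where u = u and K = K])
      show "compact K"
        unfolding K_def
      proof (intro compact_continuous_image K0 continuous_on_Pair)
        show "continuous_on K0 (\<lambda>w. chart_inv c (fst w))"
          by (rule continuous_on_compose2[OF chart(4) continuous_on_fst[OF continuous_on_id]])
             (use ball in \<open>auto simp: K0_def\<close>)
      qed (intro continuous_intros)
      have sub: "K \<subseteq> UNIV \<times> {0<..}" using t by (auto simp: inK)
      have "continuous_on K (\<lambda>z. D (fst z) (snd z))"
        using D continuous_on_subset[OF _ sub] unfolding capped_heat_function_def case_prod_unfold by blast
      moreover have "continuous_on K (\<lambda>z. snd c (fst z))"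
        by (rule continuous_on_compose2[OF chart(3) continuous_on_fst[OF continuous_on_id]])
           (auto simp: inK)
      ultimately have "continuous_on K (\<lambda>z. u (fst z) (snd z))"
        unfolding u_def \<rho>_def by (intro continuous_intros)
      then show "continuous_on K (\<lambda>(x, t). u x t)" by (simp add: case_prod_unfold)
      have R0: "0 \<le> R" using r by simp
      show "(chart_inv c x, t + \<tau>) \<in> K"
      proof -
        have xR: "x \<in> cball y0 R" using x R' by auto
        then have "(x - y0) \<bullet> (x - y0) \<le> R\<^sup>2"
          by (simp only: mem_cball_iff_inner[OF R0])
        then show ?thesis
          using xR ball chart(7,8) \<tau> \<beta>(2) by (auto simp: inK \<rho>_def)
      qed
      fix p s
      assume ps: "(p, s) \<in> K" and neg: "u p s < 0"
      define a where "a = snd c p"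
      define z where "z = a - y0"
      define \<rho>0 where "\<rho>0 = \<rho> a (s - t)"
      have p: "p \<in> fst c" and a: "a \<in> cball y0 R" and s: "t \<le> s" "s \<le> t + \<tau>" and \<rho>0: "0 \<le> \<rho>0"
        using ps by (auto simp: inK a_def \<rho>0_def)
      have s0: "0 < s" using s t by simp
      have D0: "0 \<le> D p s" using D s0 unfolding capped_heat_function_def by blast
      then have bD: "D p s < b p s" "0 < b p s" using neg by (simp_all add: u)
      have \<rho>pos: "0 < \<rho>0"
        using bD(2) \<rho>0 by (cases "\<rho>0 = 0") (auto simp: b_def \<rho>0_def a_def)
      have "\<beta> * (s - t) \<le> \<beta> * \<tau>" using s \<beta>(1) by simp
      then have "\<rho>0 \<le> R\<^sup>2" using \<beta>(2) inner_ge_zero[of "a - y0"] unfolding \<rho>0_def \<rho>_def by linarith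
      then have "\<rho>0\<^sup>2 \<le> (R\<^sup>2)\<^sup>2" using \<rho>0 by (intro power_mono)
      moreover have "exp (- \<alpha> * (s - t)) \<le> 1" using \<alpha> s by simp
      ultimately have "exp (- \<alpha> * (s - t)) * \<rho>0\<^sup>2 \<le> 1 * (R\<^sup>2)\<^sup>2" by (intro mult_mono) auto
      then have b1: "b p s \<le> \<epsilon> * (R\<^sup>2)\<^sup>2"
        using \<epsilon>(1) by (simp add: b_def \<rho>0_def a_def mult.assoc)
      then have heat: "heat_at A g D p s"
        using D s0 bD \<epsilon>(3) unfolding capped_heat_function_def by force
      have st: "t < s"
      proof (rule ccontr)
        assume "\<not> t < s"
        then have st: "s = t" using s by simp
        have "(a - y0) \<bullet> (a - y0) < r\<^sup>2" using \<rho>pos by (simp add: \<rho>0_def \<rho>_def st)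
        then have "a \<in> ball y0 r"
          using r(1) by (simp only: mem_ball_iff_inner less_imp_le)
        then have "\<delta> \<le> D p s" using init[of a] chart(6)[OF p] by (simp add: a_def st)
        then show False using bD(1) b1 \<epsilon>(2) by simp
      qed
      have cap: "chart_inv c (snd c p) = p" by (rule chart(6)[OF p])
      have tw1: "twice_differentiable ((\<lambda>y. D y s) \<circ> chart_inv c) (snd c p)"
        and dD: "((\<lambda>s. D p s) has_real_derivative laplacian g c (\<lambda>y. D y s) p) (at s)"
        using heat c p unfolding heat_at_def by blast+
      let ?B = "\<lambda>a. ((r\<^sup>2 + \<beta> * (s - t)) - (a - y0) \<bullet> (a - y0))\<^sup>2"
      have Beq: "?B y = ((\<lambda>y. (\<rho> (snd c y) (s - t))\<^sup>2) \<circ> chart_inv c) y" if "y \<in> chart_range c" for y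
        using chart(8)[OF that] by (simp add: \<rho>_def)
      have tw2: "twice_differentiable ((\<lambda>y. (\<rho> (snd c y) (s - t))\<^sup>2) \<circ> chart_inv c) (snd c p)"
        by (rule twice_differentiable_cong[OF chart(2) chart(5)[OF p] Beq squared_distance_barrier(1)])
      have lapB: "laplacian g c (\<lambda>y. (\<rho> (snd c y) (s - t))\<^sup>2) p
          = 8 * (\<Sum>i\<in>UNIV. \<Sum>j\<in>UNIV. matrix_inv (G a) $ i $ j * (z $ i * z $ j)) + \<rho>0 * q a"
      proof -
        have "laplacian g c (\<lambda>y. (\<rho> (snd c y) (s - t))\<^sup>2) p = laplace_coord G ?B a"
          unfolding laplacian_eq_laplace_coord[where g = g, OF cap] G_def a_def
          by (rule laplace_coord_cong[OF chart(2) chart(5)[OF p] Beq, symmetric])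
        then show ?thesis
          unfolding squared_distance_barrier(2) q_def \<rho>0_def \<rho>_def z_def .
      qed
      have lapB_ge: "8 * m * r\<^sup>2 - (8 * m + C) * \<rho>0 \<le> laplacian g c (\<lambda>y. (\<rho> (snd c y) (s - t))\<^sup>2) p"
      proof -
        have "r\<^sup>2 - \<rho>0 \<le> z \<bullet> z"
          using s \<beta>(1) by (simp add: \<rho>0_def \<rho>_def z_def)
        then have "m * (r\<^sup>2 - \<rho>0) \<le> m * (z \<bullet> z)" using m(1) by simp
        moreover have "\<rho>0 * - C \<le> \<rho>0 * q a" using C[OF a] \<rho>0 by (intro mult_left_mono)
        ultimately show ?thesis
          unfolding lapB using m(2)[OF a, of z] by (simp add: algebra_simps)
      qed
      show "\<exists>c\<in>A. p \<in> fst c \<and> (\<exists>r>0. \<forall>s'\<in>{s - r<..s}. (p, s') \<in> K) \<and>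
          (\<exists>W. open W \<and> p \<in> W \<and> (\<forall>y\<in>W. (y, s) \<in> K)) \<and>
          twice_differentiable ((\<lambda>y. u y s) \<circ> chart_inv c) (snd c p) \<and>
          (\<exists>D>laplacian g c (\<lambda>y. u y s) p. ((\<lambda>s. u p s) has_real_derivative D) (at s))"
      proof (intro bexI[of _ c] conjI)
        show "\<exists>r>0. \<forall>s'\<in>{s - r<..s}. (p, s') \<in> K"
        proof (intro exI[of _ "min (s - t) (\<rho>0 / \<beta>)"] conjI ballI)
          show "0 < min (s - t) (\<rho>0 / \<beta>)" using st \<rho>pos \<beta>(1) by simp
          fix s' assume s': "s' \<in> {s - min (s - t) (\<rho>0 / \<beta>)<..s}"
          then have "s - s' < \<rho>0 / \<beta>" by auto
          then have "\<beta> * (s - s') < \<rho>0" using \<beta>(1) by (simp add: field_simps)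
          then have "0 \<le> \<rho> a (s' - t)" by (simp add: \<rho>0_def \<rho>_def algebra_simps)
          then show "(p, s') \<in> K" using p a s s' by (auto simp: inK a_def)
        qed
        show "\<exists>W. open W \<and> p \<in> W \<and> (\<forall>y\<in>W. (y, s) \<in> K)"
        proof (intro exI conjI ballI)
          let ?W = "fst c \<inter> snd c -` {a. (a - y0) \<bullet> (a - y0) < r\<^sup>2 + \<beta> * (s - t)}"
          show "open ?W"
            by (rule continuous_open_preimage[OF chart(3,1)])
               (intro open_Collect_less continuous_intros)
          show "p \<in> ?W" using p \<rho>pos by (simp add: \<rho>0_def \<rho>_def a_def)
          fix y assume y: "y \<in> ?W"
          have "r\<^sup>2 + \<beta> * (s - t) \<le> R\<^sup>2" using \<open>\<beta> * (s - t) \<le> \<beta> * \<tau>\<close> \<beta>(2) by simp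
          then have "(snd c y - y0) \<bullet> (snd c y - y0) \<le> R\<^sup>2" using y by simp
          then have "snd c y \<in> cball y0 R"
            by (simp only: mem_cball_iff_inner[OF R0])
          then show "(y, s) \<in> K" using y s by (simp add: inK \<rho>_def)
        qed
        show "twice_differentiable ((\<lambda>y. u y s) \<circ> chart_inv c) (snd c p)"
          unfolding u_def by (rule laplacian_affine(1)[OF cap tw1 tw2])
        show "\<exists>D>laplacian g c (\<lambda>y. u y s) p. ((\<lambda>s. u p s) has_real_derivative D) (at s)"
        proof (intro exI conjI)
          show "((\<lambda>s. u p s) has_real_derivative laplacian g c (\<lambda>y. D y s) p
              + \<epsilon> * exp (- \<alpha> * (s - t)) * (\<alpha> * \<rho>0\<^sup>2 - 2 * \<beta> * \<rho>0)) (at s)"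
            unfolding u_def \<rho>_def \<rho>0_def a_def
            by (auto intro!: derivative_eq_intros dD simp: algebra_simps power2_eq_square)
          have "- laplacian g c (\<lambda>y. (\<rho> (snd c y) (s - t))\<^sup>2) p < \<alpha> * \<rho>0\<^sup>2 - 2 * \<beta> * \<rho>0"
            using lapB_ge quadratic[OF \<rho>pos] by (simp add: E_def algebra_simps)
          then have "\<epsilon> * exp (- \<alpha> * (s - t)) * - laplacian g c (\<lambda>y. (\<rho> (snd c y) (s - t))\<^sup>2) p
              < \<epsilon> * exp (- \<alpha> * (s - t)) * (\<alpha> * \<rho>0\<^sup>2 - 2 * \<beta> * \<rho>0)"
            using \<epsilon>(1) by (intro mult_strict_left_mono) simp_all
          then show "laplacian g c (\<lambda>y. u y s) p < laplacian g c (\<lambda>y. D y s) p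
              + \<epsilon> * exp (- \<alpha> * (s - t)) * (\<alpha> * \<rho>0\<^sup>2 - 2 * \<beta> * \<rho>0)"
            unfolding u_def laplacian_affine(2)[OF cap tw1 tw2] by simp
        qed
      qed (use c p in auto)
    qed
    then have "b (chart_inv c x) (t + \<tau>) \<le> D (chart_inv c x) (t + \<tau>)" by (simp add: u)
    moreover have "\<eta> \<le> b (chart_inv c x) (t + \<tau>)"
    proof -
      have "norm (x - y0) \<le> max R' 0" using x by (simp add: dist_norm norm_minus_commute)
      then have n: "(x - y0) \<bullet> (x - y0) \<le> (max R' 0)\<^sup>2"
        by (simp add: dot_square_norm power_mono)
      have "(max R' 0)\<^sup>2 \<le> R\<^sup>2" using R' r by (intro power_mono) auto
      then have "(R\<^sup>2 - (max R' 0)\<^sup>2)\<^sup>2 \<le> (R\<^sup>2 - (x - y0) \<bullet> (x - y0))\<^sup>2"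
        using n by (intro power_mono) auto
      moreover have "snd c (chart_inv c x) = x"
        using x R' ball by (intro chart(8)) auto
      ultimately show ?thesis
        using \<epsilon>(1) \<beta>(2) by (simp add: \<eta>_def b_def \<rho>_def)
    qed
    ultimately show "\<eta> \<le> D (chart_inv c x) (t + \<tau>)" by simp
  qed
qed

text \<open>The strong minimum principle, uniformly for a family \<open>\<D>\<close> of functions: the points near which the
  family is bounded below by a positive constant at some time before \<open>t0\<close> form an open and closed
  set, as each spreading in a chart takes as little time as desired.\<close>

lemma positivity_propagates:
  fixes A :: "('p::{t2_space, second_countable_topology}, 'n::finite) chart set"
  assumes atlas: "smooth_atlas A" and metric: "riemannian_metric A g"
    and conn: "connected (UNIV :: 'p set)"
    and \<D>: "\<And>D. D \<in> \<D> \<Longrightarrow> capped_heat_function A g D"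
    and t1: "0 < t1" "t1 < t0" and N: "open N" "N \<noteq> {}" and \<delta>: "0 < \<delta>"
    and init: "\<And>D x. D \<in> \<D> \<Longrightarrow> x \<in> N \<Longrightarrow> \<delta> \<le> D x t1"
  obtains \<eta> where "0 < \<eta>" "\<And>D. D \<in> \<D> \<Longrightarrow> \<eta> \<le> D x0 t0"
proof -
  define E where "E = {x. \<exists>t N \<delta>. 0 < t \<and> t < t0 \<and> open N \<and> x \<in> N \<and> 0 < \<delta> \<and> (\<forall>D\<in>\<D>. \<forall>y\<in>N. \<delta> \<le> D y t)}"
  have spread: "\<exists>\<eta>>0. \<exists>t\<in>{0<..<t0}. \<forall>D\<in>\<D>. \<forall>a\<in>cball (snd c y) R'. \<eta> \<le> D (chart_inv c a) (t + (t0 - t) / k)"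
    if c: "c \<in> A" "y \<in> fst c" and y: "y \<in> E" and R: "cball (snd c y) R \<subseteq> chart_range c" "R' < R" "0 < R"
      and k: "1 \<le> k" for c y R R' and k :: real
  proof -
    note chart = smooth_atlas_chart[OF atlas c(1)]
    obtain t N \<delta> where t: "0 < t" "t < t0" and N: "open N" "y \<in> N" and \<delta>: "0 < \<delta>"
      and low: "\<And>D z. D \<in> \<D> \<Longrightarrow> z \<in> N \<Longrightarrow> \<delta> \<le> D z t"
      using y unfolding E_def by blast
    have "open (chart_range c \<inter> chart_inv c -` N)"
      by (rule continuous_open_preimage[OF chart(4,2) N(1)])
    moreover have "snd c y \<in> chart_range c \<inter> chart_inv c -` N"
      using chart(5,6)[OF c(2)] N(2) by simp
    ultimately obtain r0 where r0: "0 < r0" "ball (snd c y) r0 \<subseteq> chart_range c \<inter> chart_inv c -` N"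
      by (metis openE)
    define r where "r = min r0 R / 2"
    have r: "0 < r" "r < R" "r \<le> r0" using r0(1) R(3) by (auto simp: r_def min_def)
    have "0 < (t0 - t) / k" using t k by simp
    then obtain \<eta> where \<eta>: "0 < \<eta>"
      "\<And>D s x. capped_heat_function A g D \<Longrightarrow> 0 < s \<Longrightarrow>
        (\<And>a. a \<in> ball (snd c y) r \<Longrightarrow> \<delta> \<le> D (chart_inv c a) s) \<Longrightarrow>
        x \<in> cball (snd c y) R' \<Longrightarrow> \<eta> \<le> D (chart_inv c x) (s + (t0 - t) / k)"
      using positivity_spreads_in_chart[OF atlas metric c(1) R(1) r(1,2) _ \<delta> R(2)] by metis
    have sub: "chart_inv c a \<in> N" if "a \<in> ball (snd c y) r" for a
    proof -
      have "a \<in> ball (snd c y) r0" using r(3) that by simp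
      then show ?thesis using r0(2) by blast
    qed
    have "\<eta> \<le> D (chart_inv c a) (t + (t0 - t) / k)" if "D \<in> \<D>" "a \<in> cball (snd c y) R'" for D a
      by (rule \<eta>(2)[OF \<D>[OF that(1)] t(1) low[OF that(1) sub] that(2)])
    then show ?thesis using \<eta>(1) t by (intro exI[of _ \<eta>] conjI bexI[of _ t]) auto
  qed
  have "open E"
  proof (subst open_subopen, intro ballI)
    fix x assume "x \<in> E"
    then obtain t N \<delta> where "0 < t" "t < t0" "open N" "x \<in> N" "0 < \<delta>" "\<forall>D\<in>\<D>. \<forall>y\<in>N. \<delta> \<le> D y t"
      unfolding E_def by blast
    then show "\<exists>T. open T \<and> x \<in> T \<and> T \<subseteq> E"
      by (intro exI[of _ N]) (auto simp: E_def)
  qed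
  moreover have "closed E"
  proof -
    have "x \<in> E" if x: "x \<in> closure E" for x
    proof -
      obtain c where c: "c \<in> A" "x \<in> fst c" using atlas unfolding smooth_atlas_def by blast
      note chart = smooth_atlas_chart[OF atlas c(1)]
      obtain \<rho>0 where "0 < \<rho>0" "cball (snd c x) \<rho>0 \<subseteq> chart_range c"
        using chart(2) chart(5)[OF c(2)] open_contains_cball by blast
      then obtain \<rho> where \<rho>: "0 < \<rho>" "cball (snd c x) (3 * \<rho>) \<subseteq> chart_range c"
        using that[of "\<rho>0 / 3"] by (metis divide_pos_pos nonzero_mult_div_cancel_left times_divide_eq_right zero_less_numeral zero_neq_numeral)
      have open_pre: "open (fst c \<inter> snd c -` ball z s)" for z s
        by (rule continuous_open_preimage[OF chart(3,1) open_ball])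
      have "x \<in> fst c \<inter> snd c -` ball (snd c x) \<rho>" using c(2) \<rho>(1) by simp
      then have "(fst c \<inter> snd c -` ball (snd c x) \<rho>) \<inter> E \<noteq> {}"
        using open_Int_closure_eq_empty[OF open_pre[of "snd c x" \<rho>], of E] x by blast
      then obtain y where y: "y \<in> E" "y \<in> fst c" "dist (snd c x) (snd c y) < \<rho>"
        by auto
      have "cball (snd c y) (2 * \<rho>) \<subseteq> cball (snd c x) (3 * \<rho>)"
      proof
        fix a assume "a \<in> cball (snd c y) (2 * \<rho>)"
        then show "a \<in> cball (snd c x) (3 * \<rho>)"
          using y(3) dist_triangle[of "snd c x" a "snd c y"] by simp
      qed
      then have ball: "cball (snd c y) (2 * \<rho>) \<subseteq> chart_range c" using \<rho>(2) by blast
      have lt: "3 / 2 * \<rho> < 2 * \<rho>" "0 < 2 * \<rho>" using \<rho>(1) by auto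
      obtain \<eta> t where \<eta>: "0 < \<eta>" "0 < t" "t < t0"
        "\<And>D a. D \<in> \<D> \<Longrightarrow> a \<in> cball (snd c y) (3 / 2 * \<rho>) \<Longrightarrow> \<eta> \<le> D (chart_inv c a) (t + (t0 - t) / 2)"
        using spread[OF c(1) y(2,1) ball lt, of 2] by auto
      let ?N = "fst c \<inter> snd c -` ball (snd c y) (3 / 2 * \<rho>)"
      have "\<eta> \<le> D z (t + (t0 - t) / 2)" if "D \<in> \<D>" "z \<in> ?N" for D z
        using \<eta>(4)[OF that(1), of "snd c z"] that(2) chart(6)[of z] by auto
      moreover have "x \<in> ?N" using c(2) y(3) \<rho>(1) by (simp add: dist_commute)
      moreover have "0 < t + (t0 - t) / 2" "t + (t0 - t) / 2 < t0" using \<eta>(2,3) by (simp_all add: field_simps)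
      ultimately show "x \<in> E"
        unfolding E_def using open_pre[of "snd c y" "3 / 2 * \<rho>"] \<eta>(1) by blast
    qed
    then have "closure E = E" using closure_subset by blast
    then show ?thesis using closed_closure[of E] by simp
  qed
  moreover have "E \<noteq> {}"
  proof -
    have "N \<subseteq> E" unfolding E_def using t1 N(1) \<delta> init by blast
    then show ?thesis using N(2) by blast
  qed
  ultimately have "E = UNIV"
    using conn unfolding connected_clopen by simp blast
  then have x0: "x0 \<in> E" by simp
  obtain c where c: "c \<in> A" "x0 \<in> fst c" using atlas unfolding smooth_atlas_def by blast
  note chart = smooth_atlas_chart[OF atlas c(1)]
  obtain R where R: "0 < R" "cball (snd c x0) R \<subseteq> chart_range c"
    using chart(2) chart(5)[OF c(2)] open_contains_cball by blast
  obtain \<eta> t where \<eta>: "0 < \<eta>"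
    "\<And>D a. D \<in> \<D> \<Longrightarrow> a \<in> cball (snd c x0) 0 \<Longrightarrow> \<eta> \<le> D (chart_inv c a) (t + (t0 - t) / 1)"
    using spread[OF c x0 R(2,1,1), of 1] by auto
  have "\<eta> \<le> D x0 t0" if "D \<in> \<D>" for D
    using \<eta>(2)[OF that, of "snd c x0"] chart(6)[OF c(2)] by simp
  then show ?thesis using that \<eta>(1) by blast
qed

section \<open>Integrals against a compactly supported weight\<close>

text \<open>A Dirichlet heat kernel is smooth in the interior of its domain only, and nothing bounds its derivatives
  near the boundary. So it is paired with continuous functions \<open>\<phi>\<close> of compact support \<open>K\<close>, where
  differentiation under the integral sign is possible, rather than integrated over its whole domain.\<close>

locale compact_weight =
  fixes M :: "'p::t2_space measure" and K :: "'p set" and \<phi> :: "'p \<Rightarrow> real"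
  assumes sets_M: "sets M = sets borel" and compact_K: "compact K"
    and finite_K: "emeasure M K < \<infinity>"
    and cont_\<phi>: "continuous_on UNIV \<phi>" and supp_\<phi>: "\<And>y. y \<notin> K \<Longrightarrow> \<phi> y = 0"
begin

definition wint :: "('p \<Rightarrow> real) \<Rightarrow> real" where
  "wint h = (\<integral>y. h y * \<phi> y \<partial>M)"

lemma integrable_wint:
  assumes "continuous_on K h"
  shows "integrable M (\<lambda>y. h y * \<phi> y)"
proof -
  have K: "K \<in> sets borel" using compact_K by (intro borel_closed compact_imp_closed)
  have c: "continuous_on K (\<lambda>y. h y * \<phi> y)"
    by (intro continuous_on_mult assms continuous_on_subset[OF cont_\<phi>]) simp
  have eq: "(\<lambda>y. h y * \<phi> y) = (\<lambda>y. indicator K y *\<^sub>R (h y * \<phi> y))"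
    by (auto simp: fun_eq_iff indicator_def supp_\<phi>)
  have "(\<lambda>y. indicator K y *\<^sub>R (h y * \<phi> y)) \<in> borel_measurable borel"
    by (rule borel_measurable_continuous_on_indicator[OF K c])
  then have meas: "(\<lambda>y. h y * \<phi> y) \<in> borel_measurable M"
    unfolding eq[symmetric] using measurable_cong_sets[OF sets_M refl] by blast
  have "bounded ((\<lambda>y. h y * \<phi> y) ` K)"
    by (intro compact_imp_bounded compact_continuous_image c compact_K)
  then obtain B where B: "\<And>y. y \<in> K \<Longrightarrow> norm (h y * \<phi> y) \<le> B"
    unfolding bounded_iff by auto
  show ?thesis
    by (rule integrableI_bounded_set[of K M _ B])
       (use K sets_M meas finite_K B supp_\<phi> in auto)
qed

lemma wint_add:
  "continuous_on K h \<Longrightarrow> continuous_on K k \<Longrightarrow> wint (\<lambda>y. h y + k y) = wint h + wint k"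
  unfolding wint_def by (simp add: distrib_right integrable_wint)

lemma wint_diff:
  "continuous_on K h \<Longrightarrow> continuous_on K k \<Longrightarrow> wint (\<lambda>y. h y - k y) = wint h - wint k"
  unfolding wint_def by (simp add: left_diff_distrib integrable_wint)

lemma wint_cmult: "wint (\<lambda>y. c * h y) = c * wint h"
  unfolding wint_def by (simp add: mult.assoc)

lemma wint_sum:
  "(\<And>i. i \<in> I \<Longrightarrow> continuous_on K (h i)) \<Longrightarrow> wint (\<lambda>y. \<Sum>i\<in>I. h i y) = (\<Sum>i\<in>I. wint (h i))"
  unfolding wint_def by (simp add: sum_distrib_right integrable_wint)

definition mass :: real where "mass = (\<integral>y. \<bar>\<phi> y\<bar> \<partial>M)"

lemma mass_nonneg: "0 \<le> mass" unfolding mass_def by simp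

lemma abs_wint_le:
  assumes "continuous_on K h" "\<And>y. y \<in> K \<Longrightarrow> \<bar>h y\<bar> \<le> b"
  shows "\<bar>wint h\<bar> \<le> b * mass"
proof -
  have i\<phi>: "integrable M (\<lambda>y. \<bar>\<phi> y\<bar>)"
    using integrable_wint[of "\<lambda>_. 1"] by simp
  have "\<bar>wint h\<bar> \<le> (\<integral>y. \<bar>h y * \<phi> y\<bar> \<partial>M)"
    unfolding wint_def by (rule integral_abs_bound)
  also have "\<dots> \<le> (\<integral>y. b * \<bar>\<phi> y\<bar> \<partial>M)"
  proof (rule integral_mono)
    show "integrable M (\<lambda>y. \<bar>h y * \<phi> y\<bar>)" by (rule integrable_abs[OF integrable_wint[OF assms(1)]])
    show "integrable M (\<lambda>y. b * \<bar>\<phi> y\<bar>)" using i\<phi> by simp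
    show "\<bar>h y * \<phi> y\<bar> \<le> b * \<bar>\<phi> y\<bar>" for y
      using assms(2)[of y] supp_\<phi>[of y] by (cases "y \<in> K") (auto simp: abs_mult mult_right_mono)
  qed
  also have "\<dots> = b * mass" unfolding mass_def by simp
  finally show ?thesis .
qed

lemma continuous_on_slice:
  assumes "continuous_on (U \<times> K) (\<lambda>(e, y). H e y)" "e \<in> U"
  shows "continuous_on K (H e)"
proof -
  have "continuous_on K (\<lambda>y. (\<lambda>(e, y). H e y) (e, y))"
    by (rule continuous_on_compose2[OF assms(1)]) (auto intro!: continuous_intros assms(2))
  then show ?thesis by simp
qed

lemma continuous_on_wint:
  fixes H :: "'e::topological_space \<Rightarrow> 'p \<Rightarrow> real"
  assumes "continuous_on (U \<times> K) (\<lambda>(e, y). H e y)"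
  shows "continuous_on U (\<lambda>e. wint (H e))"
  unfolding continuous_on_def
proof (intro ballI tendstoI)
  fix e0 r assume e0: "e0 \<in> U" and r: "0 < (r :: real)"
  define d where "d = r / (mass + 1)"
  have d: "0 < d" "d * mass < r"
    using r mass_nonneg by (auto simp: d_def field_simps add_nonneg_pos)
  obtain X0 where X0: "e0 \<in> X0" "open X0"
    "\<forall>x\<in>X0 \<inter> U. \<forall>y\<in>K. dist ((\<lambda>(e, y). H e y) (x, y)) ((\<lambda>(e, y). H e y) (e0, y)) \<le> d"
    using continuous_on_prod_compactE[OF assms compact_K e0 d(1)] by blast
  have "dist (wint (H e)) (wint (H e0)) < r" if "e \<in> X0" "e \<in> U" for e
  proof -
    have c: "continuous_on K (H e)" "continuous_on K (H e0)"
      using continuous_on_slice[OF assms] that e0 by auto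
    have "\<bar>wint (\<lambda>y. H e y - H e0 y)\<bar> \<le> d * mass"
      using X0(3) that by (intro abs_wint_le continuous_on_diff c) (auto simp: dist_real_def)
    then show ?thesis
      using d(2) by (simp add: wint_diff[OF c] dist_real_def)
  qed
  then show "\<forall>\<^sub>F e in at e0 within U. dist (wint (H e)) (wint (H e0)) < r"
    unfolding eventually_at_topological using X0(1,2) by blast
qed

text \<open>Differentiation under the integral sign. As \<open>K\<close> is compact, continuity of the derivative
  in both variables suffices.\<close>

lemma has_derivative_wint:
  fixes H :: "'e::euclidean_space \<Rightarrow> 'p \<Rightarrow> real"
  assumes U: "open U" "e0 \<in> U"
    and H: "\<And>e y. e \<in> U \<Longrightarrow> y \<in> K \<Longrightarrow> ((\<lambda>e. H e y) has_derivative H' e y) (at e)"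
    and cH: "continuous_on (U \<times> K) (\<lambda>(e, y). H e y)"
    and cH': "\<And>v. continuous_on (U \<times> K) (\<lambda>(e, y). H' e y v)"
  shows "((\<lambda>e. wint (H e)) has_derivative (\<lambda>v. wint (\<lambda>y. H' e0 y v))) (at e0)"
  unfolding has_derivative_at_alt
proof (intro conjI allI impI)
  have c': "continuous_on K (\<lambda>y. H' e y v)" if "e \<in> U" for e v
    using continuous_on_slice[OF cH' that] .
  have cut: "wint h = wint k" if "\<And>y. y \<in> K \<Longrightarrow> h y = k y" for h k
    unfolding wint_def using that supp_\<phi> by (metis (no_types, lifting) mult_eq_0_iff)
  have lin: "linear (H' e y)" if "e \<in> U" "y \<in> K" for e y
    using has_derivative_linear[OF H[OF that]] .
  have linw: "linear (\<lambda>v. wint (\<lambda>y. H' e0 y v))"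
  proof (rule linearI)
    fix v w c
    show "wint (\<lambda>y. H' e0 y (v + w)) = wint (\<lambda>y. H' e0 y v) + wint (\<lambda>y. H' e0 y w)"
      unfolding wint_add[OF c'[OF U(2)] c'[OF U(2)], symmetric]
      by (rule cut) (rule linear_add[OF lin[OF U(2)]])
    show "wint (\<lambda>y. H' e0 y (c *\<^sub>R v)) = c *\<^sub>R wint (\<lambda>y. H' e0 y v)"
      unfolding real_scaleR_def wint_cmult[symmetric]
      by (rule cut) (simp add: linear_scale[OF lin[OF U(2)]])
  qed
  then show "bounded_linear (\<lambda>v. wint (\<lambda>y. H' e0 y v))"
    by (rule linear_conv_bounded_linear[THEN iffD1])
  fix r :: real assume r: "0 < r"
  define d where "d = r / (mass + 1)"
  have d: "0 < d" "d * mass \<le> r"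
    using r mass_nonneg by (auto simp: d_def field_simps add_nonneg_pos)
  \<comment> \<open>Continuity is only given for the derivative in each fixed direction. A bound by \<open>d / DIM('e)\<close> in
    the basis directions yields a bound by \<open>d\<close> in operator norm.\<close>
  define d' where "d' = d / DIM('e)"
  have d': "0 < d'" using d(1) by (simp add: d'_def)
  have "\<exists>X. e0 \<in> X \<and> open X \<and> (\<forall>e\<in>X \<inter> U. \<forall>y\<in>K. \<bar>H' e y b - H' e0 y b\<bar> \<le> d')" for b
    using continuous_on_prod_compactE[OF cH'[of b] compact_K U(2) d'] by (metis case_prod_conv dist_real_def)
  then obtain X where X: "\<And>b. e0 \<in> X b" "\<And>b. open (X b)"
    "\<And>b e y. e \<in> X b \<Longrightarrow> e \<in> U \<Longrightarrow> y \<in> K \<Longrightarrow> \<bar>H' e y b - H' e0 y b\<bar> \<le> d'"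
    by (metis IntI)
  have "open (U \<inter> (\<Inter>b\<in>Basis. X b))" "e0 \<in> U \<inter> (\<Inter>b\<in>Basis. X b)"
    using U X by (auto intro!: open_Int open_INT)
  then obtain s where s: "0 < s" "ball e0 s \<subseteq> U \<inter> (\<Inter>b\<in>Basis. X b)"
    by (metis openE)
  have onorm: "onorm (H' e y - H' e0 y) \<le> d" if "e \<in> ball e0 s" "y \<in> K" for e y
  proof (rule onorm_bound)
    show "0 \<le> d" using d by simp
    fix v :: 'e
    have eU: "e \<in> U" using s that by blast
    have l: "linear (H' e y - H' e0 y)"
      using lin[OF eU that(2)] lin[OF U(2) that(2)] by (simp add: fun_diff_def linear_compose_sub)
    have "(H' e y - H' e0 y) v = (H' e y - H' e0 y) (\<Sum>b\<in>Basis. (v \<bullet> b) *\<^sub>R b)"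
      by (simp add: euclidean_representation)
    also have "\<dots> = (\<Sum>b\<in>Basis. (v \<bullet> b) * (H' e y b - H' e0 y b))"
      unfolding linear_sum[OF l] linear_scale[OF l] by simp
    finally have "norm ((H' e y - H' e0 y) v) \<le> (\<Sum>b\<in>Basis. \<bar>v \<bullet> b\<bar> * \<bar>H' e y b - H' e0 y b\<bar>)"
      by (simp add: abs_mult[symmetric])
    also have "\<dots> \<le> (\<Sum>b\<in>(Basis :: 'e set). norm v * d')"
    proof (intro sum_mono mult_mono)
      fix b :: 'e assume b: "b \<in> Basis"
      show "\<bar>v \<bullet> b\<bar> \<le> norm v" using b by (rule Basis_le_norm)
      show "\<bar>H' e y b - H' e0 y b\<bar> \<le> d'"
        using s that b eU by (intro X(3)) auto
    qed simp_all
    also have "\<dots> = d * norm v" by (simp add: d'_def)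
    finally show "norm ((H' e y - H' e0 y) v) \<le> d * norm v" .
  qed
  show "\<exists>s>0. \<forall>e. norm (e - e0) < s \<longrightarrow>
      norm (wint (H e) - wint (H e0) - wint (\<lambda>y. H' e0 y (e - e0))) \<le> r * norm (e - e0)"
  proof (intro exI[of _ s] conjI allI impI s(1))
    fix e assume e: "norm (e - e0) < s"
    then have es: "e \<in> ball e0 s" by (simp add: dist_norm norm_minus_commute)
    then have eU: "e \<in> U" using s by blast
    have "\<bar>H e y - H e0 y - H' e0 y (e - e0)\<bar> \<le> norm (e - e0) * d" if y: "y \<in> K" for y
    proof -
      have "norm (H e y - H e0 y - H' e0 y (e - e0)) \<le> norm (e - e0) * d"
      proof (rule differentiable_bound_linearization[where S = "ball e0 s"])
        show "e0 + t *\<^sub>R (e - e0) \<in> ball e0 s" if "t \<in> {0..1}" for t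
        proof -
          have "\<bar>t\<bar> * norm (e - e0) \<le> 1 * norm (e - e0)" using that by (intro mult_right_mono) auto
          then show ?thesis using e by (simp add: dist_norm)
        qed
        show "((\<lambda>e. H e y) has_derivative H' x y) (at x within ball e0 s)" if "x \<in> ball e0 s" for x
          using s that y by (intro has_derivative_at_withinI[OF H]) auto
        show "onorm (H' x y - H' e0 y) \<le> d" if "x \<in> ball e0 s" for x
          by (rule onorm[OF that y])
      qed (use s in simp)
      then show ?thesis by simp
    qed
    moreover have "wint (H e) - wint (H e0) - wint (\<lambda>y. H' e0 y (e - e0))
        = wint (\<lambda>y. H e y - H e0 y - H' e0 y (e - e0))"
      using continuous_on_slice[OF cH eU] continuous_on_slice[OF cH U(2)] c'[OF U(2)]
      by (simp add: wint_diff continuous_on_diff)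
    ultimately have "norm (wint (H e) - wint (H e0) - wint (\<lambda>y. H' e0 y (e - e0)))
        \<le> (norm (e - e0) * d) * mass"
      using continuous_on_slice[OF cH eU] continuous_on_slice[OF cH U(2)] c'[OF U(2)]
      by (simp only: real_norm_def) (intro abs_wint_le continuous_on_diff)
    also have "\<dots> \<le> r * norm (e - e0)"
      using mult_left_mono[OF d(2) norm_ge_zero[of "e - e0"]] by (simp add: mult_ac)
    finally show "norm (wint (H e) - wint (H e0) - wint (\<lambda>y. H' e0 y (e - e0))) \<le> r * norm (e - e0)" .
  qed
qed

end

section \<open>The Riemannian measure of compact sets\<close>

lemma emeasure_compact_finite:
  assumes atlas: "smooth_atlas A" and metric: "riemannian_metric A g"
    and vol: "riemannian_volume A g \<mu>" and K: "compact K"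
  shows "emeasure \<mu> K < \<infinity>"
proof -
  have sets: "sets \<mu> = sets borel" using vol unfolding riemannian_volume_def by blast
  have nbhd: "\<exists>N. open N \<and> x \<in> N \<and> emeasure \<mu> N < \<infinity>" for x
  proof -
    obtain c where c: "c \<in> A" "x \<in> fst c" using atlas unfolding smooth_atlas_def by blast
    note chart = smooth_atlas_chart[OF atlas c(1)]
    obtain R where R: "0 < R" "cball (snd c x) R \<subseteq> chart_range c"
      using chart(2) chart(5)[OF c(2)] open_contains_cball by blast
    let ?N = "fst c \<inter> snd c -` ball (snd c x) R"
    let ?f = "\<lambda>a. sqrt (det (g c (chart_inv c a)))"
    have "smooth_on (chart_range c) (g c \<circ> chart_inv c)"
      using metric c unfolding riemannian_metric_def by blast
    then have "Ck_on 0 (chart_range c) (\<lambda>a. (g c \<circ> chart_inv c) a $ i $ j)" for i j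
      using Ck_on_matrix_nth[OF chart(2)] unfolding smooth_on_def by blast
    from Ck_on_det[OF chart(2) this]
    have "continuous_on (chart_range c) (\<lambda>a. det (g c (chart_inv c a)))" by simp
    then have "continuous_on (cball (snd c x) R) ?f"
      using R(2) by (intro continuous_intros) (rule continuous_on_subset)
    then have "bounded (?f ` cball (snd c x) R)"
      by (intro compact_imp_bounded compact_continuous_image compact_cball)
    then obtain B where B0: "\<forall>y\<in>?f ` cball (snd c x) R. norm y \<le> B"
      unfolding bounded_iff by blast
    have B: "?f a \<le> B" if "a \<in> cball (snd c x) R" for a
      using bspec[OF B0 imageI[OF that]] by simp
    have openN: "open ?N" by (rule continuous_open_preimage[OF chart(3,1) open_ball])
    have img: "snd c ` ?N \<subseteq> ball (snd c x) R" by auto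
    have "emeasure \<mu> ?N = (\<integral>\<^sup>+a\<in>snd c ` ?N. ennreal (?f a) \<partial>lborel)"
    proof -
      have "\<forall>B\<in>sets borel. B \<subseteq> fst c \<longrightarrow> emeasure \<mu> B = (\<integral>\<^sup>+a\<in>snd c ` B. ennreal (?f a) \<partial>lborel)"
        using vol c(1) unfolding riemannian_volume_def by (elim conjE) (erule bspec)
      from bspec[OF this, of ?N] show ?thesis using openN by simp
    qed
    also have "\<dots> \<le> (\<integral>\<^sup>+a. ennreal B * indicator (cball (snd c x) R) a \<partial>lborel)"
    proof (intro nn_integral_mono)
      fix a
      show "ennreal (?f a) * indicator (snd c ` ?N) a \<le> ennreal B * indicator (cball (snd c x) R) a"
      proof (cases "a \<in> snd c ` ?N")
        case True
        then have a: "a \<in> cball (snd c x) R" using img ball_subset_cball by blast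
        show ?thesis using ennreal_leI[OF B[OF a]] True a by simp
      qed simp
    qed
    also have "\<dots> = ennreal B * emeasure lborel (cball (snd c x) R)"
      by (rule nn_integral_cmult_indicator) simp
    also have "\<dots> < \<infinity>"
      using emeasure_bounded_finite[OF bounded_cball, of "snd c x" R]
      by (simp add: ennreal_mult_less_top)
    finally show ?thesis using openN c(2) R(1) by (intro exI[of _ ?N]) auto
  qed
  obtain N where N: "\<And>x. open (N x)" "\<And>x. x \<in> N x" "\<And>x. emeasure \<mu> (N x) < \<infinity>"
    using nbhd by metis
  have "K \<subseteq> (\<Union>x\<in>K. N x)" using N(2) by blast
  then obtain F where F: "F \<subseteq> K" "finite F" "K \<subseteq> (\<Union>x\<in>F. N x)"
    using compactE_image[OF K, of K N] N(1) by metis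
  have "emeasure \<mu> K \<le> emeasure \<mu> (\<Union>x\<in>F. N x)"
    using F N(1) sets by (intro emeasure_mono) auto
  also have "\<dots> \<le> (\<Sum>x\<in>F. emeasure \<mu> (N x))"
    using F N(1) sets by (intro emeasure_subadditive_finite) auto
  also have "\<dots> < \<infinity>"
    using N(3) F(2) by simp
  finally show ?thesis .
qed

section \<open>Dirichlet heat kernels applied to a test function\<close>

locale dirichlet_semigroup = compact_weight M K \<phi>
  for M :: "'p::{t2_space, second_countable_topology} measure" and K \<phi> +
  fixes A :: "('p, 'n::finite) chart set" and g :: "('p, 'n) metric_coeffs"
    and \<Omega> :: "'p set" and q :: "'p \<Rightarrow> 'p \<Rightarrow> real \<Rightarrow> real"
  assumes atlas: "smooth_atlas A" and metric: "riemannian_metric A g"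
    and open_\<Omega>: "open \<Omega>" and K_sub: "K \<subseteq> \<Omega>"
    and K_supp: "closure {y. \<phi> y \<noteq> 0} = K"
    and kernel: "dirichlet_heat_kernel A g M \<Omega> q"
    and \<phi>_range: "\<And>y. 0 \<le> \<phi> y" "\<And>y. \<phi> y \<le> 1"
begin

definition coord_dom :: "('p, 'n) chart \<Rightarrow> (real ^ 'n) set" where
  "coord_dom c = snd c ` (fst c \<inter> \<Omega>)"

text \<open>\<open>R a y t\<close> is of class \<open>C\<^sup>k\<close> in all variables, where \<open>a\<close> is the coordinate vector of the first point in the
  chart \<open>c\<close>, and the second point \<open>y\<close> is read in every chart. Partial derivatives in \<open>a\<close> lower \<open>k\<close> by one and can
  be iterated without reference to the chart for \<open>y\<close>.\<close>

definition kernel_class :: "('p, 'n) chart \<Rightarrow> nat \<Rightarrow> (real ^ 'n \<Rightarrow> 'p \<Rightarrow> real \<Rightarrow> real) \<Rightarrow> bool" where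
  "kernel_class c k R \<longleftrightarrow> (\<forall>d\<in>A. Ck_on k (coord_dom c \<times> coord_dom d \<times> {0<..}) (\<lambda>(a, b, t). R a (chart_inv d b) t))"

lemma coord_dom: 
  assumes "c \<in> A"
  shows "open (coord_dom c)" "a \<in> coord_dom c \<Longrightarrow> a \<in> chart_range c"
    "\<And>p. p \<in> fst c \<Longrightarrow> p \<in> \<Omega> \<Longrightarrow> snd c p \<in> coord_dom c" "a \<in> coord_dom c \<Longrightarrow> chart_inv c a \<in> fst c \<inter> \<Omega>"
proof -
  note chart = smooth_atlas_chart[OF atlas assms]
  have "coord_dom c = chart_range c \<inter> chart_inv c -` \<Omega>"
    using chart(5,6,7,8) unfolding coord_dom_def by (force simp: image_iff)
  moreover have "open (chart_range c \<inter> chart_inv c -` \<Omega>)"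
    by (rule continuous_open_preimage[OF chart(4,2) open_\<Omega>])
  ultimately show "open (coord_dom c)" "a \<in> coord_dom c \<Longrightarrow> a \<in> chart_range c"
    "a \<in> coord_dom c \<Longrightarrow> chart_inv c a \<in> fst c \<inter> \<Omega>"
    using chart(7) by auto
  show "\<And>p. p \<in> fst c \<Longrightarrow> p \<in> \<Omega> \<Longrightarrow> snd c p \<in> coord_dom c" unfolding coord_dom_def by blast
qed

lemma kernel_class_slice:
  assumes c: "c \<in> A" and R: "kernel_class c (Suc k) R"
  shows "a \<in> coord_dom c \<Longrightarrow> y \<in> \<Omega> \<Longrightarrow> 0 < t \<Longrightarrow> (\<lambda>a. R a y t) differentiable (at a)"
    and "kernel_class c k (\<lambda>a y t. pd j (\<lambda>a. R a y t) a)"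
proof -
  have D: "((\<lambda>a. R a (chart_inv d b) t) has_derivative
      (\<lambda>v. frechet_derivative (\<lambda>(a, b, t). R a (chart_inv d b) t) (at (a, b, t)) (v, 0, 0))) (at a)"
    if "d \<in> A" "a \<in> coord_dom c" "b \<in> coord_dom d" "0 < t" for d a b t
  proof -
    let ?F = "\<lambda>(a, b, t). R a (chart_inv d b) t"
    have "?F differentiable (at (a, b, t))"
      using R that unfolding kernel_class_def by simp
    then have F: "(?F has_derivative frechet_derivative ?F (at (a, b, t))) (at (a, b, t))"
      unfolding frechet_derivative_works .
    have "((\<lambda>a. (a, b, t)) has_derivative (\<lambda>v. (v, 0, 0))) (at a)"
      by (intro has_derivative_Pair has_derivative_ident has_derivative_const)
    from has_derivative_compose[OF this F] show ?thesis by simp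
  qed
  show "(\<lambda>a. R a y t) differentiable (at a)" if "a \<in> coord_dom c" "y \<in> \<Omega>" "0 < t"
  proof -
    obtain d where d: "d \<in> A" "y \<in> fst d" using atlas unfolding smooth_atlas_def by blast
    note chart = smooth_atlas_chart[OF atlas d(1)]
    from D[OF d(1) that(1) coord_dom(3)[OF d that(2)] that(3)] show ?thesis
      unfolding chart(6)[OF d(2)] differentiable_def by blast
  qed
  show "kernel_class c k (\<lambda>a y t. pd j (\<lambda>a. R a y t) a)"
    unfolding kernel_class_def
  proof
    fix d assume d: "d \<in> A"
    have S: "open (coord_dom c \<times> coord_dom d \<times> {0::real<..})"
      by (intro open_Times coord_dom(1) c d open_greaterThan)
    have "Ck_on k (coord_dom c \<times> coord_dom d \<times> {0<..})
        (\<lambda>w. frechet_derivative (\<lambda>(a, b, t). R a (chart_inv d b) t) (at w) (axis j 1, 0, 0))"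
      using R d unfolding kernel_class_def by simp
    then show "Ck_on k (coord_dom c \<times> coord_dom d \<times> {0<..}) (\<lambda>(a, b, t). pd j (\<lambda>a. R a (chart_inv d b) t) a)"
      by (subst Ck_on_cong[OF S]) (auto simp: pd_eqI[OF D[OF d]])
  qed
qed

lemma kernel_class_continuous:
  assumes c: "c \<in> A" and R: "kernel_class c 0 R"
  shows "continuous_on (coord_dom c \<times> \<Omega> \<times> {0<..}) (\<lambda>(a, y, t). R a y t)"
proof -
  have "continuous_on (\<Union>d\<in>A. coord_dom c \<times> (fst d \<inter> \<Omega>) \<times> {0<..}) (\<lambda>(a, y, t). R a y t)"
  proof (rule continuous_on_open_UN)
    fix d assume d: "d \<in> A"
    note chart = smooth_atlas_chart[OF atlas d]
    show "open (coord_dom c \<times> (fst d \<inter> \<Omega>) \<times> {0::real<..})"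
      by (intro open_Times open_Int coord_dom(1) c chart open_\<Omega> open_greaterThan)
    have h: "continuous_on (coord_dom c \<times> coord_dom d \<times> {0<..}) (\<lambda>(a, b, t). R a (chart_inv d b) t)"
      using R d unfolding kernel_class_def by simp
    have "continuous_on (coord_dom c \<times> (fst d \<inter> \<Omega>) \<times> {0<..}) (\<lambda>w. snd d (fst (snd w)))"
      by (rule continuous_on_compose2[OF chart(3)]) (auto intro!: continuous_intros)
    then have "continuous_on (coord_dom c \<times> (fst d \<inter> \<Omega>) \<times> {0<..})
        (\<lambda>w. (\<lambda>(a, b, t). R a (chart_inv d b) t) (fst w, snd d (fst (snd w)), snd (snd w)))"
      by (intro continuous_on_compose2[OF h] continuous_on_Pair continuous_on_fst continuous_on_snd
          continuous_on_id) (auto intro: coord_dom(3)[OF d])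
    then show "continuous_on (coord_dom c \<times> (fst d \<inter> \<Omega>) \<times> {0<..}) (\<lambda>(a, y, t). R a y t)"
      by (rule continuous_on_eq) (auto simp: chart(6))
  qed
  moreover have "(\<Union>d\<in>A. coord_dom c \<times> (fst d \<inter> \<Omega>) \<times> {0<..}) = coord_dom c \<times> \<Omega> \<times> {0::real<..}"
    using atlas unfolding smooth_atlas_def by auto
  ultimately show ?thesis by simp
qed

lemma kernel_class_continuous_space:
  assumes "c \<in> A" "kernel_class c 0 R" "0 < t"
  shows "continuous_on (coord_dom c \<times> K) (\<lambda>(a, y). R a y t)"
proof -
  have "continuous_on (coord_dom c \<times> K) (\<lambda>w. (\<lambda>(a, y, t). R a y t) (fst w, snd w, t))"
    by (rule continuous_on_compose2[OF kernel_class_continuous[OF assms(1,2)]])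
       (use K_sub assms(3) in \<open>auto intro!: continuous_intros\<close>)
  then show ?thesis by (simp add: case_prod_unfold)
qed

lemma kernel_class_continuous_time:
  assumes "c \<in> A" "kernel_class c 0 R" "a \<in> coord_dom c"
  shows "continuous_on ({0<..} \<times> K) (\<lambda>(t, y). R a y t)"
proof -
  have "continuous_on ({0<..} \<times> K) (\<lambda>w. (\<lambda>(a, y, t). R a y t) (a, snd w, fst w))"
    by (rule continuous_on_compose2[OF kernel_class_continuous[OF assms(1,2)]])
       (use K_sub assms(3) in \<open>auto intro!: continuous_intros\<close>)
  then show ?thesis by (simp add: case_prod_unfold)
qed

lemma kernel_class_antimono: "kernel_class c m R \<Longrightarrow> k \<le> m \<Longrightarrow> kernel_class c k R"
  unfolding kernel_class_def using Ck_on_antimono by blast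

lemma pd_wint:
  assumes c: "c \<in> A" and R: "kernel_class c 1 R" and a: "a \<in> coord_dom c" and t: "0 < t"
  shows "(\<lambda>a. wint (\<lambda>y. R a y t)) differentiable (at a)"
    and "pd j (\<lambda>a. wint (\<lambda>y. R a y t)) a = wint (\<lambda>y. pd j (\<lambda>a. R a y t) a)"
proof -
  have R1: "kernel_class c (Suc 0) R" using R by simp
  note sl = kernel_class_slice[OF c R1]
  have D: "((\<lambda>a. wint (\<lambda>y. R a y t)) has_derivative
      (\<lambda>v. wint (\<lambda>y. \<Sum>i\<in>UNIV. v $ i * pd i (\<lambda>a. R a y t) a))) (at a)"
  proof (rule has_derivative_wint[OF coord_dom(1)[OF c] a])
    show "((\<lambda>e. R e y t) has_derivative (\<lambda>v. \<Sum>i\<in>UNIV. v $ i * pd i (\<lambda>a. R a y t) e)) (at e)"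
      if e: "e \<in> coord_dom c" "y \<in> K" for e y
    proof -
      have d: "(\<lambda>a. R a y t) differentiable (at e)"
        using sl(1)[OF e(1) _ t] e(2) K_sub by blast
      then show ?thesis
        using frechet_derivative_eq_sum_pd[OF d] unfolding frechet_derivative_works
        by (metis (no_types, lifting) ext real_scaleR_def sum.cong)
    qed
    show "continuous_on (coord_dom c \<times> K) (\<lambda>(e, y). R e y t)"
      by (rule kernel_class_continuous_space[OF c kernel_class_antimono[OF R] t]) simp
    show "continuous_on (coord_dom c \<times> K) (\<lambda>(e, y). \<Sum>i\<in>UNIV. v $ i * pd i (\<lambda>a. R a y t) e)" for v
      using kernel_class_continuous_space[OF c sl(2) t] unfolding case_prod_unfold
      by (intro continuous_on_sum continuous_on_mult continuous_on_const)
  qed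
  then show "(\<lambda>a. wint (\<lambda>y. R a y t)) differentiable (at a)" unfolding differentiable_def by blast
  show "pd j (\<lambda>a. wint (\<lambda>y. R a y t)) a = wint (\<lambda>y. pd j (\<lambda>a. R a y t) a)"
    unfolding pd_eqI[OF D] by (simp add: axis_def if_distrib[of "\<lambda>c. c * _"] cong: if_cong)
qed

text \<open>The Dirichlet heat semigroup applied to \<open>\<phi>\<close>.\<close>

definition flow :: "'p \<Rightarrow> real \<Rightarrow> real" where
  "flow x t = wint (\<lambda>y. q x y t)"

lemma q_class: "c \<in> A \<Longrightarrow> kernel_class c k (\<lambda>a y t. q (chart_inv c a) y t)"
  using kernel unfolding dirichlet_heat_kernel_def kernel_class_def smooth_on_def coord_dom_def by blast

lemma q_continuous: "continuous_on (UNIV \<times> UNIV \<times> {0<..}) (\<lambda>(x, y, t). q x y t)"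
  using kernel unfolding dirichlet_heat_kernel_def by blast

lemma flow_continuous: "continuous_on (UNIV \<times> {0<..}) (\<lambda>(x, t). flow x t)"
proof -
  have "continuous_on ((UNIV \<times> {0<..}) \<times> K) (\<lambda>z. (\<lambda>(x, y, t). q x y t) (fst (fst z), snd z, snd (fst z)))"
    by (rule continuous_on_compose2[OF q_continuous]) (auto intro!: continuous_intros)
  then have "continuous_on ((UNIV \<times> {0<..}) \<times> K) (\<lambda>(e, y). q (fst e) y (snd e))"
    by (simp add: case_prod_unfold)
  from continuous_on_wint[OF this] show ?thesis
    by (simp add: flow_def case_prod_unfold)
qed

lemma flow_outside:
  assumes "x \<notin> \<Omega>"
  shows "flow x t = 0"
proof -
  have "q x y t = 0" for y using kernel assms unfolding dirichlet_heat_kernel_def by blast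
  then show ?thesis by (simp add: flow_def wint_def)
qed

lemma flow_initial:
  assumes "0 < e"
  shows "\<exists>\<tau>>0. \<forall>t. 0 < t \<and> t < \<tau> \<longrightarrow> (\<forall>x\<in>\<Omega>. flow x t \<le> 1 + e)"
proof -
  have lim: "\<forall>f. continuous_on UNIV f \<and> compact (closure {y. f y \<noteq> 0}) \<and> closure {y. f y \<noteq> 0} \<subseteq> \<Omega> \<longrightarrow>
        uniform_limit \<Omega> (\<lambda>t x. \<integral>y. q x y t * f y \<partial>M) f (at_right 0)"
    using kernel unfolding dirichlet_heat_kernel_def by (elim conjE)
  have "uniform_limit \<Omega> (\<lambda>t x. flow x t) \<phi> (at_right 0)"
    unfolding flow_def wint_def
    using lim[THEN spec, of \<phi>] cont_\<phi> compact_K K_sub unfolding K_supp by blast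
  then have "\<forall>\<^sub>F t in at_right 0. \<forall>x\<in>\<Omega>. dist (flow x t) (\<phi> x) < e"
    using assms unfolding uniform_limit_iff by blast
  then obtain \<tau> where "0 < \<tau>" "\<And>t x. 0 < t \<Longrightarrow> t < \<tau> \<Longrightarrow> x \<in> \<Omega> \<Longrightarrow> dist (flow x t) (\<phi> x) < e"
    unfolding eventually_at_right_field by auto
  moreover have "flow x t \<le> 1 + e" if "dist (flow x t) (\<phi> x) < e" for x t
    using that \<phi>_range(2)[of x] by (simp add: dist_real_def)
  ultimately show ?thesis by blast
qed

lemma flow_heat:
  assumes x: "x \<in> \<Omega>" and t: "0 < t"
  shows "heat_at A g flow x t"
  unfolding heat_at_def
proof (intro ballI impI conjI)
  fix c assume c: "c \<in> A" and xc: "x \<in> fst c"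
  note chart = smooth_atlas_chart[OF atlas c]
  define a where "a = snd c x"
  have a: "a \<in> coord_dom c" unfolding a_def by (rule coord_dom(3)[OF c xc x])
  define Q where "Q b y t = q (chart_inv c b) y t" for b y t
  have Q2: "kernel_class c k Q" for k unfolding Q_def[abs_def] by (rule q_class[OF c])
  have Q1: "kernel_class c k (\<lambda>a y t. pd j (\<lambda>a. Q a y t) a)" for j k
    by (rule kernel_class_slice(2)[OF c Q2])
  have Q0: "kernel_class c k (\<lambda>a y t. pd i (\<lambda>a. pd j (\<lambda>a. Q a y t) a) a)" for i j k
    by (rule kernel_class_slice(2)[OF c Q1])
  define W where "W = (\<lambda>b. wint (\<lambda>y. Q b y t))"
  have W: "(\<lambda>y. flow y t) \<circ> chart_inv c = W"
    by (simp add: fun_eq_iff W_def flow_def Q_def)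
  have W1: "W differentiable (at b)" "pd j W b = wint (\<lambda>y. pd j (\<lambda>a. Q a y t) b)" if "b \<in> coord_dom c" for b j
    using pd_wint[OF c Q2 that t] unfolding W_def by auto
  have W2: "(\<lambda>b. wint (\<lambda>y. pd j (\<lambda>a. Q a y t) b)) differentiable (at b)"
    "pd i (\<lambda>b. wint (\<lambda>y. pd j (\<lambda>a. Q a y t) b)) b = wint (\<lambda>y. pd i (\<lambda>a. pd j (\<lambda>a. Q a y t) a) b)"
    if "b \<in> coord_dom c" for b i j
    using pd_wint[OF c Q1 that t] by auto
  have tw: "twice_differentiable W a"
  proof -
    have "pd j W differentiable (at a)" for j
      using differentiable_cong_open[OF coord_dom(1)[OF c] a, of "pd j W" "\<lambda>b. wint (\<lambda>y. pd j (\<lambda>a. Q a y t) b)"]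
        W1(2) W2(1)[OF a] by simp
    then show ?thesis
      unfolding twice_differentiable_def using coord_dom(1)[OF c] a W1(1) by blast
  qed
  then show "twice_differentiable ((\<lambda>y. flow y t) \<circ> chart_inv c) (snd c x)"
    unfolding W a_def .
  have ppW: "pd i (pd j W) a = wint (\<lambda>y. pd i (\<lambda>a. pd j (\<lambda>a. Q a y t) a) a)" for i j
    using pd_cong[OF coord_dom(1)[OF c] a, of "pd j W" "\<lambda>b. wint (\<lambda>y. pd j (\<lambda>a. Q a y t) b)"] W1(2) W2(2)[OF a]
    by simp
  define L where "L s y = laplace_coord (g c \<circ> chart_inv c) (\<lambda>b. Q b y s) a" for s y
  have cL: "continuous_on ({0<..} \<times> K) (\<lambda>(s, y). L s y)"
    using kernel_class_continuous_time[OF c Q0 a] kernel_class_continuous_time[OF c Q1 a]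
    unfolding L_def laplace_coord_def case_prod_unfold
    by (intro continuous_on_sum continuous_on_mult continuous_on_diff continuous_on_const)
  have s0: "continuous_on K (\<lambda>y. R a y t)" if "kernel_class c 0 R" for R
    using continuous_on_slice[OF kernel_class_continuous_space[OF c that t] a] .
  have lapW: "laplacian g c (\<lambda>y. flow y t) x = wint (L t)"
  proof -
    have "laplacian g c (\<lambda>y. flow y t) x = laplace_coord (g c \<circ> chart_inv c) W a"
      unfolding laplacian_eq_laplace_coord[where g = g, OF chart(6)[OF xc]] W a_def ..
    also have "\<dots> = wint (L t)"
      unfolding L_def laplace_coord_def ppW W1(2)[OF a]
      using s0[OF Q0] s0[OF Q1]
      by (simp add: wint_sum wint_cmult wint_diff continuous_on_sum continuous_on_diff continuous_on_mult)
    finally show ?thesis .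
  qed
  have qt: "((\<lambda>s. q x y s) has_real_derivative L s y) (at s)" if "0 < s" "y \<in> K" for s y
  proof -
    have "((\<lambda>s. q x y s) has_real_derivative laplacian g c (\<lambda>z. q z y s) x) (at s)"
      using kernel c xc x that K_sub unfolding dirichlet_heat_kernel_def by blast
    moreover have "laplacian g c (\<lambda>z. q z y s) x = L s y"
      unfolding laplacian_eq_laplace_coord[where g = g, OF chart(6)[OF xc]] L_def a_def
      by (simp add: comp_def Q_def)
    ultimately show ?thesis by simp
  qed
  have "((\<lambda>s. flow x s) has_derivative (\<lambda>h. wint (\<lambda>y. L t y * h))) (at t)"
    unfolding flow_def
  proof (rule has_derivative_wint[where U = "{0<..}"])
    show "open {0::real<..}" "t \<in> {0<..}" using t by auto
    show "((\<lambda>s. q x y s) has_derivative (\<lambda>h. L s y * h)) (at s)" if "s \<in> {0<..}" "y \<in> K" for s y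
      using qt[of s y] that unfolding has_field_derivative_def by (simp add: mult_commute_abs)
    have "continuous_on ({0<..} \<times> K) (\<lambda>z. (\<lambda>(x, y, t). q x y t) (x, snd z, fst z))"
      by (rule continuous_on_compose2[OF q_continuous]) (auto intro!: continuous_intros)
    then show "continuous_on ({0<..} \<times> K) (\<lambda>(s, y). q x y s)"
      by (simp add: case_prod_unfold)
    show "continuous_on ({0<..} \<times> K) (\<lambda>(s, y). L s y * h)" for h
      using cL unfolding case_prod_unfold by (intro continuous_intros)
  qed
  moreover have "wint (\<lambda>y. L t y * h) = wint (L t) * h" for h
    using wint_cmult[of h "L t"] by (simp add: mult.commute)
  ultimately show "((\<lambda>s. flow x s) has_real_derivative laplacian g c (\<lambda>y. flow y t) x) (at t)"
    unfolding has_field_derivative_def lapW by simp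
qed

lemma deficit_heat:
  assumes "x \<in> \<Omega>" "0 < t"
  shows "heat_at A g (\<lambda>x t. 1 - flow x t) x t"
  unfolding heat_at_def
proof (intro ballI impI)
  fix c assume c: "c \<in> A" "x \<in> fst c"
  note chart = smooth_atlas_chart[OF atlas c(1)]
  have h: "twice_differentiable ((\<lambda>y. flow y t) \<circ> chart_inv c) (snd c x)"
    "((\<lambda>s. flow x s) has_real_derivative laplacian g c (\<lambda>y. flow y t) x) (at t)"
    using flow_heat[OF assms] c unfolding heat_at_def by blast+
  have eq: "(\<lambda>y. 1 - flow y t) = (\<lambda>y. 1 + (- 1) * flow y t + 0 * flow y t)" by simp
  have "twice_differentiable ((\<lambda>y. 1 - flow y t) \<circ> chart_inv c) (snd c x)"
    "laplacian g c (\<lambda>y. 1 - flow y t) x = - laplacian g c (\<lambda>y. flow y t) x"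
    unfolding eq
    using laplacian_affine(1)[OF chart(6)[OF c(2)] h(1) h(1), where k = 1 and r = "- 1" and s = 0]
      laplacian_affine(2)[OF chart(6)[OF c(2)] h(1) h(1), where k = 1 and r = "- 1" and s = 0 and g = g]
    by simp_all
  then show "twice_differentiable ((\<lambda>y. 1 - flow y t) \<circ> chart_inv c) (snd c x) \<and>
      ((\<lambda>s. 1 - flow x s) has_real_derivative laplacian g c (\<lambda>y. 1 - flow y t) x) (at t)"
    by (auto intro!: derivative_eq_intros h(2))
qed

text \<open>Both bounds hold independently of \<open>\<Omega>\<close> and \<open>\<phi>\<close>, which is what allows an exhaustion. The first
  one is a comparison up to the time \<open>t\<close> with a solution of the heat equation that is at least \<open>F\<close> at
  the beginning and takes the value \<open>exp (\<kappa> t) F\<close>, for this fixed \<open>t\<close>, on the boundary.\<close>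

lemma deficit_comparison:
  assumes closure: "compact (closure \<Omega>)"
    and f: "smooth_map A f" "\<And>x. 0 \<le> f x" "\<And>x. f x \<le> F"
    and f_sub: "\<And>c x. c \<in> A \<Longrightarrow> x \<in> fst c \<Longrightarrow> \<kappa> * f x \<le> laplacian g c f x"
    and \<kappa>: "0 < \<kappa>" and t: "0 < t"
  shows "exp (\<kappa> * t) * f x \<le> F + (exp (\<kappa> * t) - 1) * F * (1 - flow x t)" and "flow x t \<le> 1"
proof -
  have cont: "continuous_on (UNIV \<times> {0<..}) (\<lambda>(x, t). 1 - flow x t)"
    using flow_continuous unfolding case_prod_unfold by (intro continuous_intros)
  have init: "\<exists>\<tau>>0. \<forall>t. 0 < t \<and> t < \<tau> \<longrightarrow> (\<forall>x\<in>\<Omega>. - e \<le> 1 - flow x t)" if "0 < e" for e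
    using flow_initial[OF that] by (simp add: algebra_simps)
  have F0: "0 \<le> F" using f(2)[of x] f(3)[of x] by linarith
  have "1 \<le> exp (\<kappa> * t)" using \<kappa> t by simp
  then have Fexp: "F \<le> F * exp (\<kappa> * t)" using mult_left_mono[OF _ F0] by fastforce
  note cmp = subsolution_comparison[OF atlas metric open_\<Omega> closure cont _ deficit_heat init f f_sub
      _ _ _ \<kappa> _ _ t order_refl, of _ _ _ x]
  have "1 * exp (\<kappa> * t) * f x \<le> F + (exp (\<kappa> * t) - 1) * F * (1 - flow x t)"
    using \<kappa> t F0 Fexp by (intro cmp) (auto simp: flow_outside algebra_simps)
  then show "exp (\<kappa> * t) * f x \<le> F + (exp (\<kappa> * t) - 1) * F * (1 - flow x t)" by simp
  have "0 * exp (\<kappa> * t) * f x \<le> 0 + 1 * (1 - flow x t)"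
    using \<kappa> t F0 by (intro cmp) (auto simp: flow_outside)
  then show "flow x t \<le> 1" by simp
qed

end

section \<open>Stochastic completeness excludes bounded solutions of \<open>\<Delta> f \<ge> \<kappa> f\<close>\<close>

lemma bump_function:
  fixes A :: "('p::{t2_space, second_countable_topology}, 'n::finite) chart set"
  assumes atlas: "smooth_atlas A" and C: "compact C" and \<Omega>: "open \<Omega>" "C \<subseteq> \<Omega>"
  obtains \<phi> :: "'p \<Rightarrow> real" where "continuous_on UNIV \<phi>" "\<And>y. 0 \<le> \<phi> y" "\<And>y. \<phi> y \<le> 1"
    "\<And>y. y \<in> C \<Longrightarrow> \<phi> y = 1" "closure {y. \<phi> y \<noteq> 0} \<subseteq> \<Omega>"
proof -
  have "locally_compact_space (euclidean :: 'p topology)"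
    unfolding locally_compact_space_def
  proof
    fix x :: 'p
    obtain c where c: "c \<in> A" "x \<in> fst c" using atlas unfolding smooth_atlas_def by blast
    note chart = smooth_atlas_chart[OF atlas c(1)]
    obtain R where R: "0 < R" "cball (snd c x) R \<subseteq> chart_range c"
      using chart(2) chart(5)[OF c(2)] open_contains_cball by blast
    have "openin euclidean (fst c \<inter> snd c -` ball (snd c x) R)"
      unfolding open_openin[symmetric] by (rule continuous_open_preimage[OF chart(3,1) open_ball])
    moreover have "compactin euclidean (chart_inv c ` cball (snd c x) R)"
      unfolding compactin_euclidean_iff
      by (intro compact_continuous_image compact_cball continuous_on_subset[OF chart(4) R(2)])
    moreover have "x \<in> fst c \<inter> snd c -` ball (snd c x) R" using c(2) R(1) by simp
    moreover have "fst c \<inter> snd c -` ball (snd c x) R \<subseteq> chart_inv c ` cball (snd c x) R"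
    proof
      fix y assume "y \<in> fst c \<inter> snd c -` ball (snd c x) R"
      then show "y \<in> chart_inv c ` cball (snd c x) R"
        by (intro rev_image_eqI[of "snd c y"]) (use chart(6)[of y] in auto)
    qed
    ultimately show "\<exists>U K. openin euclidean U \<and> compactin euclidean K \<and> x \<in> U \<and> U \<subseteq> K" by blast
  qed
  moreover have "Hausdorff_space (euclidean :: 'p topology)"
    unfolding Hausdorff_space_def disjnt_def open_openin[symmetric] using hausdorff by auto
  ultimately have reg: "completely_regular_space (euclidean :: 'p topology)"
    using locally_compact_regular_imp_completely_regular_space by blast
  have "closedin euclidean (- \<Omega>)" "compactin euclidean C" "disjnt C (- \<Omega>)"
    using C \<Omega> by (auto simp: disjnt_def closed_Compl)
  then obtain f :: "'p \<Rightarrow> real" where f: "continuous_map euclidean euclideanreal f" "f ` C \<subseteq> {1}" "f ` (- \<Omega>) \<subseteq> {0}"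
    using Urysohn_completely_regular_compact_closed_alt[OF reg] by metis
  have cf: "continuous_on UNIV f" using f(1) by simp
  \<comment> \<open>The Urysohn function vanishes outside \<open>\<Omega>\<close>; cutting it off at \<open>1 / 2\<close> moves the closure of the
    support into \<open>\<Omega>\<close>.\<close>
  define \<phi> where "\<phi> y = max 0 (min 1 (2 * f y - 1))" for y
  show ?thesis
  proof (rule that[of \<phi>])
    show "continuous_on UNIV \<phi>" unfolding \<phi>_def by (intro continuous_intros cf)
    show "0 \<le> \<phi> y" "\<phi> y \<le> 1" for y by (auto simp: \<phi>_def)
    show "\<phi> y = 1" if "y \<in> C" for y using f(2) that by (auto simp: \<phi>_def)
    have "closed {y. 1 / 2 \<le> f y}" by (intro closed_Collect_le continuous_on_const cf)
    moreover have "{y. \<phi> y \<noteq> 0} \<subseteq> {y. 1 / 2 \<le> f y}" by (auto simp: \<phi>_def)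
    ultimately have "closure {y. \<phi> y \<noteq> 0} \<subseteq> {y. 1 / 2 \<le> f y}" by (rule closure_minimal[rotated])
    also have "\<dots> \<subseteq> \<Omega>" using f(3) by force
    finally show "closure {y. \<phi> y \<noteq> 0} \<subseteq> \<Omega>" .
  qed
qed

text \<open>If \<open>f\<close> is bounded with \<open>\<Delta> f \<ge> \<kappa> f\<close>, heat must be lost. Where \<open>f\<close> is close to its supremum \<open>F\<close>, the number
  \<open>exp (\<kappa> t) f\<close> exceeds \<open>F\<close>, so that by comparison the deficits \<open>1 - flow\<close> are bounded below, uniformly along the
  exhaustion. By the strong minimum principle the same holds at the given point \<open>x0\<close> and time \<open>t0\<close>. With
  Fatou's lemma the total heat \<open>\<integral> p x0 y t0\<close> is less than \<open>1\<close>.\<close>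

lemma no_bounded_subsolution:
  fixes A :: "('p::{t2_space, second_countable_topology}, 'n::finite) chart set"
  assumes atlas: "smooth_atlas A" and metric: "riemannian_metric A g"
    and conn: "connected (UNIV :: 'p set)" and complete: "stochastically_complete A g"
    and f: "smooth_map A f" "\<And>x. 0 < f x" "bdd_above (range f)" and \<kappa>: "0 < \<kappa>"
    and f_sub: "\<And>c x. c \<in> A \<Longrightarrow> x \<in> fst c \<Longrightarrow> \<kappa> * f x \<le> laplacian g c f x"
  shows False
proof -
  obtain \<mu> p x0 t0 where vol: "riemannian_volume A g \<mu>" and hk: "heat_kernel A g \<mu> p"
    and t0: "0 < t0" and one: "(\<integral>\<^sup>+y. ennreal (p x0 y t0) \<partial>\<mu>) = 1"
    using complete unfolding stochastically_complete_def by blast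
  obtain \<Omega> q where \<Omega>: "\<And>k. open (\<Omega> k)" "\<And>k. compact (closure (\<Omega> k))" "\<And>k. closure (\<Omega> k) \<subseteq> \<Omega> (Suc k)"
    "(\<Union>k. \<Omega> k) = UNIV" and q: "\<And>k::nat. dirichlet_heat_kernel A g \<mu> (\<Omega> k) (q k)"
    and lim: "\<And>x y t. 0 < t \<Longrightarrow> (\<lambda>k. q k x y t) \<longlonglongrightarrow> p x y t"
    using hk unfolding heat_kernel_def by blast
  have sets: "sets \<mu> = sets borel" using vol unfolding riemannian_volume_def by blast
  have "\<exists>\<phi>. continuous_on UNIV \<phi> \<and> (\<forall>y. 0 \<le> \<phi> y) \<and> (\<forall>y. \<phi> y \<le> 1) \<and> (\<forall>y\<in>closure (\<Omega> k). \<phi> y = 1)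
      \<and> closure {y. \<phi> y \<noteq> (0::real)} \<subseteq> \<Omega> (Suc k)" for k
    by (rule bump_function[OF atlas \<Omega>(2)[of k] \<Omega>(1)[of "Suc k"] \<Omega>(3)[of k]]) blast
  then obtain \<phi> where \<phi>: "\<And>k. continuous_on UNIV (\<phi> k)" "\<And>k y. 0 \<le> \<phi> k y" "\<And>k y. \<phi> k y \<le> 1"
    "\<And>k y. y \<in> closure (\<Omega> k) \<Longrightarrow> \<phi> k y = 1" "\<And>k. closure {y. \<phi> k y \<noteq> (0::real)} \<subseteq> \<Omega> (Suc k)"
    by metis
  define K where "K k = closure {y. \<phi> k y \<noteq> 0}" for k
  have K: "compact (K k)" for k
  proof -
    have "K k \<subseteq> closure (\<Omega> (Suc k))" using \<phi>(5)[of k] closure_subset unfolding K_def by blast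
    then show ?thesis
      using compact_Int_closed[OF \<Omega>(2), of "K k" "Suc k"] by (simp add: Int_absorb1 K_def)
  qed
  have sg: "dirichlet_semigroup \<mu> (K k) (\<phi> k) A g (\<Omega> (Suc k)) (q (Suc k))" for k
  proof
    show "emeasure \<mu> (K k) < \<infinity>" by (rule emeasure_compact_finite[OF atlas metric vol K])
    show "\<phi> k y = 0" if "y \<notin> K k" for y
      using that subsetD[OF closure_subset[of "{y. \<phi> k y \<noteq> 0}"], of y] unfolding K_def by blast
    show "K k \<subseteq> \<Omega> (Suc k)" using \<phi>(5) by (simp add: K_def)
  qed (use sets K \<phi> atlas metric \<Omega> q in \<open>simp_all add: K_def\<close>)
  define w where "w k x t = (\<integral>y. q (Suc k) x y t * \<phi> k y \<partial>\<mu>)" for k x t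
  have w_eq: "dirichlet_semigroup.flow \<mu> (\<phi> k) (q (Suc k)) = w k" for k
    unfolding dirichlet_semigroup.flow_def[OF sg] compact_weight.wint_def[OF dirichlet_semigroup.axioms(1)[OF sg]]
      w_def by (simp add: fun_eq_iff)
  define F where "F = (SUP x. f x)"
  have fF: "f x \<le> F" for x unfolding F_def by (rule cSUP_upper[OF UNIV_I f(3)])
  have F: "0 < F" using f(2) fF less_le_trans by blast
  note dc = dirichlet_semigroup.deficit_comparison[OF sg \<Omega>(2) f(1) less_imp_le[OF f(2)] fF _ \<kappa>,
      unfolded w_eq]
  have cmp: "exp (\<kappa> * t) * f x \<le> F + (exp (\<kappa> * t) - 1) * F * (1 - w k x t)" "w k x t \<le> 1"
    if "0 < t" for k x t
    by (rule dc(1)[OF f_sub that]; assumption) (rule dc(2)[OF f_sub that]; assumption)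
  define \<D> where "\<D> = range (\<lambda>k x t. 1 - w k x t)"
  have capped: "capped_heat_function A g D" if D\<D>: "D \<in> \<D>" for D
  proof -
    obtain k where D: "D = (\<lambda>x t. 1 - w k x t)" using D\<D> unfolding \<D>_def by blast
    have "continuous_on (UNIV \<times> {0<..}) (\<lambda>z. w k (fst z) (snd z))"
      using dirichlet_semigroup.flow_continuous[OF sg, of k] unfolding w_eq case_prod_unfold .
    then have "continuous_on (UNIV \<times> {0<..}) (\<lambda>(x, t). D x t)"
      unfolding D case_prod_unfold by (intro continuous_intros)
    moreover have "heat_at A g D x t" if "0 < t" "D x t < 1" for x t
    proof -
      have "x \<in> \<Omega> (Suc k)"
        using that(2) dirichlet_semigroup.flow_outside[OF sg, of x k t] unfolding w_eq D by force
      then show ?thesis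
        using dirichlet_semigroup.deficit_heat[OF sg _ that(1)] unfolding w_eq D by blast
    qed
    moreover have "0 \<le> D x t" if "0 < t" for x t
      using cmp(2)[OF that, where k = k and x = x] unfolding D by simp
    ultimately show ?thesis unfolding capped_heat_function_def by blast
  qed
  \<comment> \<open>On \<open>N\<close> the comparison at time \<open>t0 / 2\<close> gives the deficit \<open>1 / 2\<close>: the threshold is the mean of \<open>F\<close> and
    \<open>F / e\<close>.\<close>
  define e where "e = exp (\<kappa> * (t0 / 2))"
  have e: "1 < e" using \<kappa> t0 by (simp add: e_def)
  define N where "N = {x. F * (e + 1) / (2 * e) < f x}"
  have "open N"
    unfolding N_def by (intro open_Collect_less continuous_on_const smooth_map_continuous[OF atlas f(1)])
  moreover have "N \<noteq> {}"
  proof -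
    have "F * (e + 1) / (2 * e) < F" using F e by (simp add: field_simps)
    then obtain x where "F * (e + 1) / (2 * e) < f x"
      unfolding F_def using less_cSUP_iff[OF UNIV_not_empty f(3)] by blast
    then show ?thesis unfolding N_def by blast
  qed
  moreover have "1 / 2 \<le> D x (t0 / 2)" if D: "D \<in> \<D>" and x: "x \<in> N" for D x
  proof -
    obtain k where D: "D = (\<lambda>x t. 1 - w k x t)" using D unfolding \<D>_def by blast
    have "F * (e + 1) / 2 \<le> e * f x"
      using x e unfolding N_def by (simp add: field_simps)
    also have "\<dots> \<le> F + (e - 1) * F * D x (t0 / 2)"
      using cmp(1)[where t = "t0 / 2" and x = x and k = k] t0 unfolding e_def D by simp
    finally have "F * (e + 1) / 2 \<le> F + (e - 1) * F * D x (t0 / 2)" .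
    moreover have "((e - 1) * F) * (1 / 2) = F * (e + 1) / 2 - F" by (simp add: field_simps)
    ultimately have "((e - 1) * F) * (1 / 2) \<le> ((e - 1) * F) * D x (t0 / 2)" by simp
    moreover have "0 < (e - 1) * F" using e F by simp
    ultimately show ?thesis using mult_le_cancel_left_pos by blast
  qed
  ultimately obtain \<eta> where \<eta>: "0 < \<eta>" "\<And>D. D \<in> \<D> \<Longrightarrow> \<eta> \<le> D x0 t0"
    using positivity_propagates[OF atlas metric conn capped, of \<D> "t0 / 2" t0 N "1 / 2" x0] t0 by auto
  have w_le: "w k x0 t0 \<le> 1 - \<eta>" for k
    using \<eta>(2)[of "\<lambda>x t. 1 - w k x t"] unfolding \<D>_def by auto
  define u where "u k y = ennreal (q (Suc k) x0 y t0 * \<phi> k y)" for k y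
  have slice: "continuous_on UNIV (\<lambda>y. q k x0 y t0)" for k
  proof -
    have "continuous_on (UNIV \<times> UNIV \<times> {0<..}) (\<lambda>(x, y, t). q k x y t)"
      using q[of k] unfolding dirichlet_heat_kernel_def by blast
    then have "continuous_on UNIV (\<lambda>y. (\<lambda>(x, y, t). q k x y t) (x0, y, t0))"
      by (rule continuous_on_compose2) (use t0 in \<open>auto intro!: continuous_intros\<close>)
    then show ?thesis by simp
  qed
  have q0: "0 \<le> q k x y t" for k x y t
    using q[of k] unfolding dirichlet_heat_kernel_def by blast
  have u_meas: "u k \<in> borel_measurable \<mu>" for k
  proof -
    have "(\<lambda>y. q (Suc k) x0 y t0 * \<phi> k y) \<in> borel_measurable borel"
      by (intro borel_measurable_continuous_onI continuous_on_mult slice \<phi>(1))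
    then have "(\<lambda>y. q (Suc k) x0 y t0 * \<phi> k y) \<in> borel_measurable \<mu>"
      using measurable_cong_sets[OF sets refl] by blast
    then show ?thesis unfolding u_def[abs_def] by measurable
  qed
  have u_int: "(\<integral>\<^sup>+y. u k y \<partial>\<mu>) \<le> ennreal (1 - \<eta>)" for k
  proof -
    have "integrable \<mu> (\<lambda>y. q (Suc k) x0 y t0 * \<phi> k y)"
      by (rule compact_weight.integrable_wint[OF dirichlet_semigroup.axioms(1)[OF sg]])
         (rule continuous_on_subset[OF slice subset_UNIV])
    then have "(\<integral>\<^sup>+y. u k y \<partial>\<mu>) = ennreal (w k x0 t0)"
      unfolding u_def w_def using q0 \<phi>(2) by (intro nn_integral_eq_integral) auto
    then show ?thesis using w_le by (simp add: ennreal_leI)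
  qed
  have "(\<lambda>k. u k y) \<longlonglongrightarrow> ennreal (p x0 y t0)" for y
  proof -
    have mono: "\<Omega> m \<subseteq> \<Omega> k" if "m \<le> k" for m k
      using that by (rule lift_Suc_mono_le[rotated]) (use \<Omega>(3) closure_subset in blast)
    obtain m where m: "y \<in> \<Omega> m" using \<Omega>(4) by blast
    have "u k y = ennreal (q (Suc k) x0 y t0)" if "m \<le> k" for k
    proof -
      have "y \<in> closure (\<Omega> k)" using mono[OF that] m closure_subset by blast
      then show ?thesis by (simp add: u_def \<phi>(4))
    qed
    then have "\<forall>\<^sub>F k in sequentially. ennreal (q (Suc k) x0 y t0) = u k y"
      by (intro eventually_sequentiallyI[of m]) simp
    moreover have "(\<lambda>k. ennreal (q (Suc k) x0 y t0)) \<longlonglongrightarrow> ennreal (p x0 y t0)"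
      using lim[OF t0, of x0 y] by (intro tendsto_ennrealI LIMSEQ_Suc)
    ultimately show ?thesis by (rule Lim_transform_eventually[rotated])
  qed
  then have "liminf (\<lambda>k. u k y) = ennreal (p x0 y t0)" for y
    by (intro lim_imp_Liminf) simp_all
  then have "1 = (\<integral>\<^sup>+y. liminf (\<lambda>k. u k y) \<partial>\<mu>)" using one by simp
  also have "\<dots> \<le> liminf (\<lambda>k. \<integral>\<^sup>+y. u k y \<partial>\<mu>)"
    by (rule nn_integral_liminf[OF u_meas])
  also have "\<dots> \<le> liminf (\<lambda>k. ennreal (1 - \<eta>))"
    by (intro Liminf_mono always_eventually allI u_int)
  also have "\<dots> = ennreal (1 - \<eta>)"
    by (simp add: Liminf_const)
  also have "\<dots> < 1" using \<eta>(1) by (simp add: ennreal_less_one_iff)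
  finally show False by simp
qed

section \<open>Nonexistence of weakly trapped immersions\<close>

theorem theorem4p11:
  fixes A :: "('p::{t2_space, second_countable_topology}, 'n::finite) chart set"
    and g :: "('p, 'n) metric_coeffs"
  assumes "2 \<le> CARD('n)" and "CARD('n) \<le> 4"
    and "CARD('k::finite) + 1 = CARD('n) + 2"
    and "smooth_atlas A"
    and "connected (UNIV :: 'p set)"
    and "riemannian_metric A g"
    and "stochastically_complete A g"
    and "inf_scalar_curvature A g > 0"
  shows "\<not> (\<exists>(\<psi> :: 'p \<Rightarrow> real \<times> (real ^ 'k)) (lam :: 'p \<Rightarrow> real).
      spacelike_immersion A \<psi> \<and> range \<psi> \<subseteq> future_light_cone \<and> weakly_trapped A \<psi> \<and>
      smooth_map A lam \<and> (\<forall>p. lam p > 0) \<and> bdd_above (range lam) \<and>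
      conformal_metrics A (induced_metric \<psi>) lam g)"
proof
  assume "\<exists>(\<psi> :: 'p \<Rightarrow> real \<times> (real ^ 'k)) (lam :: 'p \<Rightarrow> real).
      spacelike_immersion A \<psi> \<and> range \<psi> \<subseteq> future_light_cone \<and> weakly_trapped A \<psi> \<and>
      smooth_map A lam \<and> (\<forall>p. lam p > 0) \<and> bdd_above (range lam) \<and>
      conformal_metrics A (induced_metric \<psi>) lam g"
  then obtain \<psi> :: "'p \<Rightarrow> real \<times> (real ^ 'k)" and lam :: "'p \<Rightarrow> real" where
    \<psi>: "spacelike_immersion A \<psi>" "range \<psi> \<subseteq> future_light_cone" "weakly_trapped A \<psi>"
    and lam: "smooth_map A lam" "\<And>p. lam p > 0" "bdd_above (range lam)"
    and conf: "conformal_metrics A (induced_metric \<psi>) lam g"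
    by blast
  obtain S :: real where S: "0 < S" "ereal S < inf_scalar_curvature A g"
    using ereal_dense2[OF assms(8)] by (metis ereal_less(2))
  have scal: "S \<le> scalar_curvature g c p" if "c \<in> A" "p \<in> fst c" for c p
  proof -
    have "inf_scalar_curvature A g \<le> ereal (scalar_curvature g c p)"
      unfolding inf_scalar_curvature_def using that by (intro INF_lower2[of c] INF_lower) auto
    then have "ereal S \<le> ereal (scalar_curvature g c p)" using S(2) by (metis less_imp_le order_trans)
    then show ?thesis by simp
  qed
  have n: "0 < 2 * (real CARD('n) - 1)" using assms(1) by simp
  show False
  proof (rule no_bounded_subsolution[OF assms(4,6,5,7) lam])
    show "0 < S / (2 * (real CARD('n) - 1))" using S(1) n by simp
    fix c p assume cp: "c \<in> A" "p \<in> fst c"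
    have "S / (2 * (real CARD('n) - 1)) * lam p
        \<le> scalar_curvature g c p / (2 * (real CARD('n) - 1)) * lam p"
      using scal[OF cp] n less_imp_le[OF lam(2)[of p]]
      by (intro mult_right_mono divide_right_mono) auto
    also have "\<dots> \<le> laplacian g c lam p"
      by (rule laplacian_conformal_factor_ge[OF assms(1-4,6) \<psi> lam(1,2) conf cp])
    finally show "S / (2 * (real CARD('n) - 1)) * lam p \<le> laplacian g c lam p" .
  qed
qed

end
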